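(* Let $(C,\triangle_\prec,\triangle_\succ)$ be a dendriform coalgebra. When $M=C$ with the bicomodule structure given by $\triangle^l_\prec=\triangle^r_\prec=\triangle_\prec$ and $\triangle^l_\succ=\triangle^r_\succ=\triangle_\succ$, the coboundary map $\delta_c$ on $C^n_{\mathrm{coDend}}(C,C)=\mathcal O(n)$ coincides with the differential induced from the multiplication $\triangle\in\mathcal O(2)$ on the non-symmetric operad $\mathcal O$. Therefore, the cohomology $\bigoplus_{n\ge1}H^n_{\mathrm{coDend}}(C,C)$ inherits a Gerstenhaber algebra structure. The first observation also ensures that $(\delta_c)^2=0$ for the coboundary map $\delta_c$ with coefficients in an arbitrary bicomodule $M$ over $C$.
   Context: All vector spaces, linear maps and tensor products are over a field $\mathbb K$ of characteristic zero. A dendriform coalgebra $(C,\triangle_\prec,\triangle_\succ)$ is a vector space $C$ with linear maps $\triangle_\prec,\triangle_\succ:C\to C\otimes C$ satisfying (1) $(\triangle_\prec\otimes\mathrm{id})\circ\triangle_\prec=(\mathrm{id}\otimes(\triangle_\prec+\triangle_\succ))\circ\triangle_\prec$, (2) $(\triangle_\succ\otimes\mathrm{id})\circ\triangle_\prec=(\mathrm{id}\otimes\triangle_\prec)\circ\triangle_\succ$, (3) $((\triangle_\prec+\triangle_\succ)\otimes\mathrm{id})\circ\triangle_\succ=(\mathrm{id}\otimes\triangle_\succ)\circ\triangle_\succ$. A bicomodule over $C$ is a vector space $M$ with linear maps $\triangle^l_\prec,\triangle^l_\succ:M\to C\otimes M$ and $\triangle^r_\prec,\triangle^r_\succ:M\to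 M\otimes C$ satisfying the nine identities $(\triangle_\prec\otimes\mathrm{id})\triangle^l_\prec=(\mathrm{id}\otimes(\triangle^l_\prec+\triangle^l_\succ))\triangle^l_\prec$, $(\triangle_\succ\otimes\mathrm{id})\triangle^l_\prec=(\mathrm{id}\otimes\triangle^l_\prec)\triangle^l_\succ$, $((\triangle_\prec+\triangle_\succ)\otimes\mathrm{id})\triangle^l_\succ=(\mathrm{id}\otimes\triangle^l_\succ)\triangle^l_\succ$; $(\triangle^l_\prec\otimes\mathrm{id})\triangle^r_\prec=(\mathrm{id}\otimes(\triangle^r_\prec+\triangle^r_\succ))\triangle^l_\prec$, $(\triangle^l_\succ\otimes\mathrm{id})\triangle^r_\prec=(\mathrm{id}\otimes\triangle^r_\prec)\triangle^l_\succ$, $((\triangle^l_\prec+\triangle^l_\succ)\otimes\mathrm{id})\triangle^r_\succ=(\mathrm{id}\otimes\triangle^r_\succ)\triangle^l_\succ$; $(\triangle^r_\prec\otimes\mathrm{id})\triangle^r_\prec=(\mathrm{id}\otimes(\triangle_\prec+\triangle_\succ))\triangle^r_\prec$, $(\triangle^r_\succ\otimes\mathrm{id})\triangle^r_\prec=(\mathrm{id}\otimes\triangle_\prec)\triangle^r_\succ$, $((\triangle^r_\prec+\triangle^r_\succ)\otimes\mathrm{id})\triangle^r_\succ=(\mathrm{id}\otimes\triangle_\succ)\triangle^r_\succ$. Combinatorial maps. $C_n=\{[1],\dots,[n]\}$ and $\mathbb K[C_n]$ is the vector space with basis $C_n$. For $m,n\ge1$, $1\le i\le m$ define $R_0^{m,i,n}:C_{m+n-1}\to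 C_m$ by $[r]\mapsto[r]$ if $r\le i-1$, $[r]\mapsto[i]$ if $i\le r\le i+n-1$, $[r]\mapsto[r-n+1]$ if $i+n\le r\le m+n-1$; and $R_1^{m,i,n}:C_{m+n-1}\to\mathbb K[C_n]$ by $[r]\mapsto[r-i+1]$ if $i\le r\le i+n-1$ and $[r]\mapsto[1]+\cdots+[n]$ otherwise. For $f\in\mathrm{Hom}(\mathbb K[C_n]\otimes X,Y)$ and $x\in\mathbb K[C_n]$ write $f_x=f(x;-):X\to Y$ (linear in $x$). Cochain groups and coboundary. Put $\triangle_{[1]}=\triangle_\prec$, $\triangle_{[2]}=\triangle_\succ$, $\triangle^l_{[1]}=\triangle^l_\prec$, $\triangle^l_{[2]}=\triangle^l_\succ$, $\triangle^r_{[1]}=\triangle^r_\prec$, $\triangle^r_{[2]}=\triangle^r_\succ$, extended linearly to $\mathbb K[C_2]$. Set $C^0_{\mathrm{coDend}}(M,C)=0$, $C^n_{\mathrm{coDend}}(M,C)=\mathrm{Hom}(\mathbb K[C_n]\otimes M,C^{\otimes n})$ for $n\ge1$, and for $\sigma\in C^n_{\mathrm{coDend}}(M,C)$, $[r]\in C_{n+1}$, $$(\delta_c\sigma)_{[r]}=(\mathrm{id}\otimes\sigma_{R_1^{2,2,n}[r]})\circ\triangle^l_{R_0^{2,2,n}[r]}+\sum_{i=1}^n(-1)^i(\mathrm{id}^{\otimes(i-1)}\otimes\triangle_{R_1^{n,i,2}[r]}\otimes\mathrm{id}^{\otimes(n-i)})\circ\sigma_{R_0^{n,i,2}[r]}+(-1)^{n+1}(\sigma_{R_1^{2,1,n}[r]}\otimes\mathrm{id})\circ\triangle^r_{R_0^{2,1,n}[r]}.$$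 $H^n_{\mathrm{coDend}}(M,C)$ denotes the corresponding cohomology. Operad. $\mathcal O(n)=\mathrm{Hom}(\mathbb K[C_n]\otimes C,C^{\otimes n})$, $n\ge1$, is a non-symmetric operad with partial compositions, for $f\in\mathcal O(m)$, $g\in\mathcal O(n)$, $(f\bullet_ig)_{[r]}=(\mathrm{id}^{\otimes(i-1)}\otimes g_{R_1^{m,i,n}[r]}\otimes\mathrm{id}^{\otimes(m-i)})\circ f_{R_0^{m,i,n}[r]}$, and identity element $\mathrm{id}_{[1]}=\mathrm{id}_C$. Put $f\bullet g=\sum_{i=1}^m(-1)^{(i-1)(n-1)}f\bullet_ig$ and $[f,g]=f\bullet g-(-1)^{(m-1)(n-1)}g\bullet f$. A multiplication is an element $\pi\in\mathcal O(2)$ with $\pi\bullet_1\pi=\pi\bullet_2\pi$; the element $\triangle\in\mathcal O(2)$ with components $\triangle_{[1]}=\triangle_\prec$, $\triangle_{[2]}=\triangle_\succ$ is a multiplication. A multiplication $\pi$ induces the differential $d_\pi f=\pi\bullet f-(-1)^{n-1}f\bullet\pi$ for $f\in\mathcal O(n)$, and an associative product $f\cdot g=\pm(\pi\bullet_2g)\bullet_1f$ (the sign being left unspecified); the bracket $[\ ,\ ]$ and the product $\cdot$ induce a Gerstenhaber algebra structure on the cohomology of $(\mathcal O,d_\pi)$. A Gerstenhaber algebra is a graded commutative associative algebra with a degree $-1$ graded Lie bracket satisfying the graded Leibniz rule with respect to the product.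
   Formalization: With the stated formulas δ_c coincides with the differential induced by △ only up to sign: δ_c = (−1)^{n−1} d_△ on O(n) is proved, as literal equality fails for even n; the unspecified sign of the product is fixed as (−1)^{mn}. *)

theory Defs
  imports Complex_Main "HOL-Library.Function_Algebras" "HOL-Library.Product_Plus"
    "HOL-Library.Poly_Mapping"
begin

section \<open>Tensor powers\<close>

text \<open>
  The library has no tensor products of vector spaces.  For a vector space \<open>V\<close> (the type
  \<open>'v\<close> with scalar multiplication \<open>s\<close>) over a field, the tensor algebra is realised as
  the span, inside the functionals on multilinear forms, of the evaluations \<open>tens s xs\<close>,
  which play the role of \<open>x\<^sub>1 \<otimes> \<dots> \<otimes> x\<^sub>n\<close> for \<open>xs = [x\<^sub>1, \<dots>, x\<^sub>n]\<close>.  The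
  universal property is the theorem \<open>tensor_universal\<close> below.  Forms are defined on lists of
  all lengths at once, so that all tensor powers of \<open>V\<close> live in one type.
\<close>

type_synonym ('k, 'v) tensor = "('v list \<Rightarrow> 'k) \<Rightarrow> 'k"

definition slotwise_linear ::
    "('k::field \<Rightarrow> 'v::ab_group_add \<Rightarrow> 'v) \<Rightarrow> ('k \<Rightarrow> 'w::ab_group_add \<Rightarrow> 'w)
      \<Rightarrow> ('v list \<Rightarrow> 'w) \<Rightarrow> bool" where
  "slotwise_linear s t F \<longleftrightarrow> (\<forall>xs ys. Vector_Spaces.linear s t (\<lambda>x. F (xs @ x # ys)))"

abbreviation multilinear_form ::
    "('k::field \<Rightarrow> 'v::ab_group_add \<Rightarrow> 'v) \<Rightarrow> ('v list \<Rightarrow> 'k) \<Rightarrow> bool" where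
  "multilinear_form s \<equiv> slotwise_linear s (*)"

definition tscale :: "'k::field \<Rightarrow> ('k, 'v) tensor \<Rightarrow> ('k, 'v) tensor" where
  "tscale a t = (\<lambda>\<beta>. a * t \<beta>)"

definition tens ::
    "('k::field \<Rightarrow> 'v::ab_group_add \<Rightarrow> 'v) \<Rightarrow> 'v list \<Rightarrow> ('k, 'v) tensor" where
  "tens s xs = (\<lambda>\<beta>. if multilinear_form s \<beta> then \<beta> xs else 0)"

text \<open>\<open>tensors s [A\<^sub>1, \<dots>, A\<^sub>n]\<close> is the subspace \<open>A\<^sub>1 \<otimes> \<dots> \<otimes> A\<^sub>n\<close> for
  subspaces \<open>A\<^sub>i\<close> of \<open>V\<close>.\<close>

definition tensors ::
    "('k::field \<Rightarrow> 'v::ab_group_add \<Rightarrow> 'v) \<Rightarrow> 'v set list \<Rightarrow> ('k, 'v) tensor set" where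
  "tensors s As = module.span tscale {tens s xs |xs. list_all2 (\<in>) xs As}"

definition tensor_power ::
    "('k::field \<Rightarrow> 'v::ab_group_add \<Rightarrow> 'v) \<Rightarrow> nat \<Rightarrow> ('k, 'v) tensor set" where
  "tensor_power s n = tensors s (replicate n UNIV)"

text \<open>\<open>tlift s F\<close> is the linear map with \<open>tens _ xs \<mapsto> F xs\<close> for slotwise linear \<open>F\<close> with
  values in the tensor algebra of \<open>(W, s)\<close>, see \<open>tlift_tens\<close>.\<close>

definition tlift ::
    "('k::field \<Rightarrow> 'w::ab_group_add \<Rightarrow> 'w) \<Rightarrow> ('v list \<Rightarrow> ('k, 'w) tensor)
      \<Rightarrow> ('k, 'v) tensor \<Rightarrow> ('k, 'w) tensor" where
  "tlift s F t = (\<lambda>\<beta>. if multilinear_form s \<beta> then t (\<lambda>xs. F xs \<beta>) else 0)"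

definition tprod ::
    "('k::field \<Rightarrow> 'v::ab_group_add \<Rightarrow> 'v) \<Rightarrow> ('k, 'v) tensor \<Rightarrow> ('k, 'v) tensor
      \<Rightarrow> ('k, 'v) tensor" where
  "tprod s t u = tlift s (\<lambda>xs. tlift s (\<lambda>ys. tens s (xs @ ys)) u) t"

text \<open>\<open>tmap s [f\<^sub>1, \<dots>, f\<^sub>n]\<close> is \<open>f\<^sub>1 \<otimes> \<dots> \<otimes> f\<^sub>n\<close> for linear maps
  \<open>f\<^sub>i\<close> from \<open>V\<close> into the tensor algebra of \<open>(W, s)\<close>; here \<open>tid s\<close> is the
  identity, seen as a map into the tensors of degree one.\<close>

definition tmap ::
    "('k::field \<Rightarrow> 'w::ab_group_add \<Rightarrow> 'w) \<Rightarrow> ('v \<Rightarrow> ('k, 'w) tensor) list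
      \<Rightarrow> ('k, 'v) tensor \<Rightarrow> ('k, 'w) tensor" where
  "tmap s fs = tlift s (\<lambda>xs. if length xs = length fs
     then foldr (tprod s) (map2 (\<lambda>f x. f x) fs xs) (tens s []) else 0)"

definition tid :: "('k::field \<Rightarrow> 'v::ab_group_add \<Rightarrow> 'v) \<Rightarrow> 'v \<Rightarrow> ('k, 'v) tensor" where
  "tid s x = tens s [x]"

lemma vector_space_tscale: "vector_space (tscale :: 'k::field \<Rightarrow> ('k, 'v) tensor \<Rightarrow> _)"
  by unfold_locales (auto simp: tscale_def fun_eq_iff algebra_simps)

lemma vector_space_field: "vector_space ((*) :: 'k::field \<Rightarrow> 'k \<Rightarrow> 'k)"
  by unfold_locales (auto simp: algebra_simps)

lemma slotwise_linear_tens: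
  fixes s :: "'k::field \<Rightarrow> 'v::ab_group_add \<Rightarrow> 'v"
  assumes "vector_space s"
  shows "slotwise_linear s tscale (tens s)"
  unfolding slotwise_linear_def
proof (intro allI)
  fix xs ys
  interpret vector_space s by fact
  interpret T: vector_space "tscale :: 'k \<Rightarrow> ('k, 'v) tensor \<Rightarrow> _" by (rule vector_space_tscale)
  have lin: "Vector_Spaces.linear s (*) (\<lambda>x. \<beta> (xs @ x # ys))" if "multilinear_form s \<beta>" for \<beta>
    using that unfolding slotwise_linear_def by blast
  show "Vector_Spaces.linear s tscale (\<lambda>x. tens s (xs @ x # ys))"
  proof (unfold_locales, goal_cases)
    case (1 x y)
    have "tens s (xs @ (x + y) # ys) \<beta> = (tens s (xs @ x # ys) + tens s (xs @ y # ys)) \<beta>" for \<beta>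
    proof (cases "multilinear_form s \<beta>")
      case True
      then interpret b: Vector_Spaces.linear s "(*)" "\<lambda>x. \<beta> (xs @ x # ys)" by (rule lin)
      show ?thesis using True b.add[of x y] by (simp add: tens_def)
    qed (simp add: tens_def)
    then show ?case by blast
  next
    case (2 a x)
    have "tens s (xs @ s a x # ys) \<beta> = tscale a (tens s (xs @ x # ys)) \<beta>" for \<beta>
    proof (cases "multilinear_form s \<beta>")
      case True
      then interpret b: Vector_Spaces.linear s "(*)" "\<lambda>x. \<beta> (xs @ x # ys)" by (rule lin)
      show ?thesis using True b.scale[of a x] by (simp add: tens_def tscale_def)
    qed (simp add: tens_def tscale_def)
    then show ?case by blast
  qed
qed

lemma linear_tlift: "Vector_Spaces.linear tscale tscale (tlift s F)"
proof -
  interpret T: vector_space "tscale :: 'a \<Rightarrow> ('a, 'c) tensor \<Rightarrow> _" by (rule vector_space_tscale)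
  interpret U: vector_space "tscale :: 'a \<Rightarrow> ('a, 'b) tensor \<Rightarrow> _" by (rule vector_space_tscale)
  show ?thesis by unfold_locales (auto simp: tlift_def tscale_def fun_eq_iff)
qed

lemma tlift_tens:
  fixes s :: "'k::field \<Rightarrow> 'v::ab_group_add \<Rightarrow> 'v" and u :: "'k \<Rightarrow> 'w::ab_group_add \<Rightarrow> 'w"
  assumes F: "slotwise_linear s tscale F" and T: "F xs \<in> module.span tscale (range (tens u))"
  shows "tlift u F (tens s xs) = F xs"
proof -
  interpret T: vector_space "tscale :: 'k \<Rightarrow> ('k, 'w) tensor \<Rightarrow> _" by (rule vector_space_tscale)
  have "multilinear_form s (\<lambda>xs. F xs \<beta>)" for \<beta>
    unfolding slotwise_linear_def
  proof (intro allI)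
    fix xs ys
    interpret l: Vector_Spaces.linear s tscale "\<lambda>x. F (xs @ x # ys)"
      using F unfolding slotwise_linear_def by blast
    interpret K: vector_space "(*) :: 'k \<Rightarrow> 'k \<Rightarrow> 'k" by (rule vector_space_field)
    show "Vector_Spaces.linear s (*) (\<lambda>x. F (xs @ x # ys) \<beta>)"
      by unfold_locales (auto simp: l.add l.scale, auto simp: tscale_def)
  qed
  moreover have "F xs \<beta> = 0" if "\<not> multilinear_form u \<beta>" for \<beta>
    using T
  proof (induction rule: T.span_induct_alt)
    case base then show ?case by simp
  next
    case (step c x y)
    then show ?case using that by (auto simp: tscale_def tens_def)
  qed
  ultimately have "tlift u F (tens s xs) \<beta> = F xs \<beta>" for \<beta>
    by (cases "multilinear_form u \<beta>") (simp_all add: tlift_def tens_def)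
  then show ?thesis by blast
qed

text \<open>Every slotwise linear map into a vector space factors through \<open>tens\<close>, uniquely on each
  tensor power because the \<open>tens s xs\<close> span it.\<close>

theorem tensor_universal:
  fixes s :: "'k::field \<Rightarrow> 'v::ab_group_add \<Rightarrow> 'v" and t :: "'k \<Rightarrow> 'w::ab_group_add \<Rightarrow> 'w"
  assumes s: "vector_space s" and t: "vector_space t" and F: "slotwise_linear s t F"
  shows "\<exists>g. Vector_Spaces.linear tscale t g \<and> (\<forall>xs. g (tens s xs) = F xs)"
    and "Vector_Spaces.linear tscale t g \<Longrightarrow> Vector_Spaces.linear tscale t h \<Longrightarrow>
      (\<And>xs. length xs = n \<Longrightarrow> g (tens s xs) = h (tens s xs)) \<Longrightarrow>
      z \<in> tensor_power s n \<Longrightarrow> g z = h z"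
proof -
  interpret V: vector_space s by fact
  interpret W: vector_space t by fact
  interpret T: vector_space "tscale :: 'k \<Rightarrow> ('k, 'v) tensor \<Rightarrow> _" by (rule vector_space_tscale)
  interpret K: vector_space "(*) :: 'k \<Rightarrow> 'k \<Rightarrow> 'k" by (rule vector_space_field)
  interpret TW: vector_space_pair "tscale :: 'k \<Rightarrow> ('k, 'v) tensor \<Rightarrow> _" t by unfold_locales
  interpret WK: vector_space_pair t "(*) :: 'k \<Rightarrow> 'k \<Rightarrow> 'k" by unfold_locales
  obtain B where B: "B \<subseteq> range (tens s)" "T.independent B" "range (tens s) \<subseteq> T.span B"
    by (rule T.maximal_independent_subset[of "range (tens s)"])
  define pick where "pick = inv_into UNIV (tens s)"
  have pick: "tens s (pick b) = b" if "b \<in> B" for b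
    unfolding pick_def using B(1) that by (blast intro: f_inv_into_f)
  obtain g where g: "Vector_Spaces.linear tscale t g" "\<And>b. b \<in> B \<Longrightarrow> g b = F (pick b)"
    using TW.linear_independent_extend[OF B(2), of "\<lambda>b. F (pick b)"] by blast
  have sep: "\<exists>\<phi>. Vector_Spaces.linear t (*) \<phi> \<and> \<phi> w \<noteq> 0" if "w \<noteq> 0" for w :: 'w
  proof -
    have "W.independent {w}" using that by simp
    then obtain \<phi> where "Vector_Spaces.linear t (*) \<phi>" "\<phi> w = 1"
      using WK.linear_independent_extend[of "{w}" "\<lambda>_. 1"] by blast
    then show ?thesis by (metis zero_neq_one)
  qed
  have "g (tens s xs) = F xs" for xs
  proof (rule ccontr)
    assume "g (tens s xs) \<noteq> F xs"
    then obtain \<phi> where \<phi>: "Vector_Spaces.linear t (*) \<phi>" "\<phi> (g (tens s xs) - F xs) \<noteq> 0"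
      using sep[of "g (tens s xs) - F xs"] right_minus_eq by blast
    interpret \<phi>: Vector_Spaces.linear t "(*)" \<phi> by (rule \<phi>(1))
    interpret g: Vector_Spaces.linear tscale t g by (rule g(1))
    have ml: "multilinear_form s (\<lambda>xs. \<phi> (F xs))"
      unfolding slotwise_linear_def
    proof (intro allI)
      fix xs ys
      interpret l: Vector_Spaces.linear s t "\<lambda>x. F (xs @ x # ys)"
        using F unfolding slotwise_linear_def by blast
      show "Vector_Spaces.linear s (*) (\<lambda>x. \<phi> (F (xs @ x # ys)))"
        by unfold_locales (simp_all only: l.add l.scale \<phi>.add \<phi>.scale)
    qed
    have "\<phi> (g z) = z (\<lambda>xs. \<phi> (F xs))" if "z \<in> T.span B" for z
      using that
    proof (induction rule: T.span_induct_alt)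
      case base
      show ?case by (simp only: g.zero \<phi>.zero) (rule zero_fun_apply[symmetric])
    next
      case (step c x y)
      have "x (\<lambda>xs. \<phi> (F xs)) = \<phi> (F (pick x))"
        using ml arg_cong[OF pick[OF step(1)], of "\<lambda>t. t (\<lambda>xs. \<phi> (F xs))"]
        by (simp only: tens_def if_True)
      then have "\<phi> (g (tscale c x + y)) = c * x (\<lambda>xs. \<phi> (F xs)) + y (\<lambda>xs. \<phi> (F xs))"
        by (simp only: g.add g.scale \<phi>.add \<phi>.scale g(2)[OF step(1)] step(2))
      also have "\<dots> = (tscale c x + y) (\<lambda>xs. \<phi> (F xs))"
        by (simp add: tscale_def)
      finally show ?case .
    qed
    moreover have "tens s xs \<in> T.span B"
      using B(3) by blast
    ultimately have "\<phi> (g (tens s xs)) = tens s xs (\<lambda>xs. \<phi> (F xs))"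
      by blast
    also have "\<dots> = \<phi> (F xs)"
      using ml by (simp add: tens_def)
    finally have "\<phi> (g (tens s xs)) = \<phi> (F xs)" .
    then show False using \<phi>(2) by (simp add: \<phi>.diff)
  qed
  with g(1) show "\<exists>g. Vector_Spaces.linear tscale t g \<and> (\<forall>xs. g (tens s xs) = F xs)"
    by blast
  show "g z = h z"
    if "Vector_Spaces.linear tscale t g" "Vector_Spaces.linear tscale t h"
       "\<And>xs. length xs = n \<Longrightarrow> g (tens s xs) = h (tens s xs)" "z \<in> tensor_power s n"
    for g h
  proof (rule TW.linear_eq_on[OF that(1,2)])
    show "z \<in> T.span {tens s xs |xs. list_all2 (\<in>) xs (replicate n UNIV)}"
      using that(4) unfolding tensor_power_def tensors_def .
    show "g b = h b" if b: "b \<in> {tens s xs |xs. list_all2 (\<in>) xs (replicate n UNIV)}" for b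
    proof -
      obtain xs where "b = tens s xs" "length xs = n"
        using b by (auto dest: list_all2_lengthD)
      then show ?thesis by (simp add: \<open>\<And>xs. length xs = n \<Longrightarrow> g (tens s xs) = h (tens s xs)\<close>)
    qed
  qed
qed


section \<open>Dendriform coalgebras and bicomodules\<close>

locale dendriform_coalgebra = vector_space sC
  for sC :: "'k::field_char_0 \<Rightarrow> 'c::ab_group_add \<Rightarrow> 'c" +
  fixes dl dr :: "'c \<Rightarrow> ('k, 'c) tensor"
  assumes linear_dl: "Vector_Spaces.linear sC tscale dl"
    and linear_dr: "Vector_Spaces.linear sC tscale dr"
    and dl_in: "dl x \<in> tensor_power sC 2"
    and dr_in: "dr x \<in> tensor_power sC 2"
    and dend1: "tmap sC [dl, tid sC] \<circ> dl = tmap sC [tid sC, dl + dr] \<circ> dl"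
    and dend2: "tmap sC [dr, tid sC] \<circ> dl = tmap sC [tid sC, dl] \<circ> dr"
    and dend3: "tmap sC [dl + dr, tid sC] \<circ> dr = tmap sC [tid sC, dr] \<circ> dr"

text \<open>
  Mixed tensor products of \<open>C\<close> and \<open>M\<close> are taken inside the tensor powers of the direct
  sum \<open>C \<oplus> M\<close> (the type \<open>'c \<times> 'm\<close>): for instance \<open>C \<otimes> M\<close> is spanned by the tensors
  \<open>(c, 0) \<otimes> (0, m)\<close>.
\<close>

definition sum_scale :: "('k \<Rightarrow> 'c \<Rightarrow> 'c) \<Rightarrow> ('k \<Rightarrow> 'm \<Rightarrow> 'm) \<Rightarrow> 'k \<Rightarrow> 'c \<times> 'm \<Rightarrow> 'c \<times> 'm" where
  "sum_scale sC sM a = map_prod (sC a) (sM a)"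

definition inC :: "'c \<Rightarrow> 'c \<times> 'm::zero" where
  "inC c = (c, 0)"

definition inM :: "'m \<Rightarrow> 'c::zero \<times> 'm" where
  "inM m = (0, m)"

text \<open>The map \<open>C\<^bsup>\<otimes>n\<^esup> \<rightarrow> (C \<oplus> M)\<^bsup>\<otimes>n\<^esup>\<close> induced by \<open>inC\<close>, for all \<open>n\<close>.\<close>

definition embC ::
    "('k::field \<Rightarrow> 'c \<times> 'm::ab_group_add \<Rightarrow> 'c \<times> 'm) \<Rightarrow> ('k, 'c::ab_group_add) tensor
      \<Rightarrow> ('k, 'c \<times> 'm) tensor" where
  "embC s = tlift s (\<lambda>xs. tens s (map inC xs))"

text \<open>Below, \<open>dL\<close>, \<open>dR\<close>, \<open>lL\<close>, \<dots> are the structure maps as maps on a slot of a mixed tensor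
  product: those of \<open>C\<close> read the \<open>C\<close>-component of the slot, those of \<open>M\<close> its
  \<open>M\<close>-component.\<close>

locale dendriform_bicomodule = dendriform_coalgebra sC dl dr + M: vector_space sM
  for sC :: "'k::field_char_0 \<Rightarrow> 'c::ab_group_add \<Rightarrow> 'c" and dl dr
    and sM :: "'k \<Rightarrow> 'm::ab_group_add \<Rightarrow> 'm" +
  fixes ll lr rl rr :: "'m \<Rightarrow> ('k, 'c \<times> 'm) tensor"
    and s :: "'k \<Rightarrow> 'c \<times> 'm \<Rightarrow> 'c \<times> 'm"
    and dL dR lL lR rL rR idt :: "'c \<times> 'm \<Rightarrow> ('k, 'c \<times> 'm) tensor"
  defines "s \<equiv> sum_scale sC sM"
    and "dL \<equiv> embC s \<circ> dl \<circ> fst" and "dR \<equiv> embC s \<circ> dr \<circ> fst"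
    and "lL \<equiv> ll \<circ> snd" and "lR \<equiv> lr \<circ> snd"
    and "rL \<equiv> rl \<circ> snd" and "rR \<equiv> rr \<circ> snd"
    and "idt \<equiv> tid s"
  assumes linear_ll: "Vector_Spaces.linear sM tscale ll"
    and linear_lr: "Vector_Spaces.linear sM tscale lr"
    and linear_rl: "Vector_Spaces.linear sM tscale rl"
    and linear_rr: "Vector_Spaces.linear sM tscale rr"
    and ll_in: "ll x \<in> tensors s [range inC, range inM]"
    and lr_in: "lr x \<in> tensors s [range inC, range inM]"
    and rl_in: "rl x \<in> tensors s [range inM, range inC]"
    and rr_in: "rr x \<in> tensors s [range inM, range inC]"
    and ll1: "tmap s [dL, idt] \<circ> ll = tmap s [idt, lL + lR] \<circ> ll"
    and ll2: "tmap s [dR, idt] \<circ> ll = tmap s [idt, lL] \<circ> lr"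
    and ll3: "tmap s [dL + dR, idt] \<circ> lr = tmap s [idt, lR] \<circ> lr"
    and lr1: "tmap s [lL, idt] \<circ> rl = tmap s [idt, rL + rR] \<circ> ll"
    and lr2: "tmap s [lR, idt] \<circ> rl = tmap s [idt, rL] \<circ> lr"
    and lr3: "tmap s [lL + lR, idt] \<circ> rr = tmap s [idt, rR] \<circ> lr"
    and rr1: "tmap s [rL, idt] \<circ> rl = tmap s [idt, dL + dR] \<circ> rl"
    and rr2: "tmap s [rR, idt] \<circ> rl = tmap s [idt, dL] \<circ> rr"
    and rr3: "tmap s [rL + rR, idt] \<circ> rr = tmap s [idt, dR] \<circ> rr"

text \<open>For \<open>M = C\<close>, the identifications of \<open>C \<otimes> C\<close> with \<open>C \<otimes> M\<close> and with
  \<open>M \<otimes> C\<close>.\<close>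

definition as_CM ::
    "('k::field \<Rightarrow> 'c::ab_group_add \<Rightarrow> 'c) \<Rightarrow> ('k, 'c) tensor \<Rightarrow> ('k, 'c \<times> 'c) tensor" where
  "as_CM sC = (let s = sum_scale sC sC in tmap s [tid s \<circ> inC, tid s \<circ> inM])"

definition as_MC ::
    "('k::field \<Rightarrow> 'c::ab_group_add \<Rightarrow> 'c) \<Rightarrow> ('k, 'c) tensor \<Rightarrow> ('k, 'c \<times> 'c) tensor" where
  "as_MC sC = (let s = sum_scale sC sC in tmap s [tid s \<circ> inM, tid s \<circ> inC])"


section \<open>Cochains and coboundary\<close>

text \<open>\<open>[r]\<close> is encoded by \<open>r \<in> {1..n}\<close>, and \<open>\<K>[C\<^sub>n]\<close> by formal linear
  combinations of these.\<close>

definition R0 :: "nat \<Rightarrow> nat \<Rightarrow> nat \<Rightarrow> nat \<Rightarrow> nat" where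
  "R0 m i n r = (if r \<le> i - 1 then r else if r \<le> i + n - 1 then i else r - n + 1)"

definition R1 :: "nat \<Rightarrow> nat \<Rightarrow> nat \<Rightarrow> nat \<Rightarrow> (nat \<Rightarrow>\<^sub>0 'k::field)" where
  "R1 m i n r = (if i \<le> r \<and> r \<le> i + n - 1 then Poly_Mapping.single (r - i + 1) 1
     else (\<Sum>j=1..n. Poly_Mapping.single j 1))"

text \<open>A linear map \<open>\<sigma>\<close> on \<open>\<K>[C\<^sub>n] \<otimes> M\<close> is given by its components \<open>\<sigma> r = \<sigma>\<^bsub>[r]\<^esub>\<close>, with
  \<open>\<sigma> r = 0\<close> for \<open>r\<close> outside \<open>{1..n}\<close>, and \<open>comp_at \<sigma> x\<close> is \<open>\<sigma>\<^sub>x\<close>.\<close>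

type_synonym ('k, 'm, 'c) cochain = "nat \<Rightarrow> 'm \<Rightarrow> ('k, 'c) tensor"

definition comp_at :: "('k::field, 'm, 'c) cochain \<Rightarrow> (nat \<Rightarrow>\<^sub>0 'k) \<Rightarrow> 'm \<Rightarrow> ('k, 'c) tensor" where
  "comp_at \<sigma> x m = (\<Sum>j\<in>Poly_Mapping.keys x. tscale (Poly_Mapping.lookup x j) (\<sigma> j m))"

definition cscale :: "'k::field \<Rightarrow> ('k, 'm, 'c) cochain \<Rightarrow> ('k, 'm, 'c) cochain" where
  "cscale a \<sigma> = (\<lambda>r m. tscale a (\<sigma> r m))"

definition cochains ::
    "('k::field \<Rightarrow> 'm::ab_group_add \<Rightarrow> 'm) \<Rightarrow> ('k \<Rightarrow> 'c::ab_group_add \<Rightarrow> 'c) \<Rightarrow> nat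
      \<Rightarrow> ('k, 'm, 'c) cochain set" where
  "cochains sM sC n = {\<sigma>.
     (\<forall>r\<in>{1..n}. Vector_Spaces.linear sM tscale (\<sigma> r) \<and> range (\<sigma> r) \<subseteq> tensor_power sC n) \<and>
     (\<forall>r. r \<notin> {1..n} \<longrightarrow> \<sigma> r = 0)}"

definition pair_family :: "('m \<Rightarrow> 't::zero) \<Rightarrow> ('m \<Rightarrow> 't) \<Rightarrow> nat \<Rightarrow> 'm \<Rightarrow> 't" where
  "pair_family f g = (\<lambda>r. if r = 1 then f else if r = 2 then g else 0)"

text \<open>\<open>at_slot s n i g\<close> is \<open>id\<^bsup>\<otimes>(i-1)\<^esup> \<otimes> g \<otimes> id\<^bsup>\<otimes>(n-i)\<^esup>\<close>.\<close>

definition at_slot ::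
    "('k::field \<Rightarrow> 'c::ab_group_add \<Rightarrow> 'c) \<Rightarrow> nat \<Rightarrow> nat \<Rightarrow> ('c \<Rightarrow> ('k, 'c) tensor)
      \<Rightarrow> ('k, 'c) tensor \<Rightarrow> ('k, 'c) tensor" where
  "at_slot s n i g = tmap s (replicate (i - 1) (tid s) @ g # replicate (n - i) (tid s))"

text \<open>\<open>D\<close>, \<open>L\<close>, \<open>R\<close> are the families \<open>\<triangle>\<^bsub>[r]\<^esub>\<close>, \<open>\<triangle>\<^sup>l\<^bsub>[r]\<^esub>\<close>,
  \<open>\<triangle>\<^sup>r\<^bsub>[r]\<^esub>\<close>.\<close>

definition coboundary ::
    "('k::field \<Rightarrow> 'c::ab_group_add \<Rightarrow> 'c) \<Rightarrow> ('k, 'c, 'c) cochain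
      \<Rightarrow> ('k, 'm::ab_group_add, 'c \<times> 'm) cochain \<Rightarrow> ('k, 'm, 'c \<times> 'm) cochain
      \<Rightarrow> nat \<Rightarrow> ('k, 'm, 'c) cochain \<Rightarrow> ('k, 'm, 'c) cochain" where
  "coboundary sC D L R n \<sigma> = (\<lambda>r. if r \<notin> {1..n+1} then 0 else (\<lambda>x.
     tmap sC [tid sC \<circ> fst, comp_at \<sigma> (R1 2 2 n r) \<circ> snd] (L (R0 2 2 n r) x)
     + (\<Sum>i=1..n. tscale ((-1) ^ i)
         (at_slot sC n i (comp_at D (R1 n i 2 r)) (\<sigma> (R0 n i 2 r) x)))
     + tscale ((-1) ^ (n + 1))
         (tmap sC [comp_at \<sigma> (R1 2 1 n r) \<circ> snd, tid sC \<circ> fst] (R (R0 2 1 n r) x))))"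


section \<open>The operad and the operations induced by a multiplication\<close>

definition operad ::
    "('k::field \<Rightarrow> 'c::ab_group_add \<Rightarrow> 'c) \<Rightarrow> nat \<Rightarrow> ('k, 'c, 'c) cochain set" where
  "operad sC n = cochains sC sC n"

definition pcomp ::
    "('k::field \<Rightarrow> 'c::ab_group_add \<Rightarrow> 'c) \<Rightarrow> nat \<Rightarrow> nat \<Rightarrow> ('k, 'c, 'c) cochain \<Rightarrow> nat
      \<Rightarrow> ('k, 'c, 'c) cochain \<Rightarrow> ('k, 'c, 'c) cochain" where
  "pcomp sC m n f i g = (\<lambda>r. if r \<notin> {1..m+n-1} then 0 else
     at_slot sC m i (comp_at g (R1 m i n r)) \<circ> f (R0 m i n r))"

definition circ ::
    "('k::field \<Rightarrow> 'c::ab_group_add \<Rightarrow> 'c) \<Rightarrow> nat \<Rightarrow> nat \<Rightarrow> ('k, 'c, 'c) cochain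
      \<Rightarrow> ('k, 'c, 'c) cochain \<Rightarrow> ('k, 'c, 'c) cochain" where
  "circ sC m n f g = (\<Sum>i=1..m. cscale ((-1) ^ ((i - 1) * (n - 1))) (pcomp sC m n f i g))"

definition bracket ::
    "('k::field \<Rightarrow> 'c::ab_group_add \<Rightarrow> 'c) \<Rightarrow> nat \<Rightarrow> nat \<Rightarrow> ('k, 'c, 'c) cochain
      \<Rightarrow> ('k, 'c, 'c) cochain \<Rightarrow> ('k, 'c, 'c) cochain" where
  "bracket sC m n f g =
     circ sC m n f g - cscale ((-1) ^ ((m - 1) * (n - 1))) (circ sC n m g f)"

definition is_multiplication ::
    "('k::field \<Rightarrow> 'c::ab_group_add \<Rightarrow> 'c) \<Rightarrow> ('k, 'c, 'c) cochain \<Rightarrow> bool" where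
  "is_multiplication sC p \<longleftrightarrow> p \<in> operad sC 2 \<and> pcomp sC 2 2 p 1 p = pcomp sC 2 2 p 2 p"

text \<open>For \<open>p = \<triangle>\<close> and \<open>M = C\<close>, the first, middle and last terms of
  \<open>coboundary\<close> are \<open>p \<bullet>\<^sub>2 f\<close>, \<open>- (f \<bullet> p)\<close> and
  \<open>(-1)\<^bsup>n+1\<^esup> p \<bullet>\<^sub>1 f\<close>, so with these conventions it equals \<open>(-1)\<^bsup>n-1\<^esup>\<close> times
  \<open>mult_diff\<close>.\<close>

definition mult_diff ::
    "('k::field \<Rightarrow> 'c::ab_group_add \<Rightarrow> 'c) \<Rightarrow> ('k, 'c, 'c) cochain \<Rightarrow> nat
      \<Rightarrow> ('k, 'c, 'c) cochain \<Rightarrow> ('k, 'c, 'c) cochain" where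
  "mult_diff sC p n f = circ sC 2 n p f - cscale ((-1) ^ (n - 1)) (circ sC n 2 f p)"

text \<open>The sign is the one of Gerstenhaber and Voronov; it makes the left Leibniz rule hold in
  cohomology for \<open>bracket\<close>.\<close>

definition mult_prod ::
    "('k::field \<Rightarrow> 'c::ab_group_add \<Rightarrow> 'c) \<Rightarrow> ('k, 'c, 'c) cochain \<Rightarrow> nat \<Rightarrow> nat
      \<Rightarrow> ('k, 'c, 'c) cochain \<Rightarrow> ('k, 'c, 'c) cochain \<Rightarrow> ('k, 'c, 'c) cochain" where
  "mult_prod sC p m n f g = cscale ((-1) ^ (m * n)) (pcomp sC (n + 1) m (pcomp sC 2 n p 2 g) 1 f)"


section \<open>Cohomology and induced operations\<close>

definition cocycles :: "(nat \<Rightarrow> 'a set) \<Rightarrow> (nat \<Rightarrow> 'a \<Rightarrow> 'a::zero) \<Rightarrow> nat \<Rightarrow> 'a set" where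
  "cocycles X d n = {z \<in> X n. d n z = 0}"

definition coboundaries :: "(nat \<Rightarrow> 'a set) \<Rightarrow> (nat \<Rightarrow> 'a \<Rightarrow> 'a::zero) \<Rightarrow> nat \<Rightarrow> 'a set" where
  "coboundaries X d n = (if n = 0 then {0} else d (n - 1) ` X (n - 1))"

definition coset_of :: "'a::plus set \<Rightarrow> 'a \<Rightarrow> 'a set" where
  "coset_of B z = (\<lambda>b. z + b) ` B"

definition cohomology ::
    "(nat \<Rightarrow> 'a set) \<Rightarrow> (nat \<Rightarrow> 'a \<Rightarrow> 'a::{plus,zero}) \<Rightarrow> nat \<Rightarrow> 'a set set" where
  "cohomology X d n = coset_of (coboundaries X d n) ` cocycles X d n"

text \<open>The union of the classes of the values of an operation at all representatives; it is a
  single class exactly when the class of the value does not depend on the representatives.\<close>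

definition induced1 :: "'a::plus set \<Rightarrow> ('a \<Rightarrow> 'a) \<Rightarrow> 'a set \<Rightarrow> 'a set" where
  "induced1 B f X = (\<Union>x\<in>X. coset_of B (f x))"

definition induced2 :: "'a::plus set \<Rightarrow> ('a \<Rightarrow> 'a \<Rightarrow> 'a) \<Rightarrow> 'a set \<Rightarrow> 'a set \<Rightarrow> 'a set" where
  "induced2 B f X Y = (\<Union>x\<in>X. \<Union>y\<in>Y. coset_of B (f x y))"


section \<open>Gerstenhaber algebras\<close>

locale carrier_vector_space =
  fixes V :: "'h set" and zero :: 'h and add :: "'h \<Rightarrow> 'h \<Rightarrow> 'h"
    and scale :: "'k::field \<Rightarrow> 'h \<Rightarrow> 'h"
  assumes zero_closed: "zero \<in> V"
    and add_closed: "\<lbrakk>x \<in> V; y \<in> V\<rbrakk> \<Longrightarrow> add x y \<in> V"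
    and scale_closed: "x \<in> V \<Longrightarrow> scale a x \<in> V"
    and add_assoc: "\<lbrakk>x \<in> V; y \<in> V; z \<in> V\<rbrakk> \<Longrightarrow> add (add x y) z = add x (add y z)"
    and add_commute: "\<lbrakk>x \<in> V; y \<in> V\<rbrakk> \<Longrightarrow> add x y = add y x"
    and add_zero: "x \<in> V \<Longrightarrow> add zero x = x"
    and add_inverse: "x \<in> V \<Longrightarrow> \<exists>y\<in>V. add x y = zero"
    and scale_add: "\<lbrakk>x \<in> V; y \<in> V\<rbrakk> \<Longrightarrow> scale a (add x y) = add (scale a x) (scale a y)"
    and add_scale: "x \<in> V \<Longrightarrow> scale (a + b) x = add (scale a x) (scale b x)"
    and scale_scale: "x \<in> V \<Longrightarrow> scale a (scale b x) = scale (a * b) x"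
    and scale_one: "x \<in> V \<Longrightarrow> scale 1 x = x"

locale carrier_bilinear =
  U: carrier_vector_space U zeroU addU scaleU + V: carrier_vector_space V zeroV addV scaleV +
  W: carrier_vector_space W zeroW addW scaleW
  for U :: "'h set" and zeroU addU and scaleU :: "'k::field \<Rightarrow> 'h \<Rightarrow> 'h"
    and V zeroV addV scaleV and W zeroW addW scaleW +
  fixes f :: "'h \<Rightarrow> 'h \<Rightarrow> 'h"
  assumes closed: "\<lbrakk>x \<in> U; y \<in> V\<rbrakk> \<Longrightarrow> f x y \<in> W"
    and add_left: "\<lbrakk>x \<in> U; x' \<in> U; y \<in> V\<rbrakk> \<Longrightarrow> f (addU x x') y = addW (f x y) (f x' y)"
    and add_right: "\<lbrakk>x \<in> U; y \<in> V; y' \<in> V\<rbrakk> \<Longrightarrow> f x (addV y y') = addW (f x y) (f x y')"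
    and scale_left: "\<lbrakk>x \<in> U; y \<in> V\<rbrakk> \<Longrightarrow> f (scaleU a x) y = scaleW a (f x y)"
    and scale_right: "\<lbrakk>x \<in> U; y \<in> V\<rbrakk> \<Longrightarrow> f x (scaleV a y) = scaleW a (f x y)"

text \<open>
  A Gerstenhaber algebra concentrated in degrees \<open>\<ge> 1\<close>, as the family of its homogeneous
  components \<open>H n\<close>; \<open>mul m n\<close> and \<open>brk m n\<close> are the product \<open>H m \<times> H n \<rightarrow> H (m + n)\<close> and
  the bracket \<open>H m \<times> H n \<rightarrow> H (m + n - 1)\<close>.
\<close>

locale gerstenhaber_algebra =
  fixes H :: "nat \<Rightarrow> 'h set" and zero :: "nat \<Rightarrow> 'h" and add :: "nat \<Rightarrow> 'h \<Rightarrow> 'h \<Rightarrow> 'h"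
    and scale :: "nat \<Rightarrow> 'k::field \<Rightarrow> 'h \<Rightarrow> 'h"
    and mul brk :: "nat \<Rightarrow> nat \<Rightarrow> 'h \<Rightarrow> 'h \<Rightarrow> 'h"
  assumes vector_space: "n \<ge> 1 \<Longrightarrow> carrier_vector_space (H n) (zero n) (add n) (scale n)"
    and mul_bilinear: "\<lbrakk>m \<ge> 1; n \<ge> 1\<rbrakk> \<Longrightarrow>
      carrier_bilinear (H m) (zero m) (add m) (scale m) (H n) (zero n) (add n) (scale n)
        (H (m+n)) (zero (m+n)) (add (m+n)) (scale (m+n)) (mul m n)"
    and brk_bilinear: "\<lbrakk>m \<ge> 1; n \<ge> 1\<rbrakk> \<Longrightarrow>
      carrier_bilinear (H m) (zero m) (add m) (scale m) (H n) (zero n) (add n) (scale n)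
        (H (m+n-1)) (zero (m+n-1)) (add (m+n-1)) (scale (m+n-1)) (brk m n)"
    and mul_assoc: "\<lbrakk>m \<ge> 1; n \<ge> 1; p \<ge> 1; a \<in> H m; b \<in> H n; c \<in> H p\<rbrakk> \<Longrightarrow>
      mul (m+n) p (mul m n a b) c = mul m (n+p) a (mul n p b c)"
    and mul_commute: "\<lbrakk>m \<ge> 1; n \<ge> 1; a \<in> H m; b \<in> H n\<rbrakk> \<Longrightarrow>
      mul m n a b = scale (m+n) ((-1) ^ (m * n)) (mul n m b a)"
    and brk_antisym: "\<lbrakk>m \<ge> 1; n \<ge> 1; a \<in> H m; b \<in> H n\<rbrakk> \<Longrightarrow>
      brk m n a b = scale (m+n-1) (- ((-1) ^ ((m - 1) * (n - 1)))) (brk n m b a)"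
    and brk_jacobi: "\<lbrakk>m \<ge> 1; n \<ge> 1; p \<ge> 1; a \<in> H m; b \<in> H n; c \<in> H p\<rbrakk> \<Longrightarrow>
      brk m (n+p-1) a (brk n p b c) =
        add (m+n+p-2) (brk (m+n-1) p (brk m n a b) c)
          (scale (m+n+p-2) ((-1) ^ ((m - 1) * (n - 1))) (brk n (m+p-1) b (brk m p a c)))"
    and leibniz: "\<lbrakk>m \<ge> 1; n \<ge> 1; p \<ge> 1; a \<in> H m; b \<in> H n; c \<in> H p\<rbrakk> \<Longrightarrow>
      brk m (n+p) a (mul n p b c) =
        add (m+n+p-1) (mul (m+n-1) p (brk m n a b) c)
          (scale (m+n+p-1) ((-1) ^ ((m - 1) * n)) (mul n (m+p-1) b (brk m p a c)))"

end

theory Submission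
  imports Defs
begin

text \<open>
  For \<open>M = C\<close> the cochains form a nonsymmetric operad, and the coboundary is the differential
  \<open>[\<pi>, -]\<close> of its multiplication \<open>\<pi> = \<triangle>\<close> up to a sign that depends on the arity only.  That such an
  operad has a Gerstenhaber algebra as its cohomology is a formal fact.  It is proved for graded
  operads, where the degree is the arity minus one and the sign of each partial composition is
  absorbed into it: the sequential axiom then holds without a sign and the parallel axiom
  with the Koszul sign.  The sum \<open>f \<circ> g\<close> of all compositions is pre-Lie (\<open>prelie\<close>), with the braces
  \<open>f{g, h}\<close> as defect from associativity.  This gives the Jacobi identity, and with it \<open>d\<close> as a
  derivation of the bracket.  The product is \<open>\<pm> \<pi>{f, g}\<close>; it is strictly associative
  (\<open>brace_assoc\<close>), commutative up to the homotopy \<open>f \<circ> g\<close> (\<open>cup_commute\<close>), and the bracket is a derivation of it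
  up to the homotopy \<open>f{g, h}\<close> (\<open>d_brace\<close>).  The last fact needs the two expansions
  \<open>brace_circ\<close> and \<open>circ_brace\<close>.  Everything passes to cohomology by \<open>gerstenhaber_quotient\<close>.

  For cochains, the operad axioms (\<open>pcomp_seq\<close>, \<open>pcomp_par\<close>) combine two things: maps acting in different
  slots of a tensor power commute, and maps acting in nested slots compose, both of which
  follow from the compatibility \<open>tmap_tprod\<close> of tensor products of maps with concatenation; and
  the index maps \<open>R\<^sub>0\<close>, \<open>R\<^sub>1\<close> select the same components on both sides.  The dendriform identities
  are the three components of \<open>\<pi> \<bullet>\<^sub>1 \<pi> = \<pi> \<bullet>\<^sub>2 \<pi>\<close>.

  For an arbitrary bicomodule \<open>M\<close>, the direct sum \<open>C \<oplus> M\<close> is again a dendriform coalgebra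
  (\<open>semidirect_coalgebra\<close>): its three identities split into those of \<open>C\<close> and the nine of \<open>M\<close>.  Extending a
  cochain by zero from \<open>M\<close> to \<open>C \<oplus> M\<close> is injective and commutes with the coboundaries
  (\<open>operadic_coboundary_lift\<close>), so the square of the coboundary of \<open>M\<close> vanishes because the one of
  \<open>C \<oplus> M\<close> does.
\<close>

section \<open>Graded operads and braces\<close>

text \<open>The Koszul sign, as an operation on elements: case distinctions on parities then leave
  identities in an abelian group.\<close>

definition sg :: "nat \<Rightarrow> 'a::ab_group_add \<Rightarrow> 'a" where
  "sg n x = (if even n then x else - x)"

text \<open>After an element of degree \<open>b\<close> has been inserted at position \<open>i\<close>, a further position lies to its
  left, inside it, or to its right; the right ones are shifted by \<open>b\<close>.\<close>

lemma sum_split_slot: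
  fixes F :: "nat \<Rightarrow> 'a::comm_monoid_add"
  assumes "i \<le> a"
  shows "(\<Sum>l\<le>a+b. F l) = (\<Sum>l<i. F l) + (\<Sum>t\<le>b. F (i+t)) + (\<Sum>k\<in>{i<..a}. F (k+b))"
proof -
  have "(\<Sum>t\<le>b. F (i+t)) = sum F {i..i+b}"
    by (rule sum.reindex_bij_witness[of _ "\<lambda>l. l-i" "\<lambda>t. i+t"]) auto
  moreover have "(\<Sum>k\<in>{i<..a}. F (k+b)) = sum F {i+b<..a+b}"
    by (rule sum.reindex_bij_witness[of _ "\<lambda>l. l-b" "\<lambda>t. t+b"]) auto
  moreover have "{..a+b} = {..<i} \<union> {i..i+b} \<union> {i+b<..a+b}"
    using assms by auto
  moreover have "sum F ({..<i} \<union> {i..i+b} \<union> {i+b<..a+b})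
      = sum F {..<i} + sum F {i..i+b} + sum F {i+b<..a+b}"
    by (subst sum.union_disjoint; auto)+
  ultimately show ?thesis by simp
qed

lemma sum_split_slot_less:
  fixes F :: "nat \<Rightarrow> 'a::comm_monoid_add"
  assumes "i < a"
  shows "(\<Sum>l<a+b. F l) = (\<Sum>l<i. F l) + (\<Sum>t\<le>b. F (i+t)) + (\<Sum>k\<in>{i<..<a}. F (k+b))"
proof -
  obtain a' where a': "a = Suc a'" using assms by (cases a) auto
  have "{..<a+b} = {..a'+b}" "{i<..<a} = {i<..a'}" using a' by auto
  then show ?thesis using sum_split_slot[of i a' F b] assms a' by simp
qed

text \<open>The six ways in which two ordered positions can lie relative to an element of degree \<open>e\<close>
  inserted at position \<open>l\<close>.\<close>

lemma sum_split_slot_pairs: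
  fixes G :: "nat \<Rightarrow> nat \<Rightarrow> 'a::comm_monoid_add"
  assumes l: "l \<le> a"
  shows "(\<Sum>i\<le>a+e. \<Sum>j\<in>{i<..a+e}. G i j) =
      (\<Sum>i<l. \<Sum>j\<in>{i<..<l}. G i j) + (\<Sum>i<l. \<Sum>u\<le>e. G i (l+u))
    + (\<Sum>i<l. \<Sum>j\<in>{l<..a}. G i (j+e)) + (\<Sum>t\<le>e. \<Sum>u\<in>{t<..e}. G (l+t) (l+u))
    + (\<Sum>t\<le>e. \<Sum>j\<in>{l<..a}. G (l+t) (j+e)) + (\<Sum>i\<in>{l<..a}. \<Sum>j\<in>{i<..a}. G (i+e) (j+e))"
proof -
  have 1: "(\<Sum>j\<in>{i<..a+e}. G i j) = (\<Sum>j\<in>{i<..<l}. G i j) + (\<Sum>u\<le>e. G i (l+u))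
      + (\<Sum>j\<in>{l<..a}. G i (j+e))" if "i < l" for i
  proof -
    have "(\<Sum>u\<le>e. G i (l+u)) = sum (G i) {l..l+e}"
      by (rule sum.reindex_bij_witness[of _ "\<lambda>j. j-l" "\<lambda>t. l+t"]) auto
    moreover have "(\<Sum>j\<in>{l<..a}. G i (j+e)) = sum (G i) {l+e<..a+e}"
      by (rule sum.reindex_bij_witness[of _ "\<lambda>l. l-e" "\<lambda>t. t+e"]) auto
    moreover have "{i<..a+e} = {i<..<l} \<union> {l..l+e} \<union> {l+e<..a+e}"
      using l that by auto
    moreover have "sum (G i) ({i<..<l} \<union> {l..l+e} \<union> {l+e<..a+e})
        = sum (G i) {i<..<l} + sum (G i) {l..l+e} + sum (G i) {l+e<..a+e}"
      by (subst sum.union_disjoint; auto)+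
    ultimately show ?thesis by simp
  qed
  have 2: "(\<Sum>j\<in>{l+t<..a+e}. G (l+t) j) = (\<Sum>u\<in>{t<..e}. G (l+t) (l+u))
      + (\<Sum>j\<in>{l<..a}. G (l+t) (j+e))" if "t \<le> e" for t
  proof -
    have "(\<Sum>u\<in>{t<..e}. G (l+t) (l+u)) = sum (G (l+t)) {l+t<..l+e}"
      by (rule sum.reindex_bij_witness[of _ "\<lambda>j. j-l" "\<lambda>t. l+t"]) auto
    moreover have "(\<Sum>j\<in>{l<..a}. G (l+t) (j+e)) = sum (G (l+t)) {l+e<..a+e}"
      by (rule sum.reindex_bij_witness[of _ "\<lambda>l. l-e" "\<lambda>t. t+e"]) auto
    moreover have "{l+t<..a+e} = {l+t<..l+e} \<union> {l+e<..a+e}"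
      using l that by auto
    moreover have "sum (G (l+t)) ({l+t<..l+e} \<union> {l+e<..a+e})
        = sum (G (l+t)) {l+t<..l+e} + sum (G (l+t)) {l+e<..a+e}"
      by (subst sum.union_disjoint; auto)+
    ultimately show ?thesis by simp
  qed
  have 3: "(\<Sum>j\<in>{i+e<..a+e}. G (i+e) j) = (\<Sum>j\<in>{i<..a}. G (i+e) (j+e))" for i
    by (rule sum.reindex_bij_witness[of _ "\<lambda>t. t+e" "\<lambda>l. l-e"]) auto
  have "(\<Sum>i<l. \<Sum>j\<in>{i<..a+e}. G i j) = (\<Sum>i<l. \<Sum>j\<in>{i<..<l}. G i j)
      + (\<Sum>i<l. \<Sum>u\<le>e. G i (l+u)) + (\<Sum>i<l. \<Sum>j\<in>{l<..a}. G i (j+e))"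
    by (simp add: 1 sum.distrib)
  moreover have "(\<Sum>t\<le>e. \<Sum>j\<in>{l+t<..a+e}. G (l+t) j) = (\<Sum>t\<le>e. \<Sum>u\<in>{t<..e}. G (l+t) (l+u))
      + (\<Sum>t\<le>e. \<Sum>j\<in>{l<..a}. G (l+t) (j+e))"
    by (simp add: 2 sum.distrib)
  ultimately show ?thesis
    by (simp add: sum_split_slot[OF l] 3 add_ac)
qed

lemma sum_swap_less:
  fixes a :: nat
  shows "(\<Sum>i\<le>a. \<Sum>l<i. G i l) = (\<Sum>l\<le>a. \<Sum>i\<in>{l<..a}. G i l)"
  by (simp add: sum.Sigma, rule sum.reindex_bij_witness[of _ "\<lambda>(l,i). (i,l)" "\<lambda>(i,l). (l,i)"]) auto

lemma
  fixes G :: "nat \<Rightarrow> nat \<Rightarrow> nat \<Rightarrow> 'a::comm_monoid_add" and a :: nat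
  shows sum_triple_first: "(\<Sum>l\<le>a. \<Sum>i<l. \<Sum>j\<in>{i<..<l}. G l i j)
      = (\<Sum>i\<le>a. \<Sum>j\<in>{i<..a}. \<Sum>l\<in>{j<..a}. G l i j)"
    and sum_triple_middle: "(\<Sum>l\<le>a. \<Sum>i<l. \<Sum>j\<in>{l<..a}. G l i j)
      = (\<Sum>i\<le>a. \<Sum>j\<in>{i<..a}. \<Sum>l\<in>{i<..<j}. G l i j)"
    and sum_triple_last: "(\<Sum>l\<le>a. \<Sum>i\<in>{l<..a}. \<Sum>j\<in>{i<..a}. G l i j)
      = (\<Sum>i\<le>a. \<Sum>j\<in>{i<..a}. \<Sum>l<i. G l i j)"
proof -
  have Sigma3: "(\<Sum>x\<in>A. \<Sum>y\<in>B x. \<Sum>z\<in>C x y. H x y z)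
      = (\<Sum>(x,y,z)\<in>Sigma A (\<lambda>x. Sigma (B x) (C x)). H x y z)"
    if "finite A" "\<And>x. finite (B x)" "\<And>x y. finite (C x y)"
    for A B C and H :: "nat \<Rightarrow> nat \<Rightarrow> nat \<Rightarrow> 'a"
    using that by (simp add: sum.Sigma split_def)
  note rot = sum.reindex_bij_witness[of _ "\<lambda>(i,j,l). (l,i,j)" "\<lambda>(l,i,j). (i,j,l)"]
  show "(\<Sum>l\<le>a. \<Sum>i<l. \<Sum>j\<in>{i<..<l}. G l i j)
      = (\<Sum>i\<le>a. \<Sum>j\<in>{i<..a}. \<Sum>l\<in>{j<..a}. G l i j)"
    by (subst (1 2) Sigma3, simp_all, rule rot) auto
  show "(\<Sum>l\<le>a. \<Sum>i<l. \<Sum>j\<in>{l<..a}. G l i j)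
      = (\<Sum>i\<le>a. \<Sum>j\<in>{i<..a}. \<Sum>l\<in>{i<..<j}. G l i j)"
    by (subst (1 2) Sigma3, simp_all, rule rot) auto
  show "(\<Sum>l\<le>a. \<Sum>i\<in>{l<..a}. \<Sum>j\<in>{i<..a}. G l i j)
      = (\<Sum>i\<le>a. \<Sum>j\<in>{i<..a}. \<Sum>l<i. G l i j)"
    by (subst (1 2) Sigma3, simp_all, rule rot) auto
qed

locale graded_operad = vector_space scale
  for scale :: "'k::field \<Rightarrow> 'a::ab_group_add \<Rightarrow> 'a" +
  fixes V :: "nat \<Rightarrow> 'a set" and cmp :: "nat \<Rightarrow> nat \<Rightarrow> 'a \<Rightarrow> nat \<Rightarrow> 'a \<Rightarrow> 'a" and unit :: 'a
  assumes subspace_V: "subspace (V a)"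
    and cmp_closed: "\<lbrakk>f \<in> V a; g \<in> V b; i \<le> a\<rbrakk> \<Longrightarrow> cmp a b f i g \<in> V (a + b)"
    and cmp_add_left: "\<lbrakk>f \<in> V a; f' \<in> V a; g \<in> V b; i \<le> a\<rbrakk> \<Longrightarrow>
          cmp a b (f + f') i g = cmp a b f i g + cmp a b f' i g"
    and cmp_add_right: "\<lbrakk>f \<in> V a; g \<in> V b; g' \<in> V b; i \<le> a\<rbrakk> \<Longrightarrow>
          cmp a b f i (g + g') = cmp a b f i g + cmp a b f i g'"
    and cmp_scale_left: "\<lbrakk>f \<in> V a; g \<in> V b; i \<le> a\<rbrakk> \<Longrightarrow>
          cmp a b (scale s f) i g = scale s (cmp a b f i g)"
    and cmp_scale_right: "\<lbrakk>f \<in> V a; g \<in> V b; i \<le> a\<rbrakk> \<Longrightarrow>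
          cmp a b f i (scale s g) = scale s (cmp a b f i g)"
    and cmp_seq: "\<lbrakk>f \<in> V a; g \<in> V b; h \<in> V c; i \<le> a; j \<le> b\<rbrakk> \<Longrightarrow>
          cmp (a + b) c (cmp a b f i g) (i + j) h = cmp a (b + c) f i (cmp b c g j h)"
    and cmp_par: "\<lbrakk>f \<in> V a; g \<in> V b; h \<in> V c; i < k; k \<le> a\<rbrakk> \<Longrightarrow>
          cmp (a + b) c (cmp a b f i g) (k + b) h = sg (b * c) (cmp (a + c) b (cmp a c f k h) i g)"
    and unit_in: "unit \<in> V 0"
    and cmp_unit: "\<lbrakk>f \<in> V a; i \<le> a\<rbrakk> \<Longrightarrow> cmp a 0 f i unit = f"
begin

lemma V_simps [simp]:
  "0 \<in> V a" "f \<in> V a \<Longrightarrow> g \<in> V a \<Longrightarrow> f + g \<in> V a" "f \<in> V a \<Longrightarrow> g \<in> V a \<Longrightarrow> f - g \<in> V a"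
  "f \<in> V a \<Longrightarrow> - f \<in> V a" "f \<in> V a \<Longrightarrow> scale s f \<in> V a" "f \<in> V a \<Longrightarrow> sg n f \<in> V a"
  using subspace_V[of a] 
  by (auto simp: subspace_0 subspace_add subspace_diff subspace_neg subspace_scale sg_def)

lemma V_sum [simp]: "\<forall>i\<in>A. F i \<in> V a \<Longrightarrow> sum F A \<in> V a"
  using subspace_V[of a] by (simp add: subspace_sum)

lemma sg_scale: "sg n x = scale ((-1) ^ n) x"
  by (simp add: sg_def minus_one_power_iff)

lemma cmp_in [simp]: "\<lbrakk>f \<in> V a; g \<in> V b; i \<le> a; n = a + b\<rbrakk> \<Longrightarrow> cmp a b f i g \<in> V n"
  using cmp_closed by simp

lemma cmp_sg_left: "\<lbrakk>f \<in> V a; g \<in> V b; i \<le> a\<rbrakk> \<Longrightarrow> cmp a b (sg n f) i g = sg n (cmp a b f i g)"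
  by (simp add: sg_scale cmp_scale_left)

lemma cmp_zero_left: "\<lbrakk>g \<in> V b; i \<le> a\<rbrakk> \<Longrightarrow> cmp a b 0 i g = 0"
  using cmp_scale_left[of 0 a g b i 0] by simp

lemma cmp_zero_right: "\<lbrakk>f \<in> V a; i \<le> a\<rbrakk> \<Longrightarrow> cmp a b f i 0 = 0"
  using cmp_scale_right[of f a 0 b i 0] by simp

lemma cmp_sum_left:
  assumes "\<forall>j\<in>J. F j \<in> V a" "g \<in> V b" "i \<le> a"
  shows "cmp a b (\<Sum>j\<in>J. F j) i g = (\<Sum>j\<in>J. cmp a b (F j) i g)"
  using assms(1)
  by (induction J rule: infinite_finite_induct)
     (use assms in \<open>auto simp: cmp_zero_left cmp_add_left\<close>)

lemma cmp_sum_right: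
  assumes "\<forall>j\<in>J. F j \<in> V b" "f \<in> V a" "i \<le> a"
  shows "cmp a b f i (\<Sum>j\<in>J. F j) = (\<Sum>j\<in>J. cmp a b f i (F j))"
  using assms(1)
  by (induction J rule: infinite_finite_induct)
     (use assms in \<open>auto simp: cmp_zero_right cmp_add_right\<close>)

definition circ :: "nat \<Rightarrow> nat \<Rightarrow> 'a \<Rightarrow> 'a \<Rightarrow> 'a" where
  "circ a b f g = (\<Sum>i\<le>a. cmp a b f i g)"

text \<open>The braces \<open>f{g, h}\<close> of Gerstenhaber and Voronov: \<open>g\<close> and \<open>h\<close> are inserted at distinct
  positions, \<open>g\<close> to the left of \<open>h\<close>.\<close>

definition brace :: "nat \<Rightarrow> nat \<Rightarrow> nat \<Rightarrow> 'a \<Rightarrow> 'a \<Rightarrow> 'a \<Rightarrow> 'a" where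
  "brace a b c f g h = (\<Sum>i\<le>a. \<Sum>k\<in>{i<..a}. cmp (a+b) c (cmp a b f i g) (k+b) h)"

lemma circ_in [simp]: "\<lbrakk>f \<in> V a; g \<in> V b; n = a + b\<rbrakk> \<Longrightarrow> circ a b f g \<in> V n"
  by (auto simp: circ_def)

lemma brace_in [simp]: "\<lbrakk>f \<in> V a; g \<in> V b; h \<in> V c; n = a + b + c\<rbrakk> \<Longrightarrow> brace a b c f g h \<in> V n"
  by (auto simp: brace_def)

text \<open>In \<open>(f \<circ> g) \<circ> h\<close> the element \<open>h\<close> is inserted into \<open>g\<close>, to its right or to its left; only
  the last case meets the parallel axiom and its sign.  The defect from associativity is thus
  graded symmetric in \<open>g\<close> and \<open>h\<close>, which is all that the Jacobi identity needs.\<close>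

theorem prelie:
  assumes [simp]: "f \<in> V a" "g \<in> V b" "h \<in> V c"
  shows "circ (a+b) c (circ a b f g) h
    = circ a (b+c) f (circ b c g h) + brace a b c f g h + sg (b*c) (brace a c b f h g)"
proof -
  let ?C = "\<lambda>i l. cmp (a+b) c (cmp a b f i g) l h"
  have "circ (a+b) c (circ a b f g) h = (\<Sum>l\<le>a+b. \<Sum>i\<le>a. ?C i l)"
    unfolding circ_def by (intro sum.cong refl cmp_sum_left) auto
  also have "\<dots> = (\<Sum>i\<le>a. \<Sum>l\<le>a+b. ?C i l)" by (rule sum.swap)
  also have "\<dots> = (\<Sum>i\<le>a. (\<Sum>l<i. ?C i l) + (\<Sum>t\<le>b. ?C i (i+t)) + (\<Sum>k\<in>{i<..a}. ?C i (k+b)))"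
    by (intro sum.cong refl sum_split_slot) simp
  also have "\<dots> = (\<Sum>i\<le>a. \<Sum>l<i. ?C i l) + (\<Sum>i\<le>a. \<Sum>t\<le>b. ?C i (i+t)) + brace a b c f g h"
    by (simp add: sum.distrib brace_def)
  also have "(\<Sum>i\<le>a. \<Sum>t\<le>b. ?C i (i+t)) = (\<Sum>i\<le>a. cmp a (b+c) f i (circ b c g h))"
    unfolding circ_def by (intro sum.cong refl) (simp add: cmp_sum_right cmp_seq)
  also have "(\<Sum>i\<le>a. \<Sum>l<i. ?C i l) = (\<Sum>l\<le>a. \<Sum>i\<in>{l<..a}. ?C i l)"
    by (rule sum_swap_less)
  also have "\<dots> = (\<Sum>l\<le>a. \<Sum>i\<in>{l<..a}. sg (b*c) (cmp (a+c) b (cmp a c f l h) (i+c) g))"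
    by (intro sum.cong refl) (simp add: cmp_par, simp add: sg_def mult.commute)
  also have "\<dots> = sg (b*c) (brace a c b f h g)"
    by (simp add: brace_def sg_def sum_negf)
  finally show ?thesis by (simp add: circ_def add_ac)
qed

text \<open>The sum over all insertions of \<open>g\<close>, \<open>h\<close>, \<open>k\<close> at three distinct positions of \<open>f\<close>, with \<open>g\<close> to the
  left of \<open>h\<close>.  Up to a sign, it is the common part of \<open>f{g, h} \<circ> k\<close> and
  \<open>(f \<circ> k){g, h}\<close>, and it cancels when the two expansions below are compared.\<close>

definition tri :: "nat \<Rightarrow> nat \<Rightarrow> nat \<Rightarrow> nat \<Rightarrow> 'a \<Rightarrow> 'a \<Rightarrow> 'a \<Rightarrow> 'a \<Rightarrow> 'a" where
  "tri a b c e f g h k = (let Q = \<lambda>i j l. cmp (a+b+c) e (cmp (a+b) c (cmp a b f i g) (j+b) h) l k in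
    (\<Sum>i\<le>a. \<Sum>j\<in>{i<..a}. (\<Sum>l<i. Q i j l) + (\<Sum>l\<in>{i<..<j}. Q i j (l+b)) + (\<Sum>l\<in>{j<..a}. Q i j (l+b+c))))"

text \<open>The position of \<open>k\<close> is either one of \<open>f\<close>, or inside \<open>h\<close>, or inside \<open>g\<close>.\<close>

theorem brace_circ:
  assumes [simp]: "f \<in> V a" "g \<in> V b" "h \<in> V c" "k \<in> V e"
  shows "circ (a+b+c) e (brace a b c f g h) k = tri a b c e f g h k
    + brace a b (c+e) f g (circ c e h k) + sg (c*e) (brace a (b+e) c f (circ b e g k) h)"
proof -
  let ?Q = "\<lambda>i j l. cmp (a+b+c) e (cmp (a+b) c (cmp a b f i g) (j+b) h) l k"
  have *: "(\<Sum>l\<le>a+b+c. ?Q i j l) = ((\<Sum>l<i. ?Q i j l) + (\<Sum>l\<in>{i<..<j}. ?Q i j (l+b)) + (\<Sum>l\<in>{j<..a}. ?Q i j (l+b+c)))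
      + cmp (a+b) (c+e) (cmp a b f i g) (j+b) (circ c e h k)
      + sg (c*e) (cmp (a+(b+e)) c (cmp a (b+e) f i (circ b e g k)) (j+(b+e)) h)"
    if ij: "i < j" "j \<le> a" for i j
  proof -
    have "(\<Sum>l\<le>a+b+c. ?Q i j l) = (\<Sum>l<j+b. ?Q i j l) + (\<Sum>t\<le>c. ?Q i j (j+b+t)) + (\<Sum>l\<in>{j+b<..a+b}. ?Q i j (l+c))"
      by (rule sum_split_slot) (use ij in simp)
    also have "(\<Sum>l\<in>{j+b<..a+b}. ?Q i j (l+c)) = (\<Sum>l\<in>{j<..a}. ?Q i j (l+b+c))"
      by (rule sum.reindex_bij_witness[of _ "\<lambda>l. l+b" "\<lambda>l. l-b"]) auto
    also have "(\<Sum>l<j+b. ?Q i j l) = (\<Sum>l<i. ?Q i j l) + (\<Sum>t\<le>b. ?Q i j (i+t)) + (\<Sum>l\<in>{i<..<j}. ?Q i j (l+b))"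
      by (rule sum_split_slot_less) (use ij in simp)
    also have "(\<Sum>t\<le>c. ?Q i j (j+b+t)) = cmp (a+b) (c+e) (cmp a b f i g) (j+b) (circ c e h k)"
      unfolding circ_def using ij by (simp add: cmp_sum_right cmp_seq)
    also have "(\<Sum>t\<le>b. ?Q i j (i+t))
        = (\<Sum>t\<le>b. sg (c*e) (cmp (a+b+e) c (cmp (a+b) e (cmp a b f i g) (i+t) k) (j+b+e) h))"
      using ij by (intro sum.cong refl) (simp add: cmp_par, simp add: sg_def mult.commute)
    also have "\<dots> = sg (c*e) (cmp (a+(b+e)) c (cmp a (b+e) f i (circ b e g k)) (j+(b+e)) h)"
      unfolding circ_def using ij
      by (simp add: cmp_sum_right cmp_sum_left cmp_seq sg_def sum_negf add.assoc)
    finally show ?thesis by (simp add: add_ac)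
  qed
  have "circ (a+b+c) e (brace a b c f g h) k = (\<Sum>l\<le>a+b+c. \<Sum>i\<le>a. \<Sum>j\<in>{i<..a}. ?Q i j l)"
    unfolding circ_def brace_def by (intro sum.cong refl) (simp add: cmp_sum_left)
  also have "\<dots> = (\<Sum>i\<le>a. \<Sum>j\<in>{i<..a}. \<Sum>l\<le>a+b+c. ?Q i j l)"
    by (rule trans[OF sum.swap], rule sum.cong[OF refl], rule sum.swap)
  also have "\<dots> = tri a b c e f g h k
    + brace a b (c+e) f g (circ c e h k) + sg (c*e) (brace a (b+e) c f (circ b e g k) h)"
    by (simp add: * sum.distrib tri_def brace_def sg_def sum_negf)
  finally show ?thesis .
qed

lemma cmp_swap:
  "\<lbrakk>f \<in> V a; g \<in> V b; h \<in> V c; i < k; k \<le> a\<rbrakk> \<Longrightarrow>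
    cmp (a + c) b (cmp a c f k h) i g = sg (b * c) (cmp (a + b) c (cmp a b f i g) (k + b) h)"
  by (simp add: cmp_par sg_def)

text \<open>Here \<open>k\<close> comes first, and \<open>g\<close> and \<open>h\<close> both enter \<open>k\<close>, one of them does, or none.  In the last
  case moving \<open>k\<close> past \<open>g\<close> and \<open>h\<close> to the end gives the sign of the \<open>tri\<close> term.\<close>

theorem circ_brace:
  assumes [simp]: "f \<in> V a" "g \<in> V b" "h \<in> V c" "k \<in> V e"
  shows "brace (a+e) b c (circ a e f k) g h = sg (e*(b+c)) (tri a b c e f g h k)
    + circ a (e+b+c) f (brace e b c k g h) + brace a (e+b) c f (circ e b k g) h
    + sg (e*b) (brace a b (e+c) f g (circ e c k h))"
proof -
  let ?G = "\<lambda>l i j. cmp (a+e+b) c (cmp (a+e) b (cmp a e f l k) i g) (j+b) h"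
  let ?Q = "\<lambda>i j l. cmp (a+b+c) e (cmp (a+b) c (cmp a b f i g) (j+b) h) l k"
  have low: "?G l i j = sg (e*(b+c)) (?Q i j (l+b+c))" if "i < j" "j < l" "l \<le> a" for i j l
  proof -
    have "?G l i j = sg (e*b) (cmp (a+b+e) c (cmp (a+b) e (cmp a b f i g) (l+b) k) (j+b) h)"
      using that by (simp add: cmp_swap[of f a g b k e i l] add_ac cmp_sg_left) (simp add: mult.commute)
    then show ?thesis
      using that cmp_swap[of "cmp a b f i g" "a+b" h c k e "j+b" "l+b"]
      by (simp add: add_ac) (simp add: sg_def)
  qed
  have mid: "?G l i (j+e) = sg (e*(b+c)) (?Q i j (l+b))" if "i < l" "l < j" "j \<le> a" for i j l
  proof -
    have "?G l i (j+e) = sg (e*b) (cmp (a+b+e) c (cmp (a+b) e (cmp a b f i g) (l+b) k) (j+b+e) h)"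
      using that by (simp add: cmp_swap[of f a g b k e i l] add_ac cmp_sg_left) (simp add: mult.commute)
    then show ?thesis
      using that cmp_par[of "cmp a b f i g" "a+b" k e h c "l+b" "j+b"]
      by (simp add: add_ac) (simp add: sg_def)
  qed
  have high: "?G l (i+e) (j+e) = sg (e*(b+c)) (?Q i j l)" if "l < i" "i < j" "j \<le> a" for i j l
  proof -
    have "?G l (i+e) (j+e) = sg (e*b) (cmp (a+b+e) c (cmp (a+b) e (cmp a b f i g) l k) (j+b+e) h)"
    proof -
      have "cmp (a+e) b (cmp a e f l k) (i+e) g = sg (e*b) (cmp (a+b) e (cmp a b f i g) l k)"
        using that by (intro cmp_par) auto
      then show ?thesis using that by (simp add: cmp_sg_left add_ac)
    qed
    then show ?thesis
      using that cmp_par[of "cmp a b f i g" "a+b" k e h c "l" "j+b"]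
      by (simp add: add_ac) (simp add: sg_def)
  qed
  have in_both: "?G l (l+t) (l+u) = cmp a (e+b+c) f l (cmp (e+b) c (cmp e b k t g) (u+b) h)"
    if "l \<le> a" "t < u" "u \<le> e" for l t u
    using that by (simp add: cmp_seq)
      (simp add: add.assoc cmp_seq[of f a "cmp e b k t g" "e+b" h c l "u+b"])
  have in_left: "?G l (l+t) (j+e) = cmp (a+(e+b)) c (cmp a (e+b) f l (cmp e b k t g)) (j+(e+b)) h"
    if "l < j" "j \<le> a" "t \<le> e" for l j t
    using that by (simp add: cmp_seq add.assoc)
  have in_right: "?G l i (l+u) = sg (e*b) (cmp (a+b) (e+c) (cmp a b f i g) (l+b) (cmp e c k u h))"
    if "i < l" "l \<le> a" "u \<le> e" for i l u
    using that cmp_seq[of "cmp a b f i g" "a+b" k e h c "l+b" u]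
    by (simp add: cmp_swap[of f a g b k e i l] add_ac cmp_sg_left) (simp add: mult.commute)
  have "brace (a+e) b c (circ a e f k) g h = (\<Sum>i\<le>a+e. \<Sum>j\<in>{i<..a+e}. \<Sum>l\<le>a. ?G l i j)"
    unfolding circ_def brace_def by (intro sum.cong refl) (simp add: cmp_sum_left)
  also have "\<dots> = (\<Sum>i\<le>a+e. \<Sum>l\<le>a. \<Sum>j\<in>{i<..a+e}. ?G l i j)"
    by (rule sum.cong[OF refl], rule sum.swap)
  also have "\<dots> = (\<Sum>l\<le>a. \<Sum>i\<le>a+e. \<Sum>j\<in>{i<..a+e}. ?G l i j)"
    by (rule sum.swap)
  also have "\<dots> = (\<Sum>l\<le>a. \<Sum>i<l. \<Sum>j\<in>{i<..<l}. ?G l i j) + (\<Sum>l\<le>a. \<Sum>i<l. \<Sum>u\<le>e. ?G l i (l+u))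
    + (\<Sum>l\<le>a. \<Sum>i<l. \<Sum>j\<in>{l<..a}. ?G l i (j+e)) + (\<Sum>l\<le>a. \<Sum>t\<le>e. \<Sum>u\<in>{t<..e}. ?G l (l+t) (l+u))
    + (\<Sum>l\<le>a. \<Sum>t\<le>e. \<Sum>j\<in>{l<..a}. ?G l (l+t) (j+e))
    + (\<Sum>l\<le>a. \<Sum>i\<in>{l<..a}. \<Sum>j\<in>{i<..a}. ?G l (i+e) (j+e))"
    by (simp add: sum_split_slot_pairs sum.distrib)
  also have "(\<Sum>l\<le>a. \<Sum>i<l. \<Sum>j\<in>{i<..<l}. ?G l i j)
      = sg (e*(b+c)) (\<Sum>i\<le>a. \<Sum>j\<in>{i<..a}. \<Sum>l\<in>{j<..a}. ?Q i j (l+b+c))"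
    unfolding sum_triple_first by (simp add: low sg_scale scale_sum_right)
  also have "(\<Sum>l\<le>a. \<Sum>i<l. \<Sum>j\<in>{l<..a}. ?G l i (j+e))
      = sg (e*(b+c)) (\<Sum>i\<le>a. \<Sum>j\<in>{i<..a}. \<Sum>l\<in>{i<..<j}. ?Q i j (l+b))"
    unfolding sum_triple_middle by (simp add: mid sg_scale scale_sum_right)
  also have "(\<Sum>l\<le>a. \<Sum>i\<in>{l<..a}. \<Sum>j\<in>{i<..a}. ?G l (i+e) (j+e))
      = sg (e*(b+c)) (\<Sum>i\<le>a. \<Sum>j\<in>{i<..a}. \<Sum>l<i. ?Q i j l)"
    unfolding sum_triple_last by (simp add: high sg_scale scale_sum_right)
  also have "(\<Sum>l\<le>a. \<Sum>t\<le>e. \<Sum>u\<in>{t<..e}. ?G l (l+t) (l+u)) = circ a (e+b+c) f (brace e b c k g h)"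
    unfolding circ_def brace_def
    by (intro sum.cong refl) (simp add: cmp_sum_right in_both)
  also have "(\<Sum>l\<le>a. \<Sum>t\<le>e. \<Sum>j\<in>{l<..a}. ?G l (l+t) (j+e)) = brace a (e+b) c f (circ e b k g) h"
    unfolding circ_def brace_def
    by (rule sum.cong[OF refl], subst sum.swap, intro sum.cong refl)
       (simp add: cmp_sum_right cmp_sum_left in_left)
  also have "(\<Sum>l\<le>a. \<Sum>i<l. \<Sum>u\<le>e. ?G l i (l+u)) = (\<Sum>i\<le>a. \<Sum>l\<in>{i<..a}. \<Sum>u\<le>e. ?G l i (l+u))"
    by (rule sum_swap_less)
  also have "\<dots> = sg (e*b) (brace a b (e+c) f g (circ e c k h))"
    unfolding circ_def brace_def
    by (simp add: cmp_sum_right in_right sg_scale scale_sum_right[symmetric])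
  also have "sg (e*(b+c)) (tri a b c e f g h k)
      = sg (e*(b+c)) (\<Sum>i\<le>a. \<Sum>j\<in>{i<..a}. \<Sum>l\<in>{j<..a}. ?Q i j (l+b+c))
      + sg (e*(b+c)) (\<Sum>i\<le>a. \<Sum>j\<in>{i<..a}. \<Sum>l\<in>{i<..<j}. ?Q i j (l+b))
      + sg (e*(b+c)) (\<Sum>i\<le>a. \<Sum>j\<in>{i<..a}. \<Sum>l<i. ?Q i j l)"
    by (simp add: tri_def sum.distrib) (simp add: sg_def)
  then show ?thesis
    using calculation by (simp add: add_ac)
qed

text \<open>An element of degree one has two positions only.\<close>

lemma tri_binary: "tri (Suc 0) b c e f g h k = 0"
proof -
  have "{..Suc 0} = {0,Suc 0}" "{0<..Suc 0} = {Suc 0}" "{0<..<Suc 0} = {}" by auto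
  then show ?thesis by (simp add: tri_def) 
qed

lemma circ_add_left: "\<lbrakk>f \<in> V a; f' \<in> V a; g \<in> V b\<rbrakk> \<Longrightarrow>
    circ a b (f + f') g = circ a b f g + circ a b f' g"
  and circ_add_right: "\<lbrakk>f \<in> V a; g \<in> V b; g' \<in> V b\<rbrakk> \<Longrightarrow>
    circ a b f (g + g') = circ a b f g + circ a b f g'"
  and circ_scale_left: "\<lbrakk>f \<in> V a; g \<in> V b\<rbrakk> \<Longrightarrow> circ a b (scale s f) g = scale s (circ a b f g)"
  and circ_scale_right: "\<lbrakk>f \<in> V a; g \<in> V b\<rbrakk> \<Longrightarrow> circ a b f (scale s g) = scale s (circ a b f g)"
  by (simp_all add: circ_def cmp_add_left cmp_add_right cmp_scale_left cmp_scale_right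
      sum.distrib scale_sum_right)

lemma brace_add_1: "\<lbrakk>f \<in> V a; f' \<in> V a; g \<in> V b; h \<in> V c\<rbrakk> \<Longrightarrow>
    brace a b c (f + f') g h = brace a b c f g h + brace a b c f' g h"
  and brace_add_2: "\<lbrakk>f \<in> V a; g \<in> V b; g' \<in> V b; h \<in> V c\<rbrakk> \<Longrightarrow>
    brace a b c f (g + g') h = brace a b c f g h + brace a b c f g' h"
  and brace_add_3: "\<lbrakk>f \<in> V a; g \<in> V b; h \<in> V c; h' \<in> V c\<rbrakk> \<Longrightarrow>
    brace a b c f g (h + h') = brace a b c f g h + brace a b c f g h'"
  and brace_scale_1: "\<lbrakk>f \<in> V a; g \<in> V b; h \<in> V c\<rbrakk> \<Longrightarrow>
    brace a b c (scale s f) g h = scale s (brace a b c f g h)"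
  and brace_scale_2: "\<lbrakk>f \<in> V a; g \<in> V b; h \<in> V c\<rbrakk> \<Longrightarrow>
    brace a b c f (scale s g) h = scale s (brace a b c f g h)"
  and brace_scale_3: "\<lbrakk>f \<in> V a; g \<in> V b; h \<in> V c\<rbrakk> \<Longrightarrow>
    brace a b c f g (scale s h) = scale s (brace a b c f g h)"
  by (simp_all add: brace_def cmp_add_left cmp_add_right cmp_scale_left cmp_scale_right
      sum.distrib scale_sum_right)

lemma circ_minus_left: "\<lbrakk>f \<in> V a; g \<in> V b\<rbrakk> \<Longrightarrow> circ a b (- f) g = - circ a b f g"
  and circ_minus_right: "\<lbrakk>f \<in> V a; g \<in> V b\<rbrakk> \<Longrightarrow> circ a b f (- g) = - circ a b f g"
  using circ_scale_left[of f a g b "-1"] circ_scale_right[of f a g b "-1"] by simp_all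

lemma circ_diff_left: "\<lbrakk>f \<in> V a; f' \<in> V a; g \<in> V b\<rbrakk> \<Longrightarrow>
    circ a b (f - f') g = circ a b f g - circ a b f' g"
  and circ_diff_right: "\<lbrakk>f \<in> V a; g \<in> V b; g' \<in> V b\<rbrakk> \<Longrightarrow>
    circ a b f (g - g') = circ a b f g - circ a b f g'"
  using circ_add_left[of f a "- f'" g b] circ_add_right[of f a g b "- g'"]
  by (simp_all add: circ_minus_left circ_minus_right)

lemma brace_minus_1: "\<lbrakk>f \<in> V a; g \<in> V b; h \<in> V c\<rbrakk> \<Longrightarrow> brace a b c (- f) g h = - brace a b c f g h"
  and brace_minus_2: "\<lbrakk>f \<in> V a; g \<in> V b; h \<in> V c\<rbrakk> \<Longrightarrow> brace a b c f (- g) h = - brace a b c f g h"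
  and brace_minus_3: "\<lbrakk>f \<in> V a; g \<in> V b; h \<in> V c\<rbrakk> \<Longrightarrow> brace a b c f g (- h) = - brace a b c f g h"
  using brace_scale_1[of f a g b h c "-1"] brace_scale_2[of f a g b h c "-1"]
    brace_scale_3[of f a g b h c "-1"] by simp_all

lemma brace_diff_1: "\<lbrakk>f \<in> V a; f' \<in> V a; g \<in> V b; h \<in> V c\<rbrakk> \<Longrightarrow>
    brace a b c (f - f') g h = brace a b c f g h - brace a b c f' g h"
  and brace_diff_2: "\<lbrakk>f \<in> V a; g \<in> V b; g' \<in> V b; h \<in> V c\<rbrakk> \<Longrightarrow>
    brace a b c f (g - g') h = brace a b c f g h - brace a b c f g' h"
  and brace_diff_3: "\<lbrakk>f \<in> V a; g \<in> V b; h \<in> V c; h' \<in> V c\<rbrakk> \<Longrightarrow>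
    brace a b c f g (h - h') = brace a b c f g h - brace a b c f g h'"
  using brace_add_1[of f a "- f'" g b h c] brace_add_2[of f a g b "- g'" h c]
    brace_add_3[of f a g b h c "- h'"]
  by (simp_all add: brace_minus_1 brace_minus_2 brace_minus_3)

lemmas linear_simps =
  circ_add_left circ_add_right circ_diff_left circ_diff_right circ_minus_left circ_minus_right
  brace_add_1 brace_add_2 brace_add_3 brace_diff_1 brace_diff_2 brace_diff_3
  brace_minus_1 brace_minus_2 brace_minus_3

lemma prelie':
  "\<lbrakk>f \<in> V a; g \<in> V b; h \<in> V c; n = a + b\<rbrakk> \<Longrightarrow> circ n c (circ a b f g) h
    = circ a (b+c) f (circ b c g h) + brace a b c f g h + sg (b*c) (brace a c b f h g)"
  using prelie by simp

definition brk :: "nat \<Rightarrow> nat \<Rightarrow> 'a \<Rightarrow> 'a \<Rightarrow> 'a" where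
  "brk a b f g = circ a b f g - sg (a*b) (circ b a g f)"

lemma brk_in [simp]: "\<lbrakk>f \<in> V a; g \<in> V b; n = a + b\<rbrakk> \<Longrightarrow> brk a b f g \<in> V n"
  by (simp add: brk_def add_ac)

theorem brk_antisym: "brk a b f g = - sg (a*b) (brk b a g f)"
  by (simp add: brk_def sg_def mult.commute)

text \<open>Both sides expand by \<open>prelie\<close> into iterated \<open>circ\<close> and \<open>brace\<close> terms, which cancel once the
  parities of the degrees are fixed.\<close>

theorem brk_jacobi:
  assumes [simp]: "f \<in> V a" "g \<in> V b" "h \<in> V c"
  shows "brk a (b+c) f (brk b c g h) = brk (a+b) c (brk a b f g) h + sg (a*b) (brk b (a+c) g (brk a c f h))"
  by (cases "even a"; cases "even b"; cases "even c")
     (simp_all add: brk_def sg_def linear_simps prelie' algebra_simps)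
end

section \<open>Operads with multiplication\<close>

locale multiplicative_operad = graded_operad +
  fixes \<pi> :: 'b
  assumes \<pi>_in [simp]: "\<pi> \<in> V (Suc 0)"
    and \<pi>_assoc: "cmp (Suc 0) (Suc 0) \<pi> (Suc 0) \<pi> = - cmp (Suc 0) (Suc 0) \<pi> 0 \<pi>"
begin

text \<open>The two conditions \<open>\<pi> \<bullet>\<^sub>1 \<pi> = \<pi> \<bullet>\<^sub>2 \<pi>\<close> and \<open>\<pi> \<circ> \<pi> = 0\<close> agree because the signed composition at
  position \<open>1\<close> with an element of degree one is the negative of the unsigned one.\<close>

lemma \<pi>_\<pi>: "circ (Suc 0) (Suc 0) \<pi> \<pi> = 0"
proof -
  have "{..Suc 0} = {0, Suc 0}" by auto
  then show ?thesis by (simp add: circ_def \<pi>_assoc)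
qed

definition d :: "nat \<Rightarrow> 'b \<Rightarrow> 'b" where
  "d a f = circ (Suc 0) a \<pi> f - sg a (circ a (Suc 0) f \<pi>)"

text \<open>The product of Gerstenhaber and Voronov.\<close>

definition cup :: "nat \<Rightarrow> nat \<Rightarrow> 'b \<Rightarrow> 'b \<Rightarrow> 'b" where
  "cup a b f g = sg (Suc a) (brace (Suc 0) a b \<pi> f g)"

lemma d_brk: "d a f = brk (Suc 0) a \<pi> f"
  by (simp add: d_def brk_def)

lemma d_in [simp]: "\<lbrakk>f \<in> V a; n = Suc a\<rbrakk> \<Longrightarrow> d a f \<in> V n"
  by (simp add: d_def)

lemma cup_in [simp]: "\<lbrakk>f \<in> V a; g \<in> V b; n = Suc (a + b)\<rbrakk> \<Longrightarrow> cup a b f g \<in> V n"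
  by (simp add: cup_def)

text \<open>By \<open>prelie\<close> and \<open>\<pi> \<circ> \<pi> = 0\<close>, without dividing the graded Jacobi identity by two.\<close>

theorem d_d:
  assumes [simp]: "f \<in> V a"
  shows "d (Suc a) (d a f) = 0"
proof -
  have "circ (Suc (Suc 0)) a (circ (Suc 0) (Suc 0) \<pi> \<pi>) f = 0"
    by (simp only: \<pi>_\<pi>) (simp add: circ_def cmp_zero_left)
  moreover have "circ a (Suc (Suc 0)) f (circ (Suc 0) (Suc 0) \<pi> \<pi>) = 0"
    by (simp only: \<pi>_\<pi>) (simp add: circ_def cmp_zero_right)
  ultimately show ?thesis
    by (cases "even a") (simp_all add: d_def linear_simps sg_def prelie' algebra_simps add_eq_0_iff)
qed

text \<open>Since \<open>d = [\<pi>, -]\<close>, this is the Jacobi identity.\<close>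

theorem d_brk_derivation:
  assumes [simp]: "f \<in> V a" "g \<in> V b"
  shows "d (a+b) (brk a b f g) = brk (Suc a) b (d a f) g + sg a (brk a (Suc b) f (d b g))"
  using brk_jacobi[of \<pi> "Suc 0" f a g b] by (simp add: d_brk)

text \<open>The pre-Lie product \<open>f \<circ> g\<close> is a homotopy for the commutator of the product: expanding
  \<open>(\<pi> \<circ> f) \<circ> g\<close> by \<open>prelie\<close> produces \<open>\<pi>{f, g}\<close> and \<open>\<pi>{g, f}\<close>, and all the other terms cancel.\<close>

theorem cup_commute:
  assumes [simp]: "f \<in> V a" "g \<in> V b"
  shows "d (a+b) (circ a b f g) = circ (Suc a) b (d a f) g + sg a (circ a (Suc b) f (d b g))
     + sg a (cup a b f g - sg (Suc a * Suc b) (cup b a g f))"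
  by (cases "even a"; cases "even b")
     (simp_all add: d_def cup_def sg_def linear_simps prelie' algebra_simps)

lemma brace_binary: "brace (Suc 0) a b \<pi> f g = cmp (Suc a) b (cmp (Suc 0) a \<pi> 0 f) (Suc a) g"
proof -
  have "{..Suc 0} = {0, Suc 0}" "{0<..Suc 0} = {Suc 0}" by auto
  then show ?thesis by (simp add: brace_def)
qed

text \<open>Both sides are insertions of \<open>f\<close>, \<open>g\<close>, \<open>h\<close> into one of the two compositions of \<open>\<pi>\<close> with itself, which
  differ by a sign.\<close>

lemma brace_assoc:
  assumes [simp]: "f \<in> V a" "g \<in> V b" "h \<in> V c"
  shows "brace (Suc 0) a (Suc (b+c)) \<pi> f (brace (Suc 0) b c \<pi> g h)
    = - sg a (brace (Suc 0) (Suc (a+b)) c \<pi> (brace (Suc 0) a b \<pi> f g) h)"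
proof -
  let ?P = "cmp (Suc 0) a \<pi> 0 f"
  let ?L = "cmp (Suc (Suc a)) b (cmp (Suc (Suc 0)) a (cmp (Suc 0) (Suc 0) \<pi> 0 \<pi>) 0 f) (Suc a) g"
  have "cmp (Suc a) (Suc (b+c)) ?P (Suc a) (cmp (Suc b) c (cmp (Suc 0) b \<pi> 0 g) (Suc b) h)
      = cmp (Suc (Suc (a+b))) c (cmp (Suc a) (Suc b) ?P (Suc a) (cmp (Suc 0) b \<pi> 0 g)) (Suc (Suc (a+b))) h"
    using cmp_seq[of ?P "Suc a" "cmp (Suc 0) b \<pi> 0 g" "Suc b" h c "Suc a" "Suc b"] by simp
  also have "cmp (Suc a) (Suc b) ?P (Suc a) (cmp (Suc 0) b \<pi> 0 g)
      = cmp (Suc (Suc a)) b (cmp (Suc a) (Suc 0) ?P (Suc a) \<pi>) (Suc a) g"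
    using cmp_seq[of ?P "Suc a" \<pi> "Suc 0" g b "Suc a" 0] by simp
  also have "cmp (Suc a) (Suc 0) ?P (Suc a) \<pi>
      = scale (- ((-1) ^ a)) (cmp (Suc (Suc 0)) a (cmp (Suc 0) (Suc 0) \<pi> 0 \<pi>) 0 f)"
    using cmp_par[of \<pi> "Suc 0" f a \<pi> "Suc 0" 0 "Suc 0"] \<pi>_assoc
      cmp_scale_left[of "cmp (Suc 0) (Suc 0) \<pi> 0 \<pi>" "Suc (Suc 0)" f a 0 "-1"]
    by (simp add: sg_scale)
  also have "cmp (Suc (Suc a)) b \<dots> (Suc a) g = scale (- ((-1) ^ a)) ?L"
    by (rule cmp_scale_left) auto
  also have "cmp (Suc (Suc (a+b))) c \<dots> (Suc (Suc (a+b))) h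
      = scale (- ((-1) ^ a)) (cmp (Suc (Suc (a+b))) c ?L (Suc (Suc (a+b))) h)"
    by (rule cmp_scale_left) auto
  also have "?L = cmp (Suc (Suc a)) b (cmp (Suc 0) (Suc a) \<pi> 0 ?P) (Suc a) g"
    using cmp_seq[of \<pi> "Suc 0" \<pi> "Suc 0" f a 0 0] by simp
  also have "\<dots> = cmp (Suc 0) (Suc (a+b)) \<pi> 0 (cmp (Suc a) b ?P (Suc a) g)"
    using cmp_seq[of \<pi> "Suc 0" ?P "Suc a" g b 0 "Suc a"] by simp
  finally show ?thesis by (simp add: brace_binary sg_scale)
qed

theorem cup_assoc:
  assumes [simp]: "f \<in> V a" "g \<in> V b" "h \<in> V c"
  shows "cup (Suc (a+b)) c (cup a b f g) h = cup a (Suc (b+c)) f (cup b c g h)"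
  by (cases "even a"; cases "even b"; cases "even c")
     (simp_all add: cup_def sg_def brace_assoc linear_simps)

text \<open>Inserting the operad unit in the other slot writes \<open>\<pi> \<circ> f\<close> through products; in this way the
  derivation rule for \<open>d\<close> reduces to associativity of the product.\<close>

lemma mult_unit:
  assumes [simp]: "f \<in> V a"
  shows "circ (Suc 0) a \<pi> f = brace (Suc 0) a 0 \<pi> f unit + brace (Suc 0) 0 a \<pi> unit f"
proof -
  have "{..Suc 0} = {0, Suc 0}" by auto
  then show ?thesis by (simp add: circ_def brace_binary cmp_unit)
qed

theorem d_cup:
  assumes [simp]: "f \<in> V a" "g \<in> V b"
  shows "d (Suc (a+b)) (cup a b f g) = cup (Suc a) b (d a f) g + sg (Suc a) (cup a (Suc b) f (d b g))"
proof -
  have [simp]: "unit \<in> V 0" by (rule unit_in)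
  show ?thesis
    using brace_circ[of \<pi> "Suc 0" f a g b \<pi> "Suc 0"]
      brace_assoc[of f a g b unit 0] brace_assoc[of f a unit 0 g b] brace_assoc[of unit 0 f a g b]
    by (cases "even a"; cases "even b")
       (simp_all add: d_def cup_def sg_def linear_simps tri_binary mult_unit algebra_simps)
qed

text \<open>Insertion on the right is a strict derivation of the product, because \<open>\<pi>\<close> has no room for a
  third element.\<close>

lemma cup_circ:
  assumes [simp]: "f \<in> V a" "g \<in> V b" "h \<in> V c"
  shows "circ (Suc (a+b)) c (cup a b f g) h
    = cup a (b+c) f (circ b c g h) + sg (Suc b*c) (cup (a+c) b (circ a c f h) g)"
  using brace_circ[of \<pi> "Suc 0" f a g b h c]
  by (cases "even a"; cases "even b"; cases "even c")
     (simp_all add: cup_def sg_def linear_simps tri_binary)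

text \<open>The brace \<open>f{g, h}\<close> is a homotopy for the failure of \<open>f \<circ> -\<close> to be a derivation of the product.
  The term \<open>tri\<close> occurs in \<open>f{g, h} \<circ> \<pi>\<close> and in \<open>(f \<circ> \<pi>){g, h}\<close>, and is eliminated by solving the
  first expansion for it.\<close>

theorem d_brace:
  assumes [simp]: "f \<in> V a" "g \<in> V b" "h \<in> V c"
  shows "d (a+b+c) (brace a b c f g h) = brace (Suc a) b c (d a f) g h
    + sg a (brace a (Suc b) c f (d b g) h) + sg (a+b) (brace a b (Suc c) f g (d c h))
    + sg (a + Suc b) (circ a (Suc (b+c)) f (cup b c g h) 
       - cup (a+b) c (circ a b f g) h - sg (a * Suc b) (cup b (a+c) g (circ a c f h)))"
proof -
  have tri_eq: "tri a b c (Suc 0) f g h \<pi> = circ (a+b+c) (Suc 0) (brace a b c f g h) \<pi>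
      - brace a b (c + Suc 0) f g (circ c (Suc 0) h \<pi>)
      - sg (c * Suc 0) (brace a (b + Suc 0) c f (circ b (Suc 0) g \<pi>) h)"
    by (simp only: brace_circ assms \<pi>_in) simp
  have f_eq: "brace (Suc a) b c (circ a (Suc 0) f \<pi>) g h = sg (b+c) (tri a b c (Suc 0) f g h \<pi>)
      + circ a (Suc (b+c)) f (brace (Suc 0) b c \<pi> g h) + brace a (Suc b) c f (circ (Suc 0) b \<pi> g) h
      + sg b (brace a b (Suc c) f g (circ (Suc 0) c \<pi> h))"
    using circ_brace[of f a g b h c \<pi> "Suc 0"] by simp
  have \<pi>_eq: "brace (Suc a) b c (circ (Suc 0) a \<pi> f) g h = circ (Suc 0) (a+b+c) \<pi> (brace a b c f g h)
      + brace (Suc 0) (a+b) c \<pi> (circ a b f g) h + sg (a*b) (brace (Suc 0) b (a+c) \<pi> g (circ a c f h))"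
    using circ_brace[of \<pi> "Suc 0" g b h c f a] by (simp add: tri_binary sg_def)
  show ?thesis
    by (cases "even a"; cases "even b"; cases "even c")
       (simp_all add: d_def cup_def sg_def linear_simps tri_eq f_eq \<pi>_eq algebra_simps)
qed
end

section \<open>Gerstenhaber algebras of cohomology classes\<close>

lemma coset_of_eq_iff:
  assumes "module.subspace s B" "module s"
  shows "coset_of B x = coset_of B y \<longleftrightarrow> x - y \<in> B"
proof -
  interpret module s by fact
  have mem: "z \<in> coset_of B x \<longleftrightarrow> z - x \<in> B" for x z
  proof
    show "z \<in> coset_of B x" if "z - x \<in> B"
      unfolding coset_of_def using that by (rule rev_image_eqI) simp
  qed (auto simp: coset_of_def)
  show ?thesis
  proof
    assume "coset_of B x = coset_of B y"
    moreover have "x \<in> coset_of B x"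
      using subspace_0[OF assms(1)] by (simp add: mem)
    ultimately show "x - y \<in> B" by (simp add: mem)
  next
    assume xy: "x - y \<in> B"
    have "z - x \<in> B \<longleftrightarrow> z - y \<in> B" for z
      using subspace_add[OF assms(1) _ xy, of "z - x"] subspace_diff[OF assms(1) _ xy, of "z - y"]
      by auto
    then show "coset_of B x = coset_of B y" by (auto simp: mem)
  qed
qed

text \<open>Cocycles and coboundaries, indexed by arity; cochains start in arity one.\<close>

locale graded_pair = vector_space scale
  for scale :: "'k::field \<Rightarrow> 'a::ab_group_add \<Rightarrow> 'a" +
  fixes Z B :: "nat \<Rightarrow> 'a set"
  assumes subspace_Z: "n > 0 \<Longrightarrow> subspace (Z n)"
    and subspace_B: "n > 0 \<Longrightarrow> subspace (B n)"
    and B_subset: "n > 0 \<Longrightarrow> B n \<subseteq> Z n"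
begin

definition descends :: "nat \<Rightarrow> nat \<Rightarrow> nat \<Rightarrow> ('a \<Rightarrow> 'a \<Rightarrow> 'a) \<Rightarrow> bool" where
  "descends m n p f \<longleftrightarrow>
     (\<forall>x\<in>Z m. \<forall>y\<in>Z n. f x y \<in> Z p) \<and>
     (\<forall>x\<in>Z m. \<forall>x'\<in>Z m. \<forall>y\<in>Z n. f (x + x') y = f x y + f x' y) \<and>
     (\<forall>x\<in>Z m. \<forall>y\<in>Z n. \<forall>y'\<in>Z n. f x (y + y') = f x y + f x y') \<and>
     (\<forall>x\<in>Z m. \<forall>y\<in>Z n. \<forall>a. f (scale a x) y = scale a (f x y)) \<and>
     (\<forall>x\<in>Z m. \<forall>y\<in>Z n. \<forall>a. f x (scale a y) = scale a (f x y)) \<and>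
     (\<forall>x\<in>B m. \<forall>y\<in>Z n. f x y \<in> B p) \<and> (\<forall>x\<in>Z m. \<forall>y\<in>B n. f x y \<in> B p)"

abbreviation cls :: "nat \<Rightarrow> 'a \<Rightarrow> 'a set" where "cls n \<equiv> coset_of (B n)"
abbreviation H :: "nat \<Rightarrow> 'a set set" where "H n \<equiv> cls n ` Z n"

lemma cls_eq: "n > 0 \<Longrightarrow> cls n x = cls n y \<longleftrightarrow> x - y \<in> B n"
  using coset_of_eq_iff[OF subspace_B] module_axioms by blast

lemma cls_eqI: "n > 0 \<Longrightarrow> x - y \<in> B n \<Longrightarrow> cls n x = cls n y"
  using cls_eq by blast

text \<open>The set-valued \<open>induced1\<close> and \<open>induced2\<close> take the value of any representative as soon as
  the class does not depend on it.\<close>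

lemma Union_cls:
  assumes "n > 0" "x \<in> X" "\<And>x'. x' \<in> X \<Longrightarrow> f x' - f x \<in> B n"
  shows "(\<Union>x\<in>X. cls n (f x)) = cls n (f x)"
  using assms cls_eq[OF assms(1)] by blast

lemma rep: "n > 0 \<Longrightarrow> x \<in> cls n x"
  using subspace_0[OF subspace_B] unfolding coset_of_def by (force intro: image_eqI[of _ _ 0])

lemma induced2_cls:
  assumes f: "descends m n p f" and [simp]: "m > 0" "n > 0" "p > 0" and x: "x \<in> Z m" and y: "y \<in> Z n"
  shows "induced2 (B p) f (cls m x) (cls n y) = cls p (f x y)"
proof -
  have *: "f (x + b) (y + b') - f x y \<in> B p" if "b \<in> B m" "b' \<in> B n" for b b'
  proof -
    have b: "b \<in> Z m" "b' \<in> Z n" using that B_subset[of m] B_subset[of n] by auto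
    have "y + b' \<in> Z n" using b y subspace_add[OF subspace_Z] by simp
    then have "f (x + b) (y + b') - f x y = f b (y + b') + f x b'"
      using f b x y by (simp add: descends_def)
    also have "\<dots> \<in> B p"
      using f that x \<open>y + b' \<in> Z n\<close> by (intro subspace_add[OF subspace_B]) (auto simp: descends_def)
    finally show ?thesis .
  qed
  have "induced2 (B p) f (cls m x) (cls n y)
      = (\<Union>(x,y)\<in>cls m x \<times> cls n y. cls p (f x y))"
    unfolding induced2_def by blast
  also have "\<dots> = (\<Union>u\<in>cls m x \<times> cls n y. cls p (case_prod f u))" by auto
  also have "\<dots> = cls p (case_prod f (x,y))"
    by (rule Union_cls) (auto simp: rep, auto simp: coset_of_def *)
  finally show ?thesis by simp
qed

lemma induced2_add:
  assumes [simp]: "n > 0"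
  shows "induced2 (B n) (+) (cls n x) (cls n y) = cls n (x + y)"
proof -
  have "induced2 (B n) (+) (cls n x) (cls n y)
      = (\<Union>u\<in>cls n x \<times> cls n y. cls n (case_prod (+) u))"
    unfolding induced2_def by auto
  also have "\<dots> = cls n (case_prod (+) (x,y))"
  proof (rule Union_cls)
    show "case_prod (+) u - case_prod (+) (x, y) \<in> B n" if "u \<in> cls n x \<times> cls n y" for u
    proof -
      obtain b b' where "u = (x + b, y + b')" "b \<in> B n" "b' \<in> B n"
        using \<open>u \<in> _\<close> by (auto simp: coset_of_def)
      then show ?thesis using subspace_add[OF subspace_B, of n b b'] by (simp add: algebra_simps)
    qed
  qed (auto simp: rep)
  finally show ?thesis by simp
qed

lemma induced1_scale:
  assumes [simp]: "n > 0"
  shows "induced1 (B n) (scale a) (cls n x) = cls n (scale a x)"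
  unfolding induced1_def
proof (rule Union_cls)
  show "scale a u - scale a x \<in> B n" if "u \<in> cls n x" for u
    using that subspace_scale[OF subspace_B, of n _ a] by (auto simp: coset_of_def scale_right_distrib)
qed (auto simp: rep)

lemma cls_0: "n > 0 \<Longrightarrow> cls n 0 = B n"
  by (simp add: coset_of_def)

lemma vector_space_H:
  assumes [simp]: "n > 0"
  shows "carrier_vector_space (H n) (B n) (induced2 (B n) (+)) (\<lambda>a. induced1 (B n) (scale a))"
proof -
  note closed = subspace_0[OF subspace_Z] subspace_add[OF subspace_Z] subspace_scale[OF subspace_Z]
  have "carrier_vector_space (H n) (cls n 0) (induced2 (B n) (+)) (\<lambda>a. induced1 (B n) (scale a))"
  proof
    fix x assume "x \<in> H n"
    then obtain u where u: "x = cls n u" "u \<in> Z n" by blast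
    have "- u \<in> Z n" using u subspace_neg[OF subspace_Z] by simp
    then show "\<exists>y\<in>H n. induced2 (B n) (+) x y = cls n 0"
      by (intro bexI[of _ "cls n (- u)"]) (simp_all add: u induced2_add)
  qed (auto simp: induced2_add induced1_scale add_ac scale_right_distrib scale_left_distrib
         intro!: imageI closed)
  then show ?thesis by (simp add: cls_0)
qed

lemma bilinear_H:
  assumes f: "descends m n p f" and [simp]: "m > 0" "n > 0" "p > 0"
  shows "carrier_bilinear (H m) (B m) (induced2 (B m) (+)) (\<lambda>a. induced1 (B m) (scale a))
    (H n) (B n) (induced2 (B n) (+)) (\<lambda>a. induced1 (B n) (scale a))
    (H p) (B p) (induced2 (B p) (+)) (\<lambda>a. induced1 (B p) (scale a)) (induced2 (B p) f)"
proof -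
  interpret U: carrier_vector_space "H m" "B m" "induced2 (B m) (+)" "\<lambda>a. induced1 (B m) (scale a)"
    by (rule vector_space_H) simp
  interpret V: carrier_vector_space "H n" "B n" "induced2 (B n) (+)" "\<lambda>a. induced1 (B n) (scale a)"
    by (rule vector_space_H) simp
  interpret W: carrier_vector_space "H p" "B p" "induced2 (B p) (+)" "\<lambda>a. induced1 (B p) (scale a)"
    by (rule vector_space_H) simp
  show ?thesis
    using f
    by unfold_locales
      (auto simp: induced2_add induced1_scale induced2_cls[OF f] 
       subspace_add[OF subspace_Z] subspace_scale[OF subspace_Z], auto simp: descends_def)
qed

text \<open>Chain level operations that descend, and satisfy the identities up to coboundaries, induce a
  Gerstenhaber algebra on the classes.\<close>

theorem gerstenhaber_quotient:
  assumes mul: "\<And>m n. \<lbrakk>m > 0; n > 0\<rbrakk> \<Longrightarrow> descends m n (m+n) (mul m n)"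
    and brk: "\<And>m n. \<lbrakk>m > 0; n > 0\<rbrakk> \<Longrightarrow> descends m n (m+n-1) (brk m n)"
    and assoc: "\<And>m n p a b c. \<lbrakk>m > 0; n > 0; p > 0; a \<in> Z m; b \<in> Z n; c \<in> Z p\<rbrakk> \<Longrightarrow>
      mul (m+n) p (mul m n a b) c - mul m (n+p) a (mul n p b c) \<in> B (m+n+p)"
    and commute: "\<And>m n a b. \<lbrakk>m > 0; n > 0; a \<in> Z m; b \<in> Z n\<rbrakk> \<Longrightarrow>
      mul m n a b - scale ((-1) ^ (m * n)) (mul n m b a) \<in> B (m+n)"
    and antisym: "\<And>m n a b. \<lbrakk>m > 0; n > 0; a \<in> Z m; b \<in> Z n\<rbrakk> \<Longrightarrow>
      brk m n a b - scale (- ((-1) ^ ((m - 1) * (n - 1)))) (brk n m b a) \<in> B (m+n-1)"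
    and jacobi: "\<And>m n p a b c. \<lbrakk>m > 0; n > 0; p > 0; a \<in> Z m; b \<in> Z n; c \<in> Z p\<rbrakk> \<Longrightarrow>
      brk m (n+p-1) a (brk n p b c) - (brk (m+n-1) p (brk m n a b) c
        + scale ((-1) ^ ((m - 1) * (n - 1))) (brk n (m+p-1) b (brk m p a c))) \<in> B (m+n+p-2)"
    and leibniz: "\<And>m n p a b c. \<lbrakk>m > 0; n > 0; p > 0; a \<in> Z m; b \<in> Z n; c \<in> Z p\<rbrakk> \<Longrightarrow>
      brk m (n+p) a (mul n p b c) - (mul (m+n-1) p (brk m n a b) c
        + scale ((-1) ^ ((m - 1) * n)) (mul n (m+p-1) b (brk m p a c))) \<in> B (m+n+p-1)"
  shows "gerstenhaber_algebra H B (\<lambda>n. induced2 (B n) (+)) (\<lambda>n a. induced1 (B n) (scale a))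
    (\<lambda>m n. induced2 (B (m+n)) (mul m n)) (\<lambda>m n. induced2 (B (m+n-1)) (brk m n))"
proof -
  have mul_cls: "induced2 (B q) (mul m n) (cls m x) (cls n y) = cls q (mul m n x y)"
    if "m > 0" "n > 0" "x \<in> Z m" "y \<in> Z n" "q = m + n" for m n q x y
    using that mul by (simp add: induced2_cls)
  have brk_cls: "induced2 (B q) (brk m n) (cls m x) (cls n y) = cls q (brk m n x y)"
    if "m > 0" "n > 0" "x \<in> Z m" "y \<in> Z n" "q = m + n - 1" for m n q x y
    using that brk[of m n] by (simp add: induced2_cls)
  have mul_Z: "mul m n x y \<in> Z q"
    if "m > 0" "n > 0" "x \<in> Z m" "y \<in> Z n" "q = m + n" for m n q x y
    using that mul[of m n] by (simp add: descends_def)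
  have brk_Z: "brk m n x y \<in> Z q"
    if "m > 0" "n > 0" "x \<in> Z m" "y \<in> Z n" "q = m + n - 1" for m n q x y
    using that brk[of m n] by (simp add: descends_def)
  note cls_simps = mul_cls brk_cls mul_Z brk_Z induced2_add induced1_scale
  show ?thesis
  proof (rule gerstenhaber_algebra.intro, goal_cases)
    case (1 n)
    then show ?case by (intro vector_space_H) simp
  next
    case (2 m n)
    then show ?case using bilinear_H[OF mul] by simp
  next
    case (3 m n)
    then show ?case using bilinear_H[OF brk] by simp
  next
    case (4 m n p x y z)
    then obtain a b c where "a \<in> Z m" "b \<in> Z n" "c \<in> Z p" "x = cls m a" "y = cls n b" "z = cls p c"
      by blast
    with 4 assoc[of m n p a b c] show ?case by (simp add: cls_simps add.assoc cls_eqI)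
  next
    case (5 m n x y)
    then obtain a b where "a \<in> Z m" "b \<in> Z n" "x = cls m a" "y = cls n b" by blast
    with 5 commute[of m n a b] show ?case by (simp add: cls_simps cls_eqI add.commute[of n m])
  next
    case (6 m n x y)
    then obtain a b where "a \<in> Z m" "b \<in> Z n" "x = cls m a" "y = cls n b" by blast
    with 6 antisym[of m n a b] show ?case by (simp add: cls_simps cls_eqI add.commute[of n m])
  next
    case (7 m n p x y z)
    then obtain a b c where "a \<in> Z m" "b \<in> Z n" "c \<in> Z p" "x = cls m a" "y = cls n b" "z = cls p c"
      by blast
    moreover have "m + (n + p - 1) - 1 = m + n + p - 2" "m + n - 1 + p - 1 = m + n + p - 2"
      "n + (m + p - 1) - 1 = m + n + p - 2"
      using 7 by linarith+
    ultimately show ?case using 7 jacobi[of m n p a b c] by (simp add: cls_simps cls_eqI)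
  next
    case (8 m n p x y z)
    then obtain a b c where "a \<in> Z m" "b \<in> Z n" "c \<in> Z p" "x = cls m a" "y = cls n b" "z = cls p c"
      by blast
    moreover have "m + (n + p) - 1 = m + n + p - 1" "m + n - 1 + p = m + n + p - 1"
      "n + (m + p - 1) = m + n + p - 1"
      using 8 by linarith+
    ultimately show ?case using 8 leibniz[of m n p a b c] by (simp add: cls_simps cls_eqI)
  qed
qed

end

section \<open>Cohomology of an operad with multiplication\<close>

context graded_operad begin

lemma circ_zero: "f \<in> V a \<Longrightarrow> circ a b f 0 = 0" "g \<in> V b \<Longrightarrow> circ a b 0 g = 0"
  by (simp_all add: circ_def cmp_zero_left cmp_zero_right)

lemma brace_zero:
  "g \<in> V b \<Longrightarrow> h \<in> V c \<Longrightarrow> brace a b c 0 g h = 0"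
  "f \<in> V a \<Longrightarrow> h \<in> V c \<Longrightarrow> brace a b c f 0 h = 0"
  "f \<in> V a \<Longrightarrow> g \<in> V b \<Longrightarrow> brace a b c f g 0 = 0"
  by (simp_all add: brace_def cmp_zero_left cmp_zero_right)

lemma sg_simps: "sg n 0 = 0" "sg n (sg n x) = x" "sg n x = 0 \<longleftrightarrow> x = 0"
  by (simp_all add: sg_def)

lemma brk_zero: "f \<in> V a \<Longrightarrow> brk a b f 0 = 0" "g \<in> V b \<Longrightarrow> brk a b 0 g = 0"
  by (simp_all add: brk_def circ_zero sg_simps)

lemma brk_add:
  "f \<in> V a \<Longrightarrow> f' \<in> V a \<Longrightarrow> g \<in> V b \<Longrightarrow> brk a b (f + f') g = brk a b f g + brk a b f' g"
  "f \<in> V a \<Longrightarrow> g \<in> V b \<Longrightarrow> g' \<in> V b \<Longrightarrow> brk a b f (g + g') = brk a b f g + brk a b f g'"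
  by (simp_all add: brk_def circ_add_left circ_add_right sg_def)

lemma brk_scale:
  "f \<in> V a \<Longrightarrow> g \<in> V b \<Longrightarrow> brk a b (scale s f) g = scale s (brk a b f g)"
  "f \<in> V a \<Longrightarrow> g \<in> V b \<Longrightarrow> brk a b f (scale s g) = scale s (brk a b f g)"
  by (simp_all add: brk_def circ_scale_left circ_scale_right sg_def scale_right_diff_distrib)

end

context multiplicative_operad begin

lemma d_zero: "d a 0 = 0"
  by (simp add: d_brk brk_zero)

lemma d_add: "f \<in> V a \<Longrightarrow> g \<in> V a \<Longrightarrow> d a (f + g) = d a f + d a g"
  by (simp add: d_brk brk_add)

lemma d_scale: "f \<in> V a \<Longrightarrow> d a (scale s f) = scale s (d a f)"
  by (simp add: d_brk brk_scale)

lemma cup_zero: "f \<in> V a \<Longrightarrow> cup a b f 0 = 0" "g \<in> V b \<Longrightarrow> cup a b 0 g = 0"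
  by (simp_all add: cup_def brace_zero sg_simps)

lemma cup_add:
  "f \<in> V a \<Longrightarrow> f' \<in> V a \<Longrightarrow> g \<in> V b \<Longrightarrow> cup a b (f + f') g = cup a b f g + cup a b f' g"
  "f \<in> V a \<Longrightarrow> g \<in> V b \<Longrightarrow> g' \<in> V b \<Longrightarrow> cup a b f (g + g') = cup a b f g + cup a b f g'"
  by (simp_all add: cup_def brace_add_2 brace_add_3 sg_def)

lemma cup_scale:
  "f \<in> V a \<Longrightarrow> g \<in> V b \<Longrightarrow> cup a b (scale s f) g = scale s (cup a b f g)"
  "f \<in> V a \<Longrightarrow> g \<in> V b \<Longrightarrow> cup a b f (scale s g) = scale s (cup a b f g)"
  by (simp_all add: cup_def brace_scale_2 brace_scale_3 sg_def)

text \<open>Of the two halves of the bracket, \<open>- \<circ> f\<close> satisfies the Leibniz rule strictly, so only the half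
  \<open>f \<circ> -\<close> contributes to the defect.\<close>

lemma leibniz_defect:
  assumes [simp]: "f \<in> V a" "g \<in> V b" "h \<in> V c"
  shows "brk a (Suc (b+c)) f (cup b c g h)
      - (cup (a+b) c (brk a b f g) h + sg (a * Suc b) (cup b (a+c) g (brk a c f h)))
    = circ a (Suc (b+c)) f (cup b c g h) - cup (a+b) c (circ a b f g) h
      - sg (a * Suc b) (cup b (a+c) g (circ a c f h))"
  using cup_circ[of g b h c f a]
  by (cases "even a"; cases "even b"; cases "even c")
     (simp_all add: brk_def cup_def sg_def linear_simps algebra_simps)

text \<open>The families \<open>Z\<close> and \<open>B\<close> and the operations \<open>mul\<close>, \<open>bra\<close> are indexed by arity, which exceeds
  the degree by one.\<close>

theorem gerstenhaber_cohomology: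
  assumes Z: "\<And>a. Z (Suc a) = {f \<in> V a. d a f = 0}"
    and B0: "B (Suc 0) = {0}" and BS: "\<And>a. B (Suc (Suc a)) = d a ` V a"
    and mul: "\<And>a b f g. \<lbrakk>f \<in> V a; g \<in> V b\<rbrakk> \<Longrightarrow> mul (Suc a) (Suc b) f g = cup a b f g"
    and bra: "\<And>a b f g. \<lbrakk>f \<in> V a; g \<in> V b\<rbrakk> \<Longrightarrow> bra (Suc a) (Suc b) f g = brk a b f g"
  shows "gerstenhaber_algebra (\<lambda>n. coset_of (B n) ` Z n) B
    (\<lambda>n. induced2 (B n) (+)) (\<lambda>n s. induced1 (B n) (scale s))
    (\<lambda>m n. induced2 (B (m+n)) (mul m n)) (\<lambda>m n. induced2 (B (m+n-1)) (bra m n))"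
proof -
  have subspace_Z: "subspace (Z (Suc a))" for a
    unfolding Z subspace_def by (auto simp: d_add d_scale d_zero)
  have subspace_dV: "subspace (d a ` V a)" for a
  proof (rule subspaceI)
    show "0 \<in> d a ` V a" by (rule image_eqI[of _ _ 0]) (simp_all add: d_zero)
    show "x + y \<in> d a ` V a" if xy: "x \<in> d a ` V a" "y \<in> d a ` V a" for x y
    proof -
      obtain u v where "x = d a u" "y = d a v" "u \<in> V a" "v \<in> V a" using xy by blast
      then show ?thesis by (intro image_eqI[of _ _ "u + v"]) (simp_all add: d_add)
    qed
    show "scale s x \<in> d a ` V a" if x: "x \<in> d a ` V a" for s x
    proof -
      obtain u where "x = d a u" "u \<in> V a" using x by blast
      then show ?thesis by (intro image_eqI[of _ _ "scale s u"]) (simp_all add: d_scale)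
    qed
  qed
  have subspace_B: "subspace (B (Suc a))" for a
    by (cases a) (simp_all add: B0 BS subspace_dV)
  have B_sub: "B (Suc a) \<subseteq> Z (Suc a)" for a
    by (cases a) (auto simp: B0 BS Z d_d d_zero)
  have B_zero: "0 \<in> B (Suc a)" for a
    by (rule subspace_0[OF subspace_B])
  have B_sg: "sg k x \<in> B (Suc a)" if "x \<in> B (Suc a)" for k a x
    using subspace_scale[OF subspace_B that] by (simp add: sg_scale)
  have B_cases: thesis
    if "x \<in> B (Suc a)" "x = 0 \<Longrightarrow> thesis" "\<And>a' u. a = Suc a' \<Longrightarrow> u \<in> V a' \<Longrightarrow> x = d a' u \<Longrightarrow> thesis"
    for a x thesis
    using that by (cases a) (auto simp: B0 BS)
  have B_I: "d a u \<in> B (Suc (Suc a))" if "u \<in> V a" for a u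
    using that by (simp add: BS)
  interpret graded_pair scale Z B
  proof
    fix n :: nat assume "n > 0"
    then obtain a where "n = Suc a" by (cases n) auto
    then show "subspace (Z n)" "subspace (B n)" "B n \<subseteq> Z n"
      by (simp_all add: subspace_Z subspace_B B_sub)
  qed
  show ?thesis
  proof (rule gerstenhaber_quotient)
    fix m n :: nat assume "m > 0" "n > 0"
    then obtain a b where mn: "m = Suc a" "n = Suc b" by (metis gr0_implies_Suc)
    have cup_B_left: "cup a b f g \<in> B (Suc (Suc (a + b)))" if "f \<in> B (Suc a)" "g \<in> Z (Suc b)" for f g
      using that(1)
    proof (rule B_cases)
      fix a' u assume u: "a = Suc a'" "u \<in> V a'" "f = d a' u"
      then have "cup a b f g = d (a + b) (cup a' b u g)"
        using that(2) d_cup[of u a' g b] by (simp add: Z cup_zero sg_simps)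
      then show ?thesis using u that(2) by (simp add: B_I Z)
    qed (use that(2) in \<open>simp add: cup_zero Z B_zero\<close>)
    have cup_B_right: "cup a b f g \<in> B (Suc (Suc (a + b)))" if "f \<in> Z (Suc a)" "g \<in> B (Suc b)" for f g
      using that(2)
    proof (rule B_cases)
      fix b' u assume u: "b = Suc b'" "u \<in> V b'" "g = d b' u"
      then have "cup a b f g = sg (Suc a) (d (a + b) (cup a b' f u))"
        using that(1) d_cup[of f a u b'] by (simp add: Z cup_zero sg_simps)
      then show ?thesis using u that(1) by (simp add: B_I Z B_sg)
    qed (use that(1) in \<open>simp add: cup_zero Z B_zero\<close>)
    have cup_Z: "cup a b f g \<in> Z (Suc (Suc (a + b)))" if "f \<in> Z (Suc a)" "g \<in> Z (Suc b)" for f g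
      using that d_cup[of f a g b] by (simp add: Z cup_zero sg_simps)
    show "descends m n (m + n) (mul m n)"
      unfolding descends_def mn using cup_Z cup_B_left cup_B_right B_sub[of a] B_sub[of b]
      by (auto simp: mul Z cup_add cup_scale subset_iff)
    have brk_B_left: "brk a b f g \<in> B (Suc (a + b))" if "f \<in> B (Suc a)" "g \<in> Z (Suc b)" for f g
      using that(1)
    proof (rule B_cases)
      fix a' u assume u: "a = Suc a'" "u \<in> V a'" "f = d a' u"
      then have "brk a b f g = d (a' + b) (brk a' b u g)"
        using that(2) d_brk_derivation[of u a' g b] by (simp add: Z brk_zero sg_simps)
      then show ?thesis using u that(2) by (simp add: B_I Z)
    qed (use that(2) in \<open>simp add: brk_zero Z B_zero\<close>)
    have brk_B_right: "brk a b f g \<in> B (Suc (a + b))" if "f \<in> Z (Suc a)" "g \<in> B (Suc b)" for f g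
      using that(2)
    proof (rule B_cases)
      fix b' u assume u: "b = Suc b'" "u \<in> V b'" "g = d b' u"
      then have "brk a b f g = sg a (d (a + b') (brk a b' f u))"
        using that(1) d_brk_derivation[of f a u b'] by (simp add: Z brk_zero sg_simps)
      then show ?thesis using u that(1) by (simp add: B_I Z B_sg)
    qed (use that(1) in \<open>simp add: brk_zero Z B_zero\<close>)
    have brk_Z: "brk a b f g \<in> Z (Suc (a + b))" if "f \<in> Z (Suc a)" "g \<in> Z (Suc b)" for f g
      using that d_brk_derivation[of f a g b] by (simp add: Z brk_zero sg_simps)
    show "descends m n (m + n - 1) (bra m n)"
      unfolding descends_def mn using brk_Z brk_B_left brk_B_right B_sub[of a] B_sub[of b]
      by (auto simp: bra Z brk_add brk_scale subset_iff)
    fix f g assume "f \<in> Z m" "g \<in> Z n"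
    then have fg [simp]: "f \<in> V a" "g \<in> V b" "d a f = 0" "d b g = 0" by (simp_all add: mn Z)
    have "cup a b f g - sg (Suc a * Suc b) (cup b a g f) = sg a (d (a + b) (circ a b f g))"
      by (simp only: cup_commute[of f a g b] fg circ_zero sg_simps add_0_left)
    also have "\<dots> \<in> B (Suc (Suc (a + b)))"
      by (intro B_sg B_I) simp
    finally show "mul m n f g - scale ((- 1) ^ (m * n)) (mul n m g f) \<in> B (m + n)"
      by (simp add: mn mul sg_scale)
    show "bra m n f g - scale (- ((- 1) ^ ((m - 1) * (n - 1)))) (bra n m g f) \<in> B (m + n - 1)"
      using B_zero by (simp add: mn bra brk_antisym[of a b f g] sg_scale)
  next
    fix m n p :: nat and f g h
    assume "m > 0" "n > 0" "p > 0" and fgh: "f \<in> Z m" "g \<in> Z n" "h \<in> Z p"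
    then obtain a b c where mn: "m = Suc a" "n = Suc b" "p = Suc c" by (metis gr0_implies_Suc)
    from fgh have fgh [simp]: "f \<in> V a" "g \<in> V b" "h \<in> V c" "d a f = 0" "d b g = 0" "d c h = 0"
      by (simp_all add: mn Z)
    have [simp]: "mul (Suc (Suc (a + b))) (Suc c) (cup a b f g) h = cup (Suc (a + b)) c (cup a b f g) h"
      "mul (Suc a) (Suc (Suc (b + c))) f (cup b c g h) = cup a (Suc (b + c)) f (cup b c g h)"
      by (simp_all add: mul)
    show "mul (m + n) p (mul m n f g) h - mul m (n + p) f (mul n p g h) \<in> B (m + n + p)"
      using B_zero by (simp add: mn mul cup_assoc)
    show "bra m (n + p - 1) f (bra n p g h) - (bra (m + n - 1) p (bra m n f g) h
        + scale ((- 1) ^ ((m - 1) * (n - 1))) (bra n (m + p - 1) g (bra m p f h))) \<in> B (m + n + p - 2)"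
      using B_zero brk_jacobi[of f a g b h c] by (simp add: mn bra sg_scale)
    have "circ a (Suc (b+c)) f (cup b c g h) - cup (a+b) c (circ a b f g) h
        - sg (a * Suc b) (cup b (a+c) g (circ a c f h)) = sg (a + Suc b) (d (a+b+c) (brace a b c f g h))"
      by (simp only: d_brace fgh brace_zero sg_simps add_0_left)
    also have "\<dots> \<in> B (Suc (Suc (a + b + c)))"
      by (intro B_sg B_I) simp
    finally show "bra m (n + p) f (mul n p g h) - (mul (m + n - 1) p (bra m n f g) h
        + scale ((- 1) ^ ((m - 1) * n)) (mul n (m + p - 1) g (bra m p f h))) \<in> B (m + n + p - 1)"
      using leibniz_defect[of f a g b h c] by (simp add: mn bra mul sg_scale)
  qed
qed

end

section \<open>Tensor products of maps\<close>

interpretation tensor: vector_space "tscale :: 'k::field \<Rightarrow> ('k, 'v) tensor \<Rightarrow> ('k, 'v) tensor"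
  by (rule vector_space_tscale)

text \<open>Tensors are functions on forms, but only their vector space structure matters below, so sums
  of tensors must not be evaluated pointwise by the simplifier.\<close>

declare plus_fun_apply [simp del] zero_fun_apply [simp del]

lemma linear_eq_on_span:
  fixes t :: "'k::field \<Rightarrow> 'b::ab_group_add \<Rightarrow> 'b" and x :: "('k, 'v) tensor"
  assumes "Vector_Spaces.linear tscale t f" "Vector_Spaces.linear tscale t g"
    and "\<And>z. z \<in> S \<Longrightarrow> f z = g z" "x \<in> tensor.span S"
  shows "f x = g x"
proof -
  interpret t: vector_space t using assms(1) by (simp add: Vector_Spaces.linear_iff)
  interpret vector_space_pair "tscale :: 'k \<Rightarrow> ('k, 'v) tensor \<Rightarrow> _" t ..
  show ?thesis using linear_eq_on[OF assms(1,2,4)] assms(3) by blast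
qed

lemma linear_maps_span:
  fixes t :: "'k::field \<Rightarrow> 'b::ab_group_add \<Rightarrow> 'b" and x :: "('k, 'v) tensor"
  assumes f: "Vector_Spaces.linear tscale t f" and W: "module.subspace t W"
    and S: "\<And>z. z \<in> S \<Longrightarrow> f z \<in> W" and x: "x \<in> tensor.span S"
  shows "f x \<in> W"
proof -
  interpret f: Vector_Spaces.linear tscale t f by fact
  from x show ?thesis
  proof (induction rule: tensor.span_induct_alt)
    case base
    show ?case using f.vs2.subspace_0[OF W] by (simp only: f.zero)
  next
    case (step c x y)
    show ?case
      unfolding f.add f.scale
      using step S by (intro f.vs2.subspace_add[OF W] f.vs2.subspace_scale[OF W])
  qed
qed

text \<open>All tensor powers at once; the linear extensions below only have to be checked on the
  spanning elements \<open>tens s xs\<close>.\<close>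

definition tensor_algebra :: "('k::field \<Rightarrow> 'v::ab_group_add \<Rightarrow> 'v) \<Rightarrow> ('k, 'v) tensor set" where
  "tensor_algebra s = tensor.span (range (tens s))"

lemma tensor_power_span:
  fixes s :: "'k::field \<Rightarrow> 'v::ab_group_add \<Rightarrow> 'v"
  shows "tensor_power s n = tensor.span {tens s xs |xs. length xs = n}"
proof -
  have "list_all2 (\<in>) xs (replicate n UNIV) \<longleftrightarrow> length xs = n" for xs :: "'v list"
    by (auto simp: list_all2_conv_all_nth)
  then show ?thesis by (simp add: tensor_power_def tensors_def)
qed

lemma subspace_tensor_power: "tensor.subspace (tensor_power s n)"
  by (simp add: tensor_power_span)

lemma subspace_tensor_algebra: "tensor.subspace (tensor_algebra s)"
  by (simp add: tensor_algebra_def)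

lemma tens_in [simp]: "tens s xs \<in> tensor_algebra s"
  unfolding tensor_algebra_def by (rule tensor.span_base) simp

lemma tens_in_power: "length xs = n \<Longrightarrow> tens s xs \<in> tensor_power s n"
  unfolding tensor_power_span by (rule tensor.span_base) blast

lemma tensor_power_subset: "t \<in> tensor_power s n \<Longrightarrow> t \<in> tensor_algebra s"
  unfolding tensor_power_span tensor_algebra_def using tensor.span_mono[of "{tens s xs |xs. length xs = n}" "range (tens s)"] by blast

lemma tensors_subset_power: "tensors s As \<subseteq> tensor_power s (length As)"
  unfolding tensors_def tensor_power_span by (rule tensor.span_mono) (auto dest: list_all2_lengthD)

lemma tensor_algebra_closed [simp]:
  "0 \<in> tensor_algebra s"
  "t \<in> tensor_algebra s \<Longrightarrow> u \<in> tensor_algebra s \<Longrightarrow> t + u \<in> tensor_algebra s"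
  "t \<in> tensor_algebra s \<Longrightarrow> tscale a t \<in> tensor_algebra s"
  using subspace_tensor_algebra[of s]
  by (auto simp: tensor.subspace_0 tensor.subspace_add tensor.subspace_scale)

lemma tensor_power_eqI:
  assumes "z \<in> tensor_power s n" "Vector_Spaces.linear tscale t f" "Vector_Spaces.linear tscale t g"
    "\<And>xs. length xs = n \<Longrightarrow> f (tens s xs) = g (tens s xs)"
  shows "f z = g z"
  using assms(2,3) _ assms(1)[unfolded tensor_power_span] by (rule linear_eq_on_span) (use assms(4) in blast)

lemma tensor_algebra_eqI:
  assumes "z \<in> tensor_algebra s" "Vector_Spaces.linear tscale t f" "Vector_Spaces.linear tscale t g"
    "\<And>xs. f (tens s xs) = g (tens s xs)"
  shows "f z = g z"
  using assms(2,3) _ assms(1)[unfolded tensor_algebra_def] by (rule linear_eq_on_span) (use assms(4) in blast)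

lemma tensor_power_mapI:
  assumes "z \<in> tensor_power s n" "Vector_Spaces.linear tscale t f" "module.subspace t W"
    "\<And>xs. length xs = n \<Longrightarrow> f (tens s xs) \<in> W"
  shows "f z \<in> W"
  using assms(2,3) _ assms(1)[unfolded tensor_power_span] by (rule linear_maps_span) (use assms(4) in blast)

lemma tensor_algebra_mapI:
  assumes "z \<in> tensor_algebra s" "Vector_Spaces.linear tscale t f" "module.subspace t W"
    "\<And>xs. f (tens s xs) \<in> W"
  shows "f z \<in> W"
  using assms(2,3) _ assms(1)[unfolded tensor_algebra_def] by (rule linear_maps_span) (use assms(4) in blast)

lemma linear_comp: "Vector_Spaces.linear s t f \<Longrightarrow> Vector_Spaces.linear t u g \<Longrightarrow>
    Vector_Spaces.linear s u (\<lambda>x. g (f x))"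
  by (simp add: Vector_Spaces.linear_iff)

lemma linear_plus: "Vector_Spaces.linear s t f \<Longrightarrow> Vector_Spaces.linear s t g \<Longrightarrow>
    Vector_Spaces.linear s t (\<lambda>x. f x + g x)"
  by (simp add: Vector_Spaces.linear_iff algebra_simps vector_space.vector_space_assms(1))

lemma linear_tscale: "Vector_Spaces.linear s tscale f \<Longrightarrow> Vector_Spaces.linear s tscale (\<lambda>x. tscale a (f x))"
  by (simp add: Vector_Spaces.linear_iff tensor.scale_right_distrib mult.commute)

lemma linear_zero: "vector_space s \<Longrightarrow> vector_space t \<Longrightarrow> Vector_Spaces.linear s t (\<lambda>x. 0)"
  using vector_space.vector_space_assms(1)[of t _ 0 0] by (simp add: Vector_Spaces.linear_iff)

lemma linear_D:
  assumes "Vector_Spaces.linear s t f"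
  shows "f (x + y) = f x + f y" "f (s a x) = t a (f x)" "f 0 = 0"
proof -
  interpret Vector_Spaces.linear s t f by fact
  show "f (x + y) = f x + f y" "f (s a x) = t a (f x)" "f 0 = 0"
    by (simp_all add: add scale)
qed

lemmas linear_tlift_D = linear_D[OF linear_tlift]

lemma slotwise_linear_append:
  assumes "slotwise_linear s t F"
  shows "slotwise_linear s t (\<lambda>ys. F (xs @ ys))" "slotwise_linear s t (\<lambda>ys. F (ys @ xs))"
proof -
  have lin: "Vector_Spaces.linear s t (\<lambda>x. F (us @ x # vs))" for us vs
    using assms unfolding slotwise_linear_def by blast
  show "slotwise_linear s t (\<lambda>ys. F (xs @ ys))"
    unfolding slotwise_linear_def using lin[of "xs @ _"] by (simp only: append_assoc) blast
  show "slotwise_linear s t (\<lambda>ys. F (ys @ xs))"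
    unfolding slotwise_linear_def using lin[of _ "_ @ xs"] by (simp only: append_assoc append_Cons) blast
qed

lemma tlift_append_tens:
  assumes "vector_space s"
  shows "tlift s (\<lambda>ys. tens s (xs @ ys)) (tens s ys) = tens s (xs @ ys)"
  using slotwise_linear_append(1)[OF slotwise_linear_tens[OF assms]]
  by (rule tlift_tens) (simp flip: tensor_algebra_def)

text \<open>On an arbitrary functional \<open>u\<close> the inner map need not depend linearly on the entries of
  \<open>xs\<close>; on the span of the \<open>tens s ys\<close> it does.\<close>

lemma tprod_tens_left:
  fixes s :: "'k::field \<Rightarrow> 'v::ab_group_add \<Rightarrow> 'v"
  assumes s: "vector_space s" and u: "u \<in> tensor_algebra s"
  shows "tprod s (tens s xs) u = tlift s (\<lambda>ys. tens s (xs @ ys)) u"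
  unfolding tprod_def
proof (rule tlift_tens)
  show "slotwise_linear s tscale (\<lambda>xs. tlift s (\<lambda>ys. tens s (xs @ ys)) u)"
    using u unfolding tensor_algebra_def
  proof (induction rule: tensor.span_induct_alt)
    case base
    show ?case using s by (simp add: slotwise_linear_def linear_tlift_D linear_zero vector_space_tscale)
  next
    case (step c x y)
    then obtain ys where "x = tens s ys" by blast
    then have "slotwise_linear s tscale (\<lambda>xs. tlift s (\<lambda>ys. tens s (xs @ ys)) x)"
      using slotwise_linear_append(2)[OF slotwise_linear_tens[OF s]] by (simp add: tlift_append_tens s)
    with step(2) show ?case
      by (simp add: slotwise_linear_def linear_tlift_D linear_plus linear_tscale)
  qed
  have "tlift s (\<lambda>ys. tens s (xs @ ys)) u \<in> tensor_algebra s"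
    using u linear_tlift subspace_tensor_algebra by (rule tensor_algebra_mapI) (simp add: tlift_append_tens s)
  then show "tlift s (\<lambda>ys. tens s (xs @ ys)) u \<in> tensor.span (range (tens s))"
    by (simp add: tensor_algebra_def)
qed

lemma tprod_tens [simp]: "vector_space s \<Longrightarrow> tprod s (tens s xs) (tens s ys) = tens s (xs @ ys)"
  by (simp add: tprod_tens_left tlift_append_tens)

lemma linear_tprod_left: "Vector_Spaces.linear tscale tscale (\<lambda>t. tprod s t u)"
  unfolding tprod_def by (rule linear_tlift)

lemma tprod_right:
  assumes s: "vector_space s" and t: "t \<in> tensor_algebra s" and [simp]: "u \<in> tensor_algebra s"
  shows "u' \<in> tensor_algebra s \<Longrightarrow> tprod s t (u + u') = tprod s t u + tprod s t u'"
    and "tprod s t (tscale a u) = tscale a (tprod s t u)"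
    and "tprod s t 0 = 0"
proof -
  show "tprod s t (u + u') = tprod s t u + tprod s t u'" if [simp]: "u' \<in> tensor_algebra s"
    using t linear_tprod_left linear_plus[OF linear_tprod_left linear_tprod_left]
    by (rule tensor_algebra_eqI) (simp add: s tprod_tens_left linear_tlift_D)
  show "tprod s t (tscale a u) = tscale a (tprod s t u)"
    using t linear_tprod_left linear_tscale[OF linear_tprod_left]
    by (rule tensor_algebra_eqI) (simp add: s tprod_tens_left linear_tlift_D)
  show "tprod s t 0 = 0"
    using t linear_tprod_left linear_zero[OF vector_space_tscale vector_space_tscale]
    by (rule tensor_algebra_eqI) (simp add: s tprod_tens_left linear_tlift_D)
qed

lemma tprod_in_span:
  assumes s: "vector_space s" and t: "t \<in> tensor.span (tens s ` A)" and u: "u \<in> tensor.span (tens s ` B)"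
    and W: "tensor.subspace W" "\<And>xs ys. xs \<in> A \<Longrightarrow> ys \<in> B \<Longrightarrow> tens s (xs @ ys) \<in> W"
  shows "tprod s t u \<in> W"
  using linear_tprod_left W(1) _ t
proof (rule linear_maps_span)
  have u': "u \<in> tensor_algebra s"
    using u tensor.span_mono[of "tens s ` B" "range (tens s)"] by (auto simp: tensor_algebra_def)
  fix z assume "z \<in> tens s ` A"
  then obtain xs where "z = tens s xs" "xs \<in> A" by blast
  have "tlift s (\<lambda>ys. tens s (xs @ ys)) u \<in> W"
    using linear_tlift W(1) _ u
    by (rule linear_maps_span) (use W(2) \<open>xs \<in> A\<close> in \<open>auto simp: tlift_append_tens s\<close>)
  then show "tprod s z u \<in> W" by (simp add: \<open>z = _\<close> tprod_tens_left s u')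
qed

lemma tprod_in [simp]: "vector_space s \<Longrightarrow> t \<in> tensor_algebra s \<Longrightarrow> u \<in> tensor_algebra s \<Longrightarrow>
    tprod s t u \<in> tensor_algebra s"
  unfolding tensor_algebra_def 
  by (rule tprod_in_span[where A = UNIV and B = UNIV]) (auto intro: tensor.span_base)

lemma tprod_in_power:
  assumes "vector_space s" "t \<in> tensor_power s m" "u \<in> tensor_power s n" "p = m + n"
  shows "tprod s t u \<in> tensor_power s p"
proof -
  have "{tens s xs |xs. length xs = k} = tens s ` {xs. length xs = k}" for k by blast
  then show ?thesis
    using assms unfolding tensor_power_span
    by (intro tprod_in_span[where A = "{xs. length xs = m}" and B = "{xs. length xs = n}"])
       (auto intro!: tensor.span_base)
qed

lemma linear_tprod_right:
  assumes "vector_space s" "t \<in> tensor_algebra s" "Vector_Spaces.linear sV tscale f" "\<And>x. f x \<in> tensor_algebra s"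
  shows "Vector_Spaces.linear sV tscale (\<lambda>x. tprod s t (f x))"
  using assms by (simp add: Vector_Spaces.linear_iff tprod_right)

lemma tprod_assoc:
  assumes s: "vector_space s" and t: "t \<in> tensor_algebra s" "u \<in> tensor_algebra s" "v \<in> tensor_algebra s"
  shows "tprod s (tprod s t u) v = tprod s t (tprod s u v)"
proof -
  have 1: "tprod s (tens s (xs @ ys)) v = tprod s (tens s xs) (tprod s (tens s ys) v)" for xs ys
  proof -
    have eq: "tprod s (tens s xs) z = tlift s (\<lambda>ys. tens s (xs @ ys)) z" if "z \<in> tensor_algebra s" for xs z
      by (simp add: tprod_tens_left s that)
    have "tlift s (\<lambda>zs. tens s ((xs @ ys) @ zs)) v
      = tlift s (\<lambda>ys. tens s (xs @ ys)) (tlift s (\<lambda>zs. tens s (ys @ zs)) v)"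
      using t(3) linear_tlift linear_comp[OF linear_tlift linear_tlift]
      by (rule tensor_algebra_eqI)
         (use tlift_append_tens[OF s, of "xs @ ys"] in \<open>simp add: tlift_append_tens s\<close>)
    then show ?thesis using t s by (simp only: eq[symmetric] tprod_in tens_in)
  qed
  have 2: "tprod s (tprod s (tens s xs) u) v = tprod s (tens s xs) (tprod s u v)" for xs
  proof -
    have eq: "tprod s (tens s xs) z = tlift s (\<lambda>ys. tens s (xs @ ys)) z" if "z \<in> tensor_algebra s" for z
      by (simp add: tprod_tens_left s that)
    have "tprod s (tlift s (\<lambda>ys. tens s (xs @ ys)) u) v = tlift s (\<lambda>ys. tens s (xs @ ys)) (tprod s u v)"
      using t(2) linear_comp[OF linear_tlift linear_tprod_left] linear_comp[OF linear_tprod_left linear_tlift]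
      by (rule tensor_algebra_eqI) (use t s 1 in \<open>simp add: eq[symmetric]\<close>)
    then show ?thesis using t s by (simp only: eq tprod_in)
  qed
  show ?thesis
    using t(1) linear_comp[OF linear_tprod_left linear_tprod_left] linear_tprod_left
    by (rule tensor_algebra_eqI) (rule 2)
qed

lemma tprod_unit_left: "vector_space s \<Longrightarrow> t \<in> tensor_algebra s \<Longrightarrow> tprod s (tens s []) t = t"
  by (subst tprod_tens_left, simp_all, rule tensor_algebra_eqI[OF _ linear_tlift tensor.linear_ident])
     (auto simp: tlift_append_tens[of s "[]", simplified])

lemma tprod_unit_right: "vector_space s \<Longrightarrow> t \<in> tensor_algebra s \<Longrightarrow> tprod s t (tens s []) = t"
  by (rule tensor_algebra_eqI[OF _ linear_tprod_left tensor.linear_ident]) auto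

lemma tensor_power_induct [consumes 1, case_names zero step]:
  assumes z: "z \<in> tensor_power s n" and "P 0"
    and "\<And>a xs z. length xs = n \<Longrightarrow> z \<in> tensor_power s n \<Longrightarrow> P z \<Longrightarrow> P (tscale a (tens s xs) + z)"
  shows "P z"
proof -
  let ?S = "{tens s xs |xs. length xs = n}"
  have "z \<in> tensor.span ?S \<and> P z"
    using z[unfolded tensor_power_span]
  proof (induction rule: tensor.span_induct_alt)
    case base
    show ?case using assms(2) tensor.span_zero by simp
  next
    case (step c x y)
    then obtain xs where "x = tens s xs" "length xs = n" by blast
    moreover have "tscale c x + y \<in> tensor.span ?S"
      by (intro tensor.span_add tensor.span_scale) (use step in \<open>auto intro!: tensor.span_base\<close>)
    ultimately show ?case using assms(3) step by (simp add: tensor_power_span)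
  qed
  then show ?thesis ..
qed

definition tprods :: "('k::field \<Rightarrow> 'v::ab_group_add \<Rightarrow> 'v) \<Rightarrow> ('k, 'v) tensor list \<Rightarrow> ('k, 'v) tensor" where
  "tprods s ts = foldr (tprod s) ts (tens s [])"

lemma tprods_simps [simp]: "tprods s [] = tens s []" "tprods s (t # ts) = tprod s t (tprods s ts)"
  by (simp_all add: tprods_def)

lemma tprods_in [simp]: "vector_space s \<Longrightarrow> set ts \<subseteq> tensor_algebra s \<Longrightarrow> tprods s ts \<in> tensor_algebra s"
  by (induction ts) auto

lemma tprods_append: "vector_space s \<Longrightarrow> set ts \<subseteq> tensor_algebra s \<Longrightarrow> set us \<subseteq> tensor_algebra s \<Longrightarrow>
    tprods s (ts @ us) = tprod s (tprods s ts) (tprods s us)"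
  by (induction ts) (auto simp: tprod_unit_left tprod_assoc)

text \<open>The maps that may fill a slot of \<open>tmap\<close>.  Values outside the tensor algebra would break
  bilinearity of \<open>tprod\<close>.\<close>

definition slot_map :: "('k::field \<Rightarrow> 'v::ab_group_add \<Rightarrow> 'v) \<Rightarrow> ('k \<Rightarrow> 'w::ab_group_add \<Rightarrow> 'w)
    \<Rightarrow> ('v \<Rightarrow> ('k, 'w) tensor) \<Rightarrow> bool" where
  "slot_map sV sW f \<longleftrightarrow> vector_space sW \<and> Vector_Spaces.linear sV tscale f \<and> (\<forall>x. f x \<in> tensor_algebra sW)"

lemma slot_mapD:
  assumes "slot_map sV sW f"
  shows "Vector_Spaces.linear sV tscale f" "f x \<in> tensor_algebra sW" "f 0 = 0"
    "f (x + y) = f x + f y" "f (sV a x) = tscale a (f x)" "vector_space sV" "vector_space sW"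
proof -
  from assms show lin: "Vector_Spaces.linear sV tscale f" and "vector_space sW" "f x \<in> tensor_algebra sW"
    by (simp_all add: slot_map_def)
  from lin show "vector_space sV" by (simp add: Vector_Spaces.linear_iff)
  from linear_D[OF lin] show "f 0 = 0" "f (x + y) = f x + f y" "f (sV a x) = tscale a (f x)" by simp_all
qed

lemma slotwise_linear_slots:
  fixes sV :: "'k::field \<Rightarrow> 'v::ab_group_add \<Rightarrow> 'v" and sW :: "'k \<Rightarrow> 'w::ab_group_add \<Rightarrow> 'w"
  assumes sV: "vector_space sV" and sW: "vector_space sW" and fs: "\<forall>f\<in>set fs. slot_map sV sW f"
  shows "slotwise_linear sV tscale (\<lambda>xs. if length xs = length fs
     then foldr (tprod sW) (map2 (\<lambda>f x. f x) fs xs) (tens sW []) else 0)"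
  unfolding slotwise_linear_def
proof (intro allI)
  fix xs ys :: "'v list"
  let ?F = "\<lambda>xs. if length xs = length fs
     then foldr (tprod sW) (map2 (\<lambda>f x. f x) fs xs) (tens sW []) else 0"
  show "Vector_Spaces.linear sV tscale (\<lambda>x. ?F (xs @ x # ys))"
  proof (cases "length (xs @ undefined # ys) = length fs")
    case False
    then show ?thesis using linear_zero[OF sV vector_space_tscale] by simp
  next
    case True
    then have "length xs < length fs" by simp
    then obtain gs f hs where fs_eq: "fs = gs @ f # hs" "length gs = length xs"
      using id_take_nth_drop[of "length xs" fs] by (metis length_take less_imp_le min.absorb2)
    then have "length hs = length ys" using True by simp
    note fs_eq = fs_eq this
    let ?P = "tprods sW (map2 (\<lambda>f x. f x) gs xs)" and ?Q = "tprods sW (map2 (\<lambda>f x. f x) hs ys)"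
    have in_alg: "set (map2 (\<lambda>f x. f x) gs xs) \<subseteq> tensor_algebra sW"
      "set (map2 (\<lambda>f x. f x) hs ys) \<subseteq> tensor_algebra sW"
      using fs fs_eq by (auto dest!: set_zip_leftD simp: slot_map_def)
    have f: "slot_map sV sW f" using fs fs_eq by simp
    have "?F (xs @ x # ys) = tprod sW ?P (tprod sW (f x) ?Q)" for x
    proof -
      have 1: "?F (xs @ x # ys) = tprods sW (map2 (\<lambda>f x. f x) fs (xs @ x # ys))"
        using True by (simp add: tprods_def)
      have 2: "map2 (\<lambda>f x. f x) fs (xs @ x # ys)
          = map2 (\<lambda>f x. f x) gs xs @ f x # map2 (\<lambda>f x. f x) hs ys"
        using fs_eq by simp
      have "tprods sW (map2 (\<lambda>f x. f x) gs xs @ f x # map2 (\<lambda>f x. f x) hs ys)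
          = tprod sW ?P (tprod sW (f x) ?Q)"
        using in_alg f by (simp add: tprods_append sW slot_map_def)
      with 1 2 show ?thesis by (simp only:)
    qed
    moreover have "Vector_Spaces.linear sV tscale (\<lambda>x. tprod sW ?P (tprod sW (f x) ?Q))"
      using in_alg f sW
      by (intro linear_tprod_right linear_comp[OF _ linear_tprod_left]) (auto simp: slot_map_def)
    ultimately show ?thesis by simp
  qed
qed

text \<open>A map on all functionals, \<open>tmap\<close> agrees with the tensor product of the maps \<open>fs\<close> because the product
  of the values is linear in each entry.\<close>

lemma tmap_tens:
  assumes "vector_space sV" "vector_space sW" "\<forall>f\<in>set fs. slot_map sV sW f" "length xs = length fs"
  shows "tmap sW fs (tens sV xs) = tprods sW (map2 (\<lambda>f x. f x) fs xs)"
proof -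
  have "tprods sW (map2 (\<lambda>f x. f x) fs xs) \<in> tensor_algebra sW"
    using assms by (auto intro!: tprods_in dest!: set_zip_leftD simp: slot_map_def)
  then show ?thesis
    unfolding tmap_def using assms(4)
    by (subst tlift_tens[OF slotwise_linear_slots[OF assms(1-3)]])
       (simp_all flip: tprods_def tensor_algebra_def)
qed

lemma linear_tmap: "Vector_Spaces.linear tscale tscale (tmap s fs)"
  unfolding tmap_def by (rule linear_tlift)

lemmas linear_tmap_D = linear_D[OF linear_tmap]

lemma slot_map_tid: "vector_space s \<Longrightarrow> slot_map s s (tid s)"
  using slotwise_linear_tens[of s, unfolded slotwise_linear_def, rule_format, of "[]" "[]"]
  by (simp add: slot_map_def tid_def[abs_def])

lemma tprods_tens: "vector_space s \<Longrightarrow> tprods s (map (tid s) xs) = tens s xs"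
  by (induction xs) (auto simp: tid_def)

lemma tmap_pair:
  assumes "slot_map sV sW f" "slot_map sV sW g"
  shows "tmap sW [f, g] (tens sV [x, y]) = tprod sW (f x) (g y)"
  using slot_mapD[OF assms(1)] slot_mapD[OF assms(2)] assms
  by (simp add: tmap_tens tprod_unit_right)

lemma map2_replicate: "length xs = n \<Longrightarrow> map2 (\<lambda>f x. f x) (replicate n f) xs = map f xs"
  by (induction xs arbitrary: n) auto

lemma tmap_tid:
  assumes "vector_space s" "t \<in> tensor_power s n"
  shows "tmap s (replicate n (tid s)) t = t"
  using assms(2) linear_tmap tensor.linear_ident
  by (rule tensor_power_eqI)
     (simp add: tmap_tens[OF assms(1,1)] slot_map_tid assms map2_replicate tprods_tens)

text \<open>Tensor products of maps split along concatenation of slots.  This governs all compositions of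
  maps that act in different slots.\<close>

lemma tmap_tprod:
  assumes sV: "vector_space sV" and sW: "vector_space sW"
    and fs: "\<forall>f\<in>set fs. slot_map sV sW f" and gs: "\<forall>f\<in>set gs. slot_map sV sW f"
    and t: "t \<in> tensor_power sV (length fs)" and u: "u \<in> tensor_power sV (length gs)"
  shows "tmap sW (fs @ gs) (tprod sV t u) = tprod sW (tmap sW fs t) (tmap sW gs u)"
proof -
  have in_alg: "set (map2 (\<lambda>f x. f x) hs zs) \<subseteq> tensor_algebra sW" if "\<forall>f\<in>set hs. slot_map sV sW f" for hs zs
    using that by (auto dest!: set_zip_leftD simp: slot_map_def)
  have u': "u \<in> tensor_algebra sV" using u by (rule tensor_power_subset)
  have gs_alg: "tmap sW gs z \<in> tensor_algebra sW" if "z \<in> tensor_power sV (length gs)" for z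
    using that linear_tmap subspace_tensor_algebra
    by (rule tensor_power_mapI) (simp add: tmap_tens sV sW gs tprods_in[OF sW in_alg] del: set_map)
  have 1: "tmap sW (fs @ gs) (tlift sV (\<lambda>ys. tens sV (xs @ ys)) u) = tprod sW (tmap sW fs (tens sV xs)) (tmap sW gs u)"
    if "length xs = length fs" for xs
  proof -
    have X: "tmap sW fs (tens sV xs) \<in> tensor_algebra sW"
      by (simp add: tmap_tens sV sW fs that tprods_in[OF sW in_alg] del: set_map)
    show ?thesis
      using u
    proof (induction rule: tensor_power_induct)
      case zero
      show ?case by (simp add: linear_tlift_D linear_tmap_D tprod_right(3)[OF sW X, of 0])
    next
      case (step a ys z)
      have "tmap sW (fs @ gs) (tens sV (xs @ ys)) = tprod sW (tmap sW fs (tens sV xs)) (tmap sW gs (tens sV ys))"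
        using that step by (simp add: tmap_tens sV sW fs gs ball_Un tprods_append[OF sW in_alg in_alg] del: set_map)
      then show ?case
        using step by (simp add: linear_tlift_D linear_tmap_D tlift_append_tens sV
            tprod_right sW X gs_alg tens_in_power)
    qed
  qed
  show ?thesis
    using t linear_comp[OF linear_tprod_left linear_tmap] linear_comp[OF linear_tmap linear_tprod_left]
    by (rule tensor_power_eqI) (simp add: tprod_tens_left sV u' 1)
qed

lemma tmap_in_algebra:
  assumes sV: "vector_space sV" and sW: "vector_space sW"
    and gs: "\<forall>f\<in>set gs. slot_map sV sW f" and u: "u \<in> tensor_power sV (length gs)"
  shows "tmap sW gs u \<in> tensor_algebra sW"
proof -
  have in_alg: "set (map2 (\<lambda>f x. f x) hs zs) \<subseteq> tensor_algebra sW" if "\<forall>f\<in>set hs. slot_map sV sW f" for hs zs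
    using that by (auto dest!: set_zip_leftD simp: slot_map_def)
  show ?thesis
    using u linear_tmap subspace_tensor_algebra
    by (rule tensor_power_mapI) (simp add: tmap_tens sV sW gs tprods_in[OF sW in_alg] del: set_map)
qed

lemma tmap_single: "slot_map sV sW f \<Longrightarrow> tmap sW [f] (tens sV [x]) = f x"
  by (simp add: tmap_tens slot_mapD tprod_unit_right)

section \<open>Maps acting in one tensor slot\<close>

text \<open>All slots outside the middle factor carry the identity.\<close>

lemma at_slot_tprod:
  assumes s: "vector_space s" and h: "slot_map s s h"
    and t: "t \<in> tensor_power s p" and u: "u \<in> tensor_power s n" and v: "v \<in> tensor_power s q"
    and j: "1 \<le> j" "j \<le> n" and N: "N = p + n + q" "i = p + j"
  shows "at_slot s N i h (tprod s t (tprod s u v)) = tprod s t (tprod s (at_slot s n j h u) v)"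
proof -
  let ?ids = "\<lambda>n. replicate n (tid s)"
  have slots: "?ids (i - 1) @ h # ?ids (N - i) = ?ids p @ (?ids (j - 1) @ h # ?ids (n - j)) @ ?ids q"
    using j N by (simp flip: replicate_add add: add.commute)
  have sm: "\<forall>f\<in>set (?ids m). slot_map s s f" "\<forall>f\<in>set (?ids m @ h # ?ids k). slot_map s s f" for m k
    using h slot_map_tid[OF s] by auto
  have uv: "tprod s u v \<in> tensor_power s (n + q)" using s u v by (rule tprod_in_power) simp
  let ?mid = "?ids (j - 1) @ h # ?ids (n - j)"
  have mid: "length ?mid = n" using j by simp
  have "at_slot s N i h (tprod s t (tprod s u v))
      = tprod s (tmap s (?ids p) t) (tmap s (?mid @ ?ids q) (tprod s u v))"
    unfolding at_slot_def slots using t uv sm h slot_map_tid[OF s] mid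
    by (intro tmap_tprod[OF s s]) auto
  also have "tmap s (?mid @ ?ids q) (tprod s u v) = tprod s (tmap s ?mid u) (tmap s (?ids q) v)"
    by (rule tmap_tprod[OF s s sm(2)]) (use u v sm mid in auto)
  finally show ?thesis using s t v by (simp add: tmap_tid at_slot_def)
qed

lemma at_slot_single:
  assumes s: "vector_space s" and h: "slot_map s s h"
    and "t \<in> tensor_power s (i - 1)" "v \<in> tensor_power s (n - i)" "1 \<le> i" "i \<le> n"
  shows "at_slot s n i h (tprod s t (tprod s (tens s [x]) v)) = tprod s t (tprod s (h x) v)"
proof -
  have "at_slot s 1 1 h (tens s [x]) = h x"
    unfolding at_slot_def using tmap_single[OF h] by simp
  then show ?thesis
    using at_slot_tprod[OF s h assms(3) tens_in_power[of "[x]" 1] assms(4), of 1 n i] assms by simp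
qed

lemma at_slot_tens:
  assumes s: "vector_space s" and h: "slot_map s s h" and "length xs = i - 1" "length ys = n - i" "1 \<le> i" "i \<le> n"
  shows "at_slot s n i h (tens s (xs @ x # ys)) = tprod s (tens s xs) (tprod s (h x) (tens s ys))"
proof -
  have "tens s (xs @ x # ys) = tprod s (tens s xs) (tprod s (tens s [x]) (tens s ys))"
    using s by simp
  then show ?thesis using assms by (simp only: at_slot_single tens_in_power)
qed

lemma split_list_at:
  assumes "length zs = m" "1 \<le> i" "i \<le> m"
  shows "\<exists>xs x ys. zs = xs @ x # ys \<and> length xs = i - 1 \<and> length ys = m - i"
proof (intro exI conjI)
  show "zs = take (i - 1) zs @ zs ! (i - 1) # drop i zs"
    using id_take_nth_drop[of "i - 1" zs] assms by simp
qed (use assms in auto)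

lemma linear_at_slot: "Vector_Spaces.linear tscale tscale (at_slot s n i h)"
  unfolding at_slot_def by (rule linear_tmap)

lemmas linear_at_slot_D = linear_D[OF linear_at_slot]

text \<open>Slot maps of a fixed degree: the components of a cochain of arity \<open>n\<close> have this form.\<close>

definition graded_map where
  "graded_map sV sW n f \<longleftrightarrow> vector_space sW \<and> Vector_Spaces.linear sV tscale f \<and> (\<forall>x. f x \<in> tensor_power sW n)"

lemma graded_map_slot_map: "graded_map sV sW n f \<Longrightarrow> slot_map sV sW f"
  unfolding graded_map_def slot_map_def using tensor_power_subset by blast

lemma at_slot_in_power:
  assumes s: "vector_space s" and h: "graded_map s s n h" and i: "1 \<le> i" "i \<le> m" and t: "t \<in> tensor_power s m"
    and k: "k = m + n - 1"
  shows "at_slot s m i h t \<in> tensor_power s k"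
  using t linear_at_slot subspace_tensor_power
proof (rule tensor_power_mapI)
  fix zs :: "'b list" assume zs: "length zs = m"
  then obtain xs x ys where z: "zs = xs @ x # ys" "length xs = i - 1" "length ys = m - i"
    using split_list_at i by metis
  show "at_slot s m i h (tens s zs) \<in> tensor_power s k"
    unfolding z(1) using z i zs h k
    by (subst at_slot_tens[OF s graded_map_slot_map[OF h]])
       (auto intro!: tprod_in_power[OF s tens_in_power[OF refl]] tprod_in_power[OF s _ tens_in_power[OF refl], of _ n]
         simp: graded_map_def)
qed

text \<open>The second map acts on a slot that was created by the first one.\<close>

lemma at_slot_at_slot:
  assumes s: "vector_space s" and g: "graded_map s s n g" and h: "slot_map s s h"
    and i: "1 \<le> i" "i \<le> m" and j: "1 \<le> j" "j \<le> n" and t: "t \<in> tensor_power s m"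
    and N: "N = m + n - 1" "k = i - 1 + j"
  shows "at_slot s N k h (at_slot s m i g t) = at_slot s m i (at_slot s n j h \<circ> g) t"
proof -
  have "at_slot s n j h (g x) \<in> tensor_algebra s" for x
    unfolding at_slot_def using j g h slot_map_tid[OF s]
    by (intro tmap_in_algebra[OF s s]) (auto simp: graded_map_def)
  then have hg: "slot_map s s (at_slot s n j h \<circ> g)"
    using g s by (simp add: graded_map_def slot_map_def comp_def linear_comp[OF _ linear_at_slot])
  show ?thesis
    using t linear_comp[OF linear_at_slot linear_at_slot] linear_at_slot
  proof (rule tensor_power_eqI)
    fix zs :: "'b list" assume zs: "length zs = m"
    then obtain xs x ys where z: "zs = xs @ x # ys" "length xs = i - 1" "length ys = m - i"
      using split_list_at[OF zs, of i] i by auto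
    have "at_slot s N k h (at_slot s m i g (tens s zs))
        = at_slot s N k h (tprod s (tens s xs) (tprod s (g x) (tens s ys)))"
      using z i by (simp add: at_slot_tens s graded_map_slot_map[OF g])
    also have "\<dots> = tprod s (tens s xs) (tprod s (at_slot s n j h (g x)) (tens s ys))"
      by (rule at_slot_tprod[OF s h tens_in_power[OF z(2)] _ tens_in_power[OF z(3)]])
         (use g i j N in \<open>simp_all add: graded_map_def\<close>)
    also have "\<dots> = at_slot s m i (at_slot s n j h \<circ> g) (tens s zs)"
      using z i by (simp add: at_slot_tens s hg)
    finally show "at_slot s N k h (at_slot s m i g (tens s zs))
      = at_slot s m i (at_slot s n j h \<circ> g) (tens s zs)" .
  qed
qed

text \<open>Maps acting in different slots commute; the slots to the right of the expanded one are
  renumbered.\<close>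

lemma at_slot_commute:
  assumes s: "vector_space s" and g: "graded_map s s n g" and h: "graded_map s s p h"
    and i: "1 \<le> i" "i < k" "k \<le> m" and t: "t \<in> tensor_power s m"
    and N: "N = m + n - 1" "k' = k - 1 + n" "N' = m + p - 1"
  shows "at_slot s N k' h (at_slot s m i g t) = at_slot s N' i g (at_slot s m k h t)"
  using t linear_comp[OF linear_at_slot linear_at_slot] linear_comp[OF linear_at_slot linear_at_slot]
proof (rule tensor_power_eqI)
  note g' = graded_map_slot_map[OF g] and h' = graded_map_slot_map[OF h]
  fix zs :: "'b list" assume zs: "length zs = m"
  then obtain xs x rs where z: "zs = xs @ x # rs" "length xs = i - 1" "length rs = m - i"
    using split_list_at[OF zs, of i] i by auto
  obtain ys y ws where r: "rs = ys @ y # ws" "length ys = k - i - 1" "length ws = m - i - (k - i)"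
  proof -
    have "1 \<le> k - i" "k - i \<le> m - i" using i by linarith+
    then show thesis using split_list_at[OF z(3)] that by blast
  qed
  have A: "tprod s (tens s xs) (tprod s (g x) (tens s ys)) \<in> tensor_power s (k' - 1)"
  proof (rule tprod_in_power[OF s tens_in_power[OF refl]])
    show "tprod s (g x) (tens s ys) \<in> tensor_power s (n + length ys)"
      using g by (intro tprod_in_power[OF s _ tens_in_power[OF refl] refl]) (simp add: graded_map_def)
    show "k' - 1 = length xs + (n + length ys)" using z(2) r(2) N(2) i by simp
  qed
  have W: "tprod s (tens s ys) (tprod s (h y) (tens s ws)) \<in> tensor_power s (N' - i)"
  proof (rule tprod_in_power[OF s tens_in_power[OF refl]])
    show "tprod s (h y) (tens s ws) \<in> tensor_power s (p + length ws)"
      using h by (intro tprod_in_power[OF s _ tens_in_power[OF refl] refl]) (simp add: graded_map_def)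
    show "N' - i = length ys + (p + length ws)" using r(2,3) N(3) i by simp
  qed
  have in_alg: "g x \<in> tensor_algebra s" "h y \<in> tensor_algebra s"
    using g' h' by (simp_all add: slot_mapD)
  have "at_slot s m i g (tens s zs) = tprod s (tens s xs) (tprod s (g x) (tens s (ys @ y # ws)))"
    using z r zs i g' by (simp add: at_slot_tens s)
  also have "tens s (ys @ y # ws) = tprod s (tens s ys) (tprod s (tens s [y]) (tens s ws))"
    using s by simp
  also have "tprod s (tens s xs) (tprod s (g x) \<dots>)
      = tprod s (tprod s (tens s xs) (tprod s (g x) (tens s ys))) (tprod s (tens s [y]) (tens s ws))"
    by (simp only: tprod_assoc[OF s] in_alg s tens_in tprod_in)
  finally have "at_slot s N k' h (at_slot s m i g (tens s zs))
      = tprod s (tprod s (tens s xs) (tprod s (g x) (tens s ys))) (tprod s (h y) (tens s ws))"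
  proof (simp only:, intro at_slot_single[OF s h'] A tens_in_power)
    show "length ws = N - k'" "1 \<le> k'" "k' \<le> N" using r(3) N(1,2) i by simp_all
  qed
  also have "\<dots> = tprod s (tens s xs) (tprod s (g x) (tprod s (tens s ys) (tprod s (h y) (tens s ws))))"
    by (simp only: tprod_assoc[OF s] in_alg s tens_in tprod_in)
  also have "\<dots> = at_slot s N' i g (tprod s (tens s xs)
      (tprod s (tens s [x]) (tprod s (tens s ys) (tprod s (h y) (tens s ws)))))"
  proof (rule sym, intro at_slot_single[OF s g'] W tens_in_power z(2))
    show "1 \<le> i" "i \<le> N'" using N(3) i by simp_all
  qed
  also have "\<dots> = at_slot s N' i g (tprod s (tprod s (tens s xs) (tprod s (tens s [x]) (tens s ys)))
      (tprod s (h y) (tens s ws)))"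
    by (simp only: tprod_assoc[OF s] in_alg s tens_in tprod_in)
  also have "\<dots> = at_slot s N' i g (tprod s (tens s (xs @ x # ys)) (tprod s (h y) (tens s ws)))"
    using s by simp
  also have "\<dots> = at_slot s N' i g (at_slot s m k h (tens s zs))"
    using at_slot_tens[OF s h', of "xs @ x # ys" k ws m y] z r i zs by simp
  finally show "at_slot s N k' h (at_slot s m i g (tens s zs)) = at_slot s N' i g (at_slot s m k h (tens s zs))" .
qed

section \<open>Partial compositions of cochains\<close>

lemma linear_sum:
  assumes "vector_space s" "vector_space t" "\<And>j. j \<in> J \<Longrightarrow> Vector_Spaces.linear s t (F j)"
  shows "Vector_Spaces.linear s t (\<lambda>x. \<Sum>j\<in>J. F j x)"
  using assms(3)
  by (induction J rule: infinite_finite_induct) (simp_all add: linear_zero linear_plus assms)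

lemma linear_map_sum:
  assumes "Vector_Spaces.linear s t f"
  shows "f (\<Sum>j\<in>J. F j) = (\<Sum>j\<in>J. f (F j))"
  by (induction J rule: infinite_finite_induct) (simp_all add: linear_D[OF assms])

lemma tensor_algebra_sum: "(\<And>j. j \<in> J \<Longrightarrow> F j \<in> tensor_algebra s) \<Longrightarrow> (\<Sum>j\<in>J. F j) \<in> tensor_algebra s"
  by (rule tensor.subspace_sum[OF subspace_tensor_algebra])

lemma graded_map_zero: "vector_space sV \<Longrightarrow> vector_space sW \<Longrightarrow> graded_map sV sW n 0"
  using tensor.subspace_0[OF subspace_tensor_power, of sW n] linear_zero[OF _ vector_space_tscale, of sV]
  by (simp add: graded_map_def zero_fun_apply) (subst zero_fun_def, simp)

lemma graded_map_sum:
  assumes "vector_space sV" "vector_space sW" "\<And>j. j \<in> J \<Longrightarrow> graded_map sV sW n (F j)"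
  shows "graded_map sV sW n (\<lambda>x. \<Sum>j\<in>J. F j x)"
  using assms unfolding graded_map_def
  by (auto intro!: linear_sum vector_space_tscale tensor.subspace_sum[OF subspace_tensor_power])

lemma graded_map_plus: "graded_map sV sW n f \<Longrightarrow> graded_map sV sW n g \<Longrightarrow> graded_map sV sW n (\<lambda>x. f x + g x)"
  unfolding graded_map_def using linear_plus tensor.subspace_add[OF subspace_tensor_power] by blast

lemma graded_map_scale: "graded_map sV sW n f \<Longrightarrow> graded_map sV sW n (\<lambda>x. tscale a (f x))"
  unfolding graded_map_def using tensor.subspace_scale[OF subspace_tensor_power] linear_tscale by blast

lemma graded_map_at_slot:
  assumes "graded_map sV s m f" "graded_map s s n h" "1 \<le> i" "i \<le> m" "k = m + n - 1"
  shows "graded_map sV s k (at_slot s m i h \<circ> f)"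
  using assms at_slot_in_power[OF _ assms(2-4) _ assms(5)] linear_comp[OF _ linear_at_slot, of sV f]
  unfolding graded_map_def comp_def by blast

text \<open>The component of \<open>\<sigma>\<close> at \<open>[1] + \<dots> + [Suc n]\<close>.\<close>

definition total :: "nat \<Rightarrow> ('k::field, 'm, 'c) cochain \<Rightarrow> 'm \<Rightarrow> ('k, 'c) tensor" where
  "total n \<sigma> x = (\<Sum>j\<le>n. \<sigma> (Suc j) x)"

text \<open>Arities and positions in successor form keep truncated subtraction out of the index
  computations.\<close>

lemma comp_at_R1:
  fixes \<sigma> :: "('k::field, 'm, 'c) cochain"
  shows "comp_at \<sigma> (R1 m (Suc i) (Suc n) (Suc l)) = (if i \<le> l \<and> l \<le> i + n then \<sigma> (Suc (l - i)) else total n \<sigma>)"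
proof (cases "i \<le> l \<and> l \<le> i + n")
  case True
  then show ?thesis by (simp add: R1_def comp_at_def fun_eq_iff Suc_diff_le)
next
  case False
  let ?x = "\<Sum>j=Suc 0..Suc n. Poly_Mapping.single j (1::'k)"
  have lookup: "Poly_Mapping.lookup ?x k = (if k \<in> {Suc 0..Suc n} then 1 else 0)" for k
    by (simp add: lookup_sum lookup_single when_def del: sum.cl_ivl_Suc)
  have keys: "Poly_Mapping.keys ?x = {Suc 0..Suc n}"
    by (auto simp: keys.rep_eq lookup simp del: sum.cl_ivl_Suc)
  have "comp_at \<sigma> ?x = total n \<sigma>"
  proof
    fix x
    have "comp_at \<sigma> ?x x = (\<Sum>j\<in>{Suc 0..Suc n}. \<sigma> j x)"
      unfolding comp_at_def keys by (intro sum.cong refl) (simp only: lookup if_True tensor.scale_one)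
    then show "comp_at \<sigma> ?x x = total n \<sigma> x"
      by (simp only: sum.shift_bounds_cl_Suc_ivl total_def atMost_atLeast0)
  qed
  moreover have "R1 m (Suc i) (Suc n) (Suc l) = ?x"
    using False by (auto simp: R1_def simp del: sum.cl_ivl_Suc)
  ultimately show ?thesis by (simp only: if_not_P[OF False])
qed

lemma R0_Suc: "R0 m (Suc i) (Suc n) (Suc l) = Suc (if l < i then l else if l \<le> i + n then i else l - n)"
  by (auto simp: R0_def)

lemma cochains_iff:
  assumes "vector_space sM" "vector_space sC"
  shows "\<sigma> \<in> cochains sM sC n \<longleftrightarrow> (\<forall>r. graded_map sM sC n (\<sigma> r)) \<and> (\<forall>r. r \<notin> {1..n} \<longrightarrow> \<sigma> r = 0)"
proof -
  have "\<sigma> \<in> cochains sM sC n \<longleftrightarrow> (\<forall>r\<in>{1..n}. graded_map sM sC n (\<sigma> r)) \<and> (\<forall>r. r \<notin> {1..n} \<longrightarrow> \<sigma> r = 0)"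
    using assms(2) by (simp add: cochains_def graded_map_def image_subset_iff)
  moreover have "\<sigma> r = 0 \<Longrightarrow> graded_map sM sC n (\<sigma> r)" for r
    by (simp only: graded_map_zero assms)
  ultimately show ?thesis by metis
qed

lemma cochain_eqI:
  assumes "\<And>r. r \<notin> {1..Suc n} \<Longrightarrow> \<sigma> r = \<tau> r" "\<And>l x. l \<le> n \<Longrightarrow> \<sigma> (Suc l) x = \<tau> (Suc l) x"
  shows "\<sigma> = \<tau>"
proof
  fix r
  show "\<sigma> r = \<tau> r"
    using assms by (cases r) (auto simp: fun_eq_iff Suc_le_eq less_Suc_eq_le)
qed

lemma at_slot_slot_sum:
  assumes s: "vector_space s" and h: "\<And>j. j \<in> J \<Longrightarrow> slot_map s s (h j)"
    and i: "1 \<le> i" "i \<le> n" and t: "t \<in> tensor_power s n"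
  shows "at_slot s n i (\<lambda>x. \<Sum>j\<in>J. h j x) t = (\<Sum>j\<in>J. at_slot s n i (h j) t)"
proof -
  have sum: "slot_map s s (\<lambda>x. \<Sum>j\<in>J. h j x)"
    using h s by (auto simp: slot_map_def intro!: linear_sum vector_space_tscale tensor_algebra_sum)
  have lin: "Vector_Spaces.linear tscale tscale (\<lambda>t. \<Sum>j\<in>J. at_slot s n i (h j) t)"
    by (intro linear_sum vector_space_tscale linear_at_slot)
  show ?thesis
    using t linear_at_slot lin
  proof (rule tensor_power_eqI)
    fix zs :: "'b list" assume zs: "length zs = n"
    then obtain xs x ys where z: "zs = xs @ x # ys" "length xs = i - 1" "length ys = n - i"
      using split_list_at[OF zs, of i] i by auto
    have "tprod s (\<Sum>j\<in>J. h j x) (tens s ys) = (\<Sum>j\<in>J. tprod s (h j x) (tens s ys))"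
      by (rule linear_map_sum[OF linear_tprod_left])
    moreover have "tprod s (tens s xs) (\<Sum>j\<in>J. tprod s (h j x) (tens s ys))
        = (\<Sum>j\<in>J. tprod s (tens s xs) (tprod s (h j x) (tens s ys)))"
      using s slot_mapD(2)[OF h]
      by (simp add: tprod_tens_left tensor_algebra_sum linear_map_sum[OF linear_tlift])
    ultimately show "at_slot s n i (\<lambda>x. \<Sum>j\<in>J. h j x) (tens s zs) = (\<Sum>j\<in>J. at_slot s n i (h j) (tens s zs))"
      using z i by (simp add: at_slot_tens s sum h)
  qed
qed

context
  fixes s :: "'k::field \<Rightarrow> 'c::ab_group_add \<Rightarrow> 'c"
  assumes s: "vector_space s"
begin

lemma operad_graded: "f \<in> operad s n \<Longrightarrow> graded_map s s n (f r)"
  by (simp add: operad_def cochains_iff s)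

lemma operad_total: "f \<in> operad s (Suc n) \<Longrightarrow> graded_map s s (Suc n) (total n f)"
  unfolding total_def[abs_def] using operad_graded by (intro graded_map_sum s)

lemma operad_comp_at: "g \<in> operad s (Suc n) \<Longrightarrow> graded_map s s (Suc n) (comp_at g (R1 m (Suc i) (Suc n) (Suc l)))"
  by (simp add: comp_at_R1 operad_graded operad_total)

lemma operad_value: "f \<in> operad s n \<Longrightarrow> f r x \<in> tensor_power s n"
  using operad_graded by (simp add: graded_map_def)

lemma pcomp_Suc:
  "l \<le> a + b \<Longrightarrow> pcomp s (Suc a) (Suc b) f (Suc i) g (Suc l) x
    = at_slot s (Suc a) (Suc i) (comp_at g (R1 (Suc a) (Suc i) (Suc b) (Suc l)))
        (f (R0 (Suc a) (Suc i) (Suc b) (Suc l)) x)"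
  by (simp add: pcomp_def)

lemma pcomp_outside: "r \<notin> {1..Suc (a + b)} \<Longrightarrow> pcomp s (Suc a) (Suc b) f i g r = 0"
  by (simp add: pcomp_def)

lemma pcomp_closed:
  assumes f: "f \<in> operad s (Suc a)" and g: "g \<in> operad s (Suc b)" and i: "i \<le> a"
  shows "pcomp s (Suc a) (Suc b) f (Suc i) g \<in> operad s (Suc (a + b))"
proof -
  have "graded_map s s (Suc (a + b)) (pcomp s (Suc a) (Suc b) f (Suc i) g r)" for r
  proof (cases "r \<in> {1..Suc (a + b)}")
    case True
    then obtain l where "r = Suc l" by (cases r) auto
    with True show ?thesis
      using operad_graded[OF f] operad_comp_at[OF g] i
      by (auto simp: pcomp_def intro!: graded_map_at_slot)
  qed (simp add: pcomp_outside graded_map_zero s)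
  then show ?thesis by (simp add: operad_def cochains_iff s pcomp_outside)
qed

text \<open>The reason why partial composition is associative for the values \<open>[1] + \<dots> + [n]\<close> of \<open>R\<^sub>1\<close>:
  summing \<open>R\<^sub>0[r] \<otimes> R\<^sub>1[r]\<close> over all \<open>r\<close> gives the product of the two full sums.\<close>

lemma total_pcomp:
  assumes f: "f \<in> operad s (Suc a)" and g: "g \<in> operad s (Suc b)" and i: "i \<le> a"
  shows "total (a + b) (pcomp s (Suc a) (Suc b) f (Suc i) g) = at_slot s (Suc a) (Suc i) (total b g) \<circ> total a f"
proof
  fix x
  let ?S = "at_slot s (Suc a) (Suc i)"
  have "total (a + b) (pcomp s (Suc a) (Suc b) f (Suc i) g) x
      = (\<Sum>l\<le>a+b. ?S (comp_at g (R1 (Suc a) (Suc i) (Suc b) (Suc l))) (f (R0 (Suc a) (Suc i) (Suc b) (Suc l)) x))"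
    unfolding total_def by (intro sum.cong refl) (simp add: pcomp_Suc)
  also have "\<dots> = (\<Sum>l<i. ?S (total b g) (f (Suc l) x)) + (\<Sum>t\<le>b. ?S (g (Suc t)) (f (Suc i) x))
      + (\<Sum>k\<in>{i<..a}. ?S (total b g) (f (Suc k) x))"
    unfolding sum_split_slot[OF i]
    by (intro arg_cong2[where f = "(+)"] sum.cong refl) (auto simp: comp_at_R1 R0_Suc)
  also have "(\<Sum>t\<le>b. ?S (g (Suc t)) (f (Suc i) x)) = ?S (total b g) (f (Suc i) x)"
    unfolding total_def[abs_def] using i f g
    by (subst at_slot_slot_sum[OF s]) (auto simp: graded_map_slot_map[OF operad_graded] operad_value)
  also have "(\<Sum>l<i. ?S (total b g) (f (Suc l) x)) + ?S (total b g) (f (Suc i) x)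
      + (\<Sum>k\<in>{i<..a}. ?S (total b g) (f (Suc k) x)) = (\<Sum>k\<le>a. ?S (total b g) (f (Suc k) x))"
    using sum_split_slot[OF i, of "\<lambda>k. ?S (total b g) (f (Suc k) x)" 0] by simp
  also have "\<dots> = ?S (total b g) (\<Sum>k\<le>a. f (Suc k) x)"
    by (rule linear_map_sum[OF linear_at_slot, symmetric])
  finally show "total (a + b) (pcomp s (Suc a) (Suc b) f (Suc i) g) x = (?S (total b g) \<circ> total a f) x"
    by (simp add: total_def)
qed

text \<open>Only the indices have to be compared, since \<open>at_slot_at_slot\<close> composes the maps.  For \<open>r\<close> inside the
  block of \<open>g\<close> the two sides select the same component, and outside it \<open>total_pcomp\<close> applies.\<close>

theorem pcomp_seq:
  assumes f: "f \<in> operad s (Suc a)" and g: "g \<in> operad s (Suc b)" and h: "h \<in> operad s (Suc c)"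
    and i: "i \<le> a" and j: "j \<le> b"
  shows "pcomp s (Suc (a + b)) (Suc c) (pcomp s (Suc a) (Suc b) f (Suc i) g) (Suc (i + j)) h
    = pcomp s (Suc a) (Suc (b + c)) f (Suc i) (pcomp s (Suc b) (Suc c) g (Suc j) h)"
proof (rule cochain_eqI)
  fix l x assume l: "l \<le> a + b + c"
  let ?l = "R0 (Suc (a+b)) (Suc (i+j)) (Suc c) (Suc l)"
  obtain l' where l': "?l = Suc l'" "l' \<le> a + b"
    by (rule that[OF R0_Suc]) (use l i j in auto)
  have inner: "comp_at (pcomp s (Suc b) (Suc c) g (Suc j) h) (R1 (Suc a) (Suc i) (Suc (b+c)) (Suc l))
      = at_slot s (Suc b) (Suc j) (comp_at h (R1 (Suc (a+b)) (Suc (i+j)) (Suc c) (Suc l)))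
        \<circ> comp_at g (R1 (Suc a) (Suc i) (Suc b) ?l)" (is "?L = ?R")
  proof (cases "i \<le> l \<and> l \<le> i + (b + c)")
    case True
    have "?L = at_slot s (Suc b) (Suc j) (comp_at h (R1 (Suc b) (Suc j) (Suc c) (Suc (l - i))))
        \<circ> g (R0 (Suc b) (Suc j) (Suc c) (Suc (l - i)))"
      using True by (auto simp: comp_at_R1 pcomp_Suc fun_eq_iff)
    also have "\<dots> = ?R"
      using True i j by (auto simp: comp_at_R1 R0_Suc add_ac)
    finally show ?thesis .
  next
    case False
    then have "?L = total (b + c) (pcomp s (Suc b) (Suc c) g (Suc j) h)"
      by (auto simp: comp_at_R1)
    also have "\<dots> = at_slot s (Suc b) (Suc j) (total c h) \<circ> total b g"
      using g h j by (rule total_pcomp)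
    also have "\<dots> = ?R"
      using False i j by (auto simp: comp_at_R1 R0_Suc)
    finally show ?thesis .
  qed
  have pos: "R0 (Suc a) (Suc i) (Suc b) ?l = R0 (Suc a) (Suc i) (Suc (b + c)) (Suc l)"
    using i j by (auto simp: R0_Suc)
  show "pcomp s (Suc (a + b)) (Suc c) (pcomp s (Suc a) (Suc b) f (Suc i) g) (Suc (i + j)) h (Suc l) x
    = pcomp s (Suc a) (Suc (b + c)) f (Suc i) (pcomp s (Suc b) (Suc c) g (Suc j) h) (Suc l) x"
    using l l' i j inner pos
      at_slot_at_slot[OF s, of "Suc b" "comp_at g (R1 (Suc a) (Suc i) (Suc b) ?l)"
        "comp_at h (R1 (Suc (a+b)) (Suc (i+j)) (Suc c) (Suc l))" "Suc i" "Suc a" "Suc j"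
        "f (R0 (Suc a) (Suc i) (Suc (b + c)) (Suc l)) x"]
    by (simp add: pcomp_Suc operad_comp_at g graded_map_slot_map[OF operad_comp_at[OF h]] operad_value f)
next
  fix r assume "r \<notin> {1..Suc (a + b + c)}"
  then have "r \<notin> {1..Suc (a + b + c)}" "r \<notin> {1..Suc (a + (b + c))}"
    by (simp_all add: add_ac)
  then show "pcomp s (Suc (a + b)) (Suc c) (pcomp s (Suc a) (Suc b) f (Suc i) g) (Suc (i + j)) h r
    = pcomp s (Suc a) (Suc (b + c)) f (Suc i) (pcomp s (Suc b) (Suc c) g (Suc j) h) r"
    by (rule trans[OF pcomp_outside pcomp_outside[symmetric]])
qed

text \<open>The two insertions concern different slots of \<open>f\<close>, and the maps \<open>R\<^sub>0\<close>, \<open>R\<^sub>1\<close> select the same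
  components of \<open>f\<close>, \<open>g\<close>, \<open>h\<close> in either order.\<close>

theorem pcomp_par:
  assumes f: "f \<in> operad s (Suc a)" and g: "g \<in> operad s (Suc b)" and h: "h \<in> operad s (Suc c)"
    and i: "i < k" "k \<le> a"
  shows "pcomp s (Suc (a + b)) (Suc c) (pcomp s (Suc a) (Suc b) f (Suc i) g) (Suc (k + b)) h
    = pcomp s (Suc (a + c)) (Suc b) (pcomp s (Suc a) (Suc c) f (Suc k) h) (Suc i) g"
proof (rule cochain_eqI)
  fix l x assume l: "l \<le> a + b + c"
  let ?l = "R0 (Suc (a+b)) (Suc (k+b)) (Suc c) (Suc l)" and ?l' = "R0 (Suc (a+c)) (Suc i) (Suc b) (Suc l)"
  obtain u where u: "?l = Suc u" "u \<le> a + b"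
    by (rule that[OF R0_Suc]) (use l i in auto)
  obtain u' where u': "?l' = Suc u'" "u' \<le> a + c"
    by (rule that[OF R0_Suc]) (use l i in auto)
  have pos: "R0 (Suc a) (Suc i) (Suc b) ?l = R0 (Suc a) (Suc k) (Suc c) ?l'"
    using i by (auto simp: R0_Suc)
  let ?G = "comp_at g (R1 (Suc (a+c)) (Suc i) (Suc b) (Suc l))"
    and ?H = "comp_at h (R1 (Suc a) (Suc k) (Suc c) ?l')"
    and ?z = "f (R0 (Suc a) (Suc k) (Suc c) ?l') x"
  have G: "comp_at g (R1 (Suc a) (Suc i) (Suc b) ?l) = ?G"
    using i by (auto simp: R0_Suc comp_at_R1)
  have H: "comp_at h (R1 (Suc (a+b)) (Suc (k+b)) (Suc c) (Suc l)) = ?H"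
    using i by (auto simp: R0_Suc comp_at_R1 add_ac)
  have "pcomp s (Suc a) (Suc b) f (Suc i) g ?l x = at_slot s (Suc a) (Suc i) ?G ?z"
    using pcomp_Suc[OF u(2), of f i g x] by (simp only: u(1)[symmetric] G pos)
  then have "pcomp s (Suc (a + b)) (Suc c) (pcomp s (Suc a) (Suc b) f (Suc i) g) (Suc (k + b)) h (Suc l) x
      = at_slot s (Suc (a+b)) (Suc (k+b)) ?H (at_slot s (Suc a) (Suc i) ?G ?z)"
    using pcomp_Suc[of l "a+b" c "pcomp s (Suc a) (Suc b) f (Suc i) g" "k+b" h x] l
    by (simp only: H)
  also have "\<dots> = at_slot s (Suc (a+c)) (Suc i) ?G (at_slot s (Suc a) (Suc k) ?H ?z)"
  proof (rule at_slot_commute[OF s])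
    show "graded_map s s (Suc b) ?G" by (rule operad_comp_at[OF g])
    show "graded_map s s (Suc c) ?H" unfolding u'(1) by (rule operad_comp_at[OF h])
    show "?z \<in> tensor_power s (Suc a)" by (rule operad_value[OF f])
  qed (use i in simp_all)
  also have "at_slot s (Suc a) (Suc k) ?H ?z = pcomp s (Suc a) (Suc c) f (Suc k) h ?l' x"
    using pcomp_Suc[OF u'(2), of f k h x] by (simp only: u'(1)[symmetric])
  also have "at_slot s (Suc (a+c)) (Suc i) ?G \<dots>
      = pcomp s (Suc (a + c)) (Suc b) (pcomp s (Suc a) (Suc c) f (Suc k) h) (Suc i) g (Suc l) x"
    using pcomp_Suc[of l "a+c" b "pcomp s (Suc a) (Suc c) f (Suc k) h" i g x] l
    by (simp only: add_ac)
  finally show "pcomp s (Suc (a + b)) (Suc c) (pcomp s (Suc a) (Suc b) f (Suc i) g) (Suc (k + b)) h (Suc l) x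
    = pcomp s (Suc (a + c)) (Suc b) (pcomp s (Suc a) (Suc c) f (Suc k) h) (Suc i) g (Suc l) x" .
next
  fix r assume "r \<notin> {1..Suc (a + b + c)}"
  then have "r \<notin> {1..Suc (a + b + c)}" "r \<notin> {1..Suc (a + c + b)}"
    by (simp_all add: add_ac)
  then show "pcomp s (Suc (a + b)) (Suc c) (pcomp s (Suc a) (Suc b) f (Suc i) g) (Suc (k + b)) h r
    = pcomp s (Suc (a + c)) (Suc b) (pcomp s (Suc a) (Suc c) f (Suc k) h) (Suc i) g r"
    by (rule trans[OF pcomp_outside pcomp_outside[symmetric]])
qed

end

section \<open>The graded operad of cochains\<close>

lemma comp_at_plus: "comp_at (g + g') x m = comp_at g x m + comp_at g' x m"
  by (simp add: comp_at_def plus_fun_apply[of g g'] plus_fun_apply[of "g _" "g' _"]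
      tensor.scale_right_distrib sum.distrib)

lemma comp_at_cscale: "comp_at (cscale a g) x m = tscale a (comp_at g x m)"
  by (simp add: comp_at_def cscale_def tensor.scale_sum_right mult.commute)

lemma at_slot_slot_plus:
  assumes "vector_space s" "slot_map s s h" "slot_map s s h'" "1 \<le> i" "i \<le> n" "t \<in> tensor_power s n"
  shows "at_slot s n i (\<lambda>x. h x + h' x) t = at_slot s n i h t + at_slot s n i h' t"
  using at_slot_slot_sum[of s "UNIV :: bool set" "\<lambda>b. if b then h else h'" i n t] assms
  by (simp add: UNIV_bool add.commute)

lemma at_slot_slot_scale:
  assumes s: "vector_space s" and h: "slot_map s s h" and i: "1 \<le> i" "i \<le> n" and t: "t \<in> tensor_power s n"
  shows "at_slot s n i (\<lambda>x. tscale a (h x)) t = tscale a (at_slot s n i h t)"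
  using t linear_at_slot linear_tscale[OF linear_at_slot]
proof (rule tensor_power_eqI)
  fix zs :: "'b list" assume zs: "length zs = n"
  then obtain xs x ys where z: "zs = xs @ x # ys" "length xs = i - 1" "length ys = n - i"
    using split_list_at[OF zs, of i] i by auto
  have "slot_map s s (\<lambda>x. tscale a (h x))"
    using h by (simp add: slot_map_def linear_tscale)
  then show "at_slot s n i (\<lambda>x. tscale a (h x)) (tens s zs) = tscale a (at_slot s n i h (tens s zs))"
    using z i h s
    by (simp add: at_slot_tens linear_D(2)[OF linear_tprod_left] tprod_right(2) slot_mapD(2)[OF h])
qed

lemma at_slot_tid: "vector_space s \<Longrightarrow> t \<in> tensor_power s n \<Longrightarrow> 1 \<le> i \<Longrightarrow> i \<le> n \<Longrightarrow> at_slot s n i (tid s) t = t"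
  unfolding at_slot_def by (subst replicate_Suc[symmetric], subst replicate_add[symmetric]) (simp add: tmap_tid)

interpretation cochain: vector_space "cscale :: 'k::field \<Rightarrow> ('k, 'm, 'c) cochain \<Rightarrow> ('k, 'm, 'c) cochain"
  by unfold_locales
    (simp_all add: cscale_def fun_eq_iff plus_fun_apply tscale_def algebra_simps)

lemma sg_cscale: "sg n x = cscale ((-1) ^ n) x"
  by (simp add: sg_def minus_one_power_iff)

lemma cochain_plus_apply: "(f + g) r x = f r x + g r x"
  by (simp add: plus_fun_apply)

lemma cscale_apply: "cscale a f r x = tscale a (f r x)"
  by (simp add: cscale_def)

lemma subspace_cochains:
  assumes sM: "vector_space sM" and s: "vector_space s"
  shows "cochain.subspace (cochains sM s n)"
proof (rule cochain.subspaceI)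
  note iff = cochains_iff[OF sM s]
  have plus: "(f + g) r = (\<lambda>x. f r x + g r x)" for f g :: "('a, 'b, 'c) cochain" and r
    by (rule ext) (rule cochain_plus_apply)
  have scale: "cscale a f r = (\<lambda>x. tscale a (f r x))" for f :: "('a, 'b, 'c) cochain" and a r
    by (rule ext) (rule cscale_apply)
  have zero: "(\<lambda>x. 0) = (0 :: 'b \<Rightarrow> ('a, 'c) tensor)"
    by (rule ext) (simp only: zero_fun_apply)
  show "0 \<in> cochains sM s n"
    by (simp add: iff zero_fun_apply graded_map_zero sM s)
  fix f g :: "('a, 'b, 'c) cochain"
  assume f: "f \<in> cochains sM s n"
  show "cscale a f \<in> cochains sM s n" for a
    using f unfolding iff scale by (simp add: graded_map_scale zero_fun_apply zero)
  assume g: "g \<in> cochains sM s n"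
  show "f + g \<in> cochains sM s n"
    using f g unfolding iff plus by (simp add: graded_map_plus zero_fun_apply zero)
qed

context
  fixes s :: "'k::field \<Rightarrow> 'c::ab_group_add \<Rightarrow> 'c"
  assumes s: "vector_space s"
begin

lemma pcomp_add_left: "pcomp s m n (f + f') i g = pcomp s m n f i g + pcomp s m n f' i g"
  by (intro ext) (simp add: cochain_plus_apply pcomp_def linear_at_slot_D zero_fun_apply)

lemma pcomp_scale_left: "pcomp s m n (cscale a f) i g = cscale a (pcomp s m n f i g)"
  by (intro ext) (simp add: cscale_apply pcomp_def linear_at_slot_D zero_fun_apply)

lemma pcomp_add_right:
  assumes f: "f \<in> operad s (Suc a)" and g: "g \<in> operad s (Suc b)" and g': "g' \<in> operad s (Suc b)" and i: "i \<le> a"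
  shows "pcomp s (Suc a) (Suc b) f (Suc i) (g + g') = pcomp s (Suc a) (Suc b) f (Suc i) g + pcomp s (Suc a) (Suc b) f (Suc i) g'"
proof (rule cochain_eqI)
  fix l x assume l: "l \<le> a + b"
  have "comp_at (g + g') x = (\<lambda>m. comp_at g x m + comp_at g' x m)" for x
    by (rule ext) (rule comp_at_plus)
  then show "pcomp s (Suc a) (Suc b) f (Suc i) (g + g') (Suc l) x
    = (pcomp s (Suc a) (Suc b) f (Suc i) g + pcomp s (Suc a) (Suc b) f (Suc i) g') (Suc l) x"
    using l i by (simp add: pcomp_Suc[OF s] cochain_plus_apply
        at_slot_slot_plus[OF s] graded_map_slot_map[OF operad_comp_at[OF s g]] graded_map_slot_map[OF operad_comp_at[OF s g']] operad_value[OF s f])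
next
  fix r assume "r \<notin> {1..Suc (a + b)}"
  then have out: "pcomp s (Suc a) (Suc b) f (Suc i) k r = 0" for k
    by (rule pcomp_outside[OF s])
  show "pcomp s (Suc a) (Suc b) f (Suc i) (g + g') r
    = (pcomp s (Suc a) (Suc b) f (Suc i) g + pcomp s (Suc a) (Suc b) f (Suc i) g') r"
    by (rule ext) (simp only: cochain_plus_apply out zero_fun_apply add_0_left)
qed

lemma pcomp_scale_right:
  assumes f: "f \<in> operad s (Suc a)" and g: "g \<in> operad s (Suc b)" and i: "i \<le> a"
  shows "pcomp s (Suc a) (Suc b) f (Suc i) (cscale c g) = cscale c (pcomp s (Suc a) (Suc b) f (Suc i) g)"
proof (rule cochain_eqI)
  fix l x assume l: "l \<le> a + b"
  have "comp_at (cscale c g) x = (\<lambda>m. tscale c (comp_at g x m))" for x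
    by (rule ext) (rule comp_at_cscale)
  then show "pcomp s (Suc a) (Suc b) f (Suc i) (cscale c g) (Suc l) x
    = cscale c (pcomp s (Suc a) (Suc b) f (Suc i) g) (Suc l) x"
    using l i by (simp add: pcomp_Suc[OF s] cscale_apply
        at_slot_slot_scale[OF s] graded_map_slot_map[OF operad_comp_at[OF s g]] operad_value[OF s f])
next
  fix r assume "r \<notin> {1..Suc (a + b)}"
  then have out: "pcomp s (Suc a) (Suc b) f (Suc i) k r = 0" for k
    by (rule pcomp_outside[OF s])
  show "pcomp s (Suc a) (Suc b) f (Suc i) (cscale c g) r
    = cscale c (pcomp s (Suc a) (Suc b) f (Suc i) g) r"
    by (rule ext) (simp only: cscale_apply out zero_fun_apply tensor.scale_zero_right)
qed

definition operad_unit :: "('k, 'c, 'c) cochain" where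
  "operad_unit = (\<lambda>r. if r = 1 then tid s else 0)"

lemma operad_unit_in: "operad_unit \<in> operad s (Suc 0)"
  using slot_map_tid[OF s] graded_map_zero[OF s s]
  by (auto simp: operad_def cochains_iff s operad_unit_def graded_map_def slot_map_def tid_def tens_in_power)

text \<open>The unit \<open>id\<^bsub>[1]\<^esub>\<close> of the operad can be inserted anywhere because \<open>R\<^sub>1\<close> only takes the value \<open>[1]\<close> on \<open>C\<^sub>1\<close>.\<close>

lemma pcomp_unit:
  assumes f: "f \<in> operad s (Suc a)" and i: "i \<le> a"
  shows "pcomp s (Suc a) (Suc 0) f (Suc i) operad_unit = f"
proof (rule cochain_eqI)
  fix l x assume l: "l \<le> a"
  have "comp_at operad_unit (R1 (Suc a) (Suc i) (Suc 0) (Suc l)) = tid s"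
    by (auto simp: comp_at_R1 operad_unit_def total_def)
  then show "pcomp s (Suc a) (Suc 0) f (Suc i) operad_unit (Suc l) x = f (Suc l) x"
    using l i pcomp_Suc[OF s, of l a 0 f i operad_unit x]
    by (auto simp: R0_Suc at_slot_tid[OF s operad_value[OF s f]])
next
  fix r assume "r \<notin> {1..Suc a}"
  then show "pcomp s (Suc a) (Suc 0) f (Suc i) operad_unit r = f r"
    using f pcomp_outside[OF s, where b = 0 and r = r and a = a] by (simp add: operad_def cochains_def)
qed

text \<open>Degree \<open>a\<close> means arity \<open>a + 1\<close>, and positions are counted from \<open>0\<close>.\<close>

definition signed_comp where
  "signed_comp a b f i g = cscale ((-1) ^ (i * b)) (pcomp s (Suc a) (Suc b) f (Suc i) g)"

lemma cscale_closed: "f \<in> operad s n \<Longrightarrow> cscale a f \<in> operad s n"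
  using cochain.subspace_scale[OF subspace_cochains[OF s s]] by (simp add: operad_def)

lemma graded_operad_cochains:
  "graded_operad cscale (\<lambda>a. operad s (Suc a)) signed_comp operad_unit"
proof
  fix f g h :: "('k, 'c, 'c) cochain" and a b c i j k
  assume fgh: "f \<in> operad s (Suc a)" "g \<in> operad s (Suc b)" "h \<in> operad s (Suc c)"
  note comps = pcomp_closed[OF s] cscale_closed
  show "signed_comp (a + b) c (signed_comp a b f i g) (i + j) h = signed_comp a (b + c) f i (signed_comp b c g j h)"
    if "i \<le> a" "j \<le> b"
    using that fgh
    by (simp add: signed_comp_def pcomp_scale_left pcomp_scale_right comps pcomp_seq[OF s]
        flip: power_add) (simp add: algebra_simps)
  show "signed_comp (a + b) c (signed_comp a b f i g) (k + b) h
      = sg (b * c) (signed_comp (a + c) b (signed_comp a c f k h) i g)"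
    if "i < k" "k \<le> a"
    using that fgh pcomp_par[OF s fgh that]
    by (simp add: sg_cscale signed_comp_def pcomp_scale_left comps algebra_simps flip: power_add)
qed (auto simp: signed_comp_def operad_unit_in pcomp_unit pcomp_closed[OF s] pcomp_add_left pcomp_add_right
       pcomp_scale_left pcomp_scale_right cochain.scale_right_distrib mult.commute cscale_closed
       subspace_cochains[OF s s, folded operad_def])

end

section \<open>Multiplications on the operad of cochains\<close>

lemma circ_signed_comp:
  "circ s (Suc a) (Suc b) f g = graded_operad.circ (signed_comp s) a b f g" if "vector_space s"
proof -
  interpret graded_operad cscale "\<lambda>a. operad s (Suc a)" "signed_comp s" "operad_unit s"
    by (rule graded_operad_cochains[OF that])
  show ?thesis
    unfolding Defs.circ_def circ_def One_nat_def sum.shift_bounds_cl_Suc_ivl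
    by (simp add: signed_comp_def[OF that] atMost_atLeast0 mult.commute)
qed

lemma multiplicative_operad_cochains:
  assumes s: "vector_space s" and p: "is_multiplication s p"
  shows "multiplicative_operad cscale (\<lambda>a. operad s (Suc a)) (signed_comp s) (operad_unit s) p"
proof -
  interpret graded_operad cscale "\<lambda>a. operad s (Suc a)" "signed_comp s" "operad_unit s"
    by (rule graded_operad_cochains[OF s])
  show ?thesis
    using p by unfold_locales
      (simp_all add: is_multiplication_def numeral_2_eq_2 signed_comp_def[OF s])
qed

context
  fixes s :: "'k::field \<Rightarrow> 'c::ab_group_add \<Rightarrow> 'c" and p
  assumes s: "vector_space s" and p: "is_multiplication s p"
begin

interpretation multiplicative_operad cscale "\<lambda>a. operad s (Suc a)" "signed_comp s" "operad_unit s" p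
  by (rule multiplicative_operad_cochains[OF s p])

lemma mult_diff_eq: "mult_diff s p (Suc a) f = d a f"
  using circ_signed_comp[OF s, of "Suc 0" a] circ_signed_comp[OF s, of a "Suc 0"]
  by (simp add: mult_diff_def d_def numeral_2_eq_2 sg_scale)

lemma bracket_eq: "bracket s (Suc a) (Suc b) f g = brk a b f g"
  by (simp add: bracket_def brk_def circ_signed_comp s sg_scale)

text \<open>The sign \<open>(-1)\<^bsup>mn\<^esup>\<close> collects those of the signed compositions, of the exchange of the two
  insertions and of \<open>cup\<close>.\<close>

lemma mult_prod_eq:
  assumes f: "f \<in> operad s (Suc a)" and g: "g \<in> operad s (Suc b)"
  shows "mult_prod s p (Suc a) (Suc b) f g = cup a b f g"
proof -
  have cmp_sym: "signed_comp s (Suc b) a (signed_comp s (Suc 0) b p (Suc 0) g) 0 f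
      = sg (a * b) (brace (Suc 0) a b p f g)"
    using cmp_swap[of p "Suc 0" f a g b 0 "Suc 0"] f g by (simp add: brace_binary)
  have "signed_comp s (Suc b) a (signed_comp s (Suc 0) b p (Suc 0) g) 0 f
     = cscale ((-1) ^ b) (pcomp s (Suc (Suc b)) (Suc a) (pcomp s 2 (Suc b) p 2 g) 1 f)"
    by (simp add: signed_comp_def[OF s] pcomp_scale_left[OF s] numeral_2_eq_2)
  then have "pcomp s (Suc (Suc b)) (Suc a) (pcomp s 2 (Suc b) p 2 g) 1 f
      = sg b (sg (a * b) (brace (Suc 0) a b p f g))"
    unfolding cmp_sym by (simp add: sg_scale[of b] flip: power_add)
  then show ?thesis
    by (cases "even a"; cases "even b") (simp_all add: mult_prod_def cup_def sg_def)
qed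

lemma mult_diff_closed: "f \<in> operad s (Suc a) \<Longrightarrow> mult_diff s p (Suc a) f \<in> operad s (Suc (Suc a))"
  unfolding mult_diff_eq by simp

lemma mult_diff_mult_diff: "f \<in> operad s (Suc a) \<Longrightarrow> mult_diff s p (Suc (Suc a)) (mult_diff s p (Suc a) f) = 0"
  unfolding mult_diff_eq by (rule d_d)

lemma mult_diff_scale: "f \<in> operad s (Suc a) \<Longrightarrow> mult_diff s p (Suc a) (cscale c f) = cscale c (mult_diff s p (Suc a) f)"
  unfolding mult_diff_eq by (rule d_scale)

text \<open>The differential may differ from the one of the multiplication by signs depending on the
  arity: cocycles and coboundaries are the same.\<close>

theorem gerstenhaber_operad:
  assumes X: "\<And>n. X n = operad s n"
    and \<delta>: "\<And>n f. n \<ge> 1 \<Longrightarrow> f \<in> operad s n \<Longrightarrow> \<delta> n f = cscale ((-1) ^ (n - 1)) (mult_diff s p n f)"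
    and \<delta>0: "\<delta> 0 0 = 0"
  shows "gerstenhaber_algebra (cohomology X \<delta>) (coboundaries X \<delta>)
    (\<lambda>n. induced2 (coboundaries X \<delta> n) (+)) (\<lambda>n a. induced1 (coboundaries X \<delta> n) (cscale a))
    (\<lambda>m n. induced2 (coboundaries X \<delta> (m + n)) (mult_prod s p m n))
    (\<lambda>m n. induced2 (coboundaries X \<delta> (m + n - 1)) (bracket s m n))"
proof -
  have \<delta>_Suc: "\<delta> (Suc a) f = sg a (d a f)" if "f \<in> operad s (Suc a)" for a f
    using \<delta>[of "Suc a" f] that by (simp add: mult_diff_eq sg_scale)
  have "\<delta> (Suc a) ` operad s (Suc a) = d a ` operad s (Suc a)" for a
  proof -
    have sg: "sg a f \<in> operad s (Suc a)" if "f \<in> operad s (Suc a)" for f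
      using that by simp
    have 1: "\<delta> (Suc a) f = d a (sg a f)" and 2: "d a f = \<delta> (Suc a) (sg a f)"
      if "f \<in> operad s (Suc a)" for f
      using \<delta>_Suc[OF that] \<delta>_Suc[OF sg[OF that]] that d_scale[OF that, of "(-1) ^ a"]
      by (simp_all add: sg_scale flip: power_add)
    show ?thesis
    proof (intro subset_antisym image_subsetI)
      fix f assume f: "f \<in> operad s (Suc a)"
      show "\<delta> (Suc a) f \<in> d a ` operad s (Suc a)" unfolding 1[OF f] by (rule imageI[OF sg[OF f]])
      show "d a f \<in> \<delta> (Suc a) ` operad s (Suc a)" unfolding 2[OF f] by (rule imageI[OF sg[OF f]])
    qed
  qed
  then have image: "\<delta> (Suc a) ` X (Suc a) = d a ` operad s (Suc a)" for a
    by (simp add: X)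
  have X0: "X 0 = {0}"
    by (auto simp: X operad_def cochains_def zero_fun_apply fun_eq_iff)
  have cohomology: "cohomology X \<delta> = (\<lambda>n. coset_of (coboundaries X \<delta> n) ` cocycles X \<delta> n)"
    by (rule ext) (rule cohomology_def)
  show ?thesis
    unfolding cohomology
  proof (rule gerstenhaber_cohomology)
    show "cocycles X \<delta> (Suc a) = {f \<in> operad s (Suc a). d a f = 0}" for a
      by (auto simp: cocycles_def X \<delta>_Suc sg_simps)
    show "coboundaries X \<delta> (Suc 0) = {0}"
      by (simp add: coboundaries_def X0 \<delta>0)
    show "coboundaries X \<delta> (Suc (Suc a)) = d a ` operad s (Suc a)" for a
      by (simp add: coboundaries_def image)
  qed (simp_all only: mult_prod_eq bracket_eq)
qed

end

text \<open>The coboundary in terms of partial compositions; it makes sense for any family \<open>D\<close>, and so for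
  the coalgebra on a direct sum as well.\<close>

definition operadic_coboundary where
  "operadic_coboundary s D n \<sigma> = pcomp s 2 n D 2 \<sigma>
     + (\<Sum>i=1..n. cscale ((-1) ^ i) (pcomp s n 2 \<sigma> i D)) + cscale ((-1) ^ (n+1)) (pcomp s 2 n D 1 \<sigma>)"

lemma operadic_coboundary_eq:
  assumes "n \<ge> 1"
  shows "operadic_coboundary s D n \<sigma> = cscale ((-1) ^ (n - 1)) (mult_diff s D n \<sigma>)"
proof -
  obtain a where n: "n = Suc a" using assms by (cases n) auto
  have "circ s n 2 \<sigma> D = - (\<Sum>i=1..n. cscale ((-1) ^ i) (pcomp s n 2 \<sigma> i D))"
    unfolding Defs.circ_def sum_negf[symmetric]
  proof (rule sum.cong[OF refl])
    fix i assume "i \<in> {1..n}"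
    then show "cscale ((-1) ^ ((i - 1) * (2 - 1))) (pcomp s n 2 \<sigma> i D) = - cscale ((-1) ^ i) (pcomp s n 2 \<sigma> i D)"
      by (cases i) (simp_all flip: cochain.scale_minus_left)
  qed
  moreover have "circ s 2 n D \<sigma> = pcomp s 2 n D 1 \<sigma> + cscale ((-1) ^ a) (pcomp s 2 n D 2 \<sigma>)"
    by (simp add: Defs.circ_def numeral_2_eq_2 n)
  ultimately show ?thesis
    unfolding operadic_coboundary_def mult_diff_def
    by (simp add: n cochain.scale_right_distrib cochain.scale_right_diff_distrib add_ac flip: power_add)
qed

lemma sum_cochain_apply: "(\<Sum>i\<in>I. f i) r x = (\<Sum>i\<in>I. f i r x)" for f :: "'i \<Rightarrow> ('k::field, 'm, 'c) cochain"
  by (induction I rule: infinite_finite_induct) (simp_all add: cochain_plus_apply zero_fun_apply)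

lemma operadic_coboundary_apply:
  "operadic_coboundary s D n \<sigma> r x = (if r \<notin> {1..n+1} then 0 else
     at_slot s 2 2 (comp_at \<sigma> (R1 2 2 n r)) (D (R0 2 2 n r) x)
     + (\<Sum>i=1..n. tscale ((-1) ^ i) (at_slot s n i (comp_at D (R1 n i 2 r)) (\<sigma> (R0 n i 2 r) x)))
     + tscale ((-1) ^ (n + 1)) (at_slot s 2 1 (comp_at \<sigma> (R1 2 1 n r)) (D (R0 2 1 n r) x)))"
  by (simp add: operadic_coboundary_def cochain_plus_apply cscale_apply sum_cochain_apply pcomp_def zero_fun_apply)

section \<open>Functoriality of the tensor algebra\<close>

lemma vector_space_sum_scale:
  assumes "vector_space sC" "vector_space sM"
  shows "vector_space (sum_scale sC sM)"
proof -
  interpret C: vector_space sC by fact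
  interpret M: vector_space sM by fact
  show ?thesis
    by unfold_locales (auto simp: sum_scale_def plus_prod_def C.scale_right_distrib C.scale_left_distrib
        M.scale_right_distrib M.scale_left_distrib)
qed

lemma linear_sum_maps:
  assumes "vector_space sC" "vector_space sM"
  shows "Vector_Spaces.linear (sum_scale sC sM) sC fst" "Vector_Spaces.linear (sum_scale sC sM) sM snd"
    "Vector_Spaces.linear sC (sum_scale sC sM) inC" "Vector_Spaces.linear sM (sum_scale sC sM) inM"
proof -
  interpret C: vector_space sC by fact
  interpret M: vector_space sM by fact
  show "Vector_Spaces.linear (sum_scale sC sM) sC fst" "Vector_Spaces.linear (sum_scale sC sM) sM snd"
    "Vector_Spaces.linear sC (sum_scale sC sM) inC" "Vector_Spaces.linear sM (sum_scale sC sM) inM"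
    unfolding Vector_Spaces.linear_iff
    using vector_space_sum_scale[OF assms] assms
    by (auto simp: sum_scale_def inC_def inM_def plus_prod_def)
qed

lemma slot_map_comp: "Vector_Spaces.linear sV sU h \<Longrightarrow> slot_map sU sW f \<Longrightarrow> slot_map sV sW (f \<circ> h)"
  using linear_comp[of sV sU h tscale f] by (simp add: slot_map_def comp_def)

lemma graded_map_comp: "Vector_Spaces.linear sV sU h \<Longrightarrow> graded_map sU sW n f \<Longrightarrow> graded_map sV sW n (f \<circ> h)"
  using linear_comp[of sV sU h tscale f] by (simp add: graded_map_def comp_def)

lemma slot_map_plus:
  assumes "slot_map sV sW f" "slot_map sV sW g"
  shows "slot_map sV sW (\<lambda>x. f x + g x)"
  using assms linear_plus[of sV tscale f g] by (simp add: slot_map_def)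

lemma slotwise_linear_map:
  assumes "slotwise_linear t u F" "Vector_Spaces.linear s t h"
  shows "slotwise_linear s u (\<lambda>xs. F (map h xs))"
  unfolding slotwise_linear_def
proof (intro allI)
  fix xs ys
  have "Vector_Spaces.linear t u (\<lambda>x. F (map h xs @ x # map h ys))"
    using assms(1) unfolding slotwise_linear_def by blast
  from linear_comp[OF assms(2) this] show "Vector_Spaces.linear s u (\<lambda>x. F (map h (xs @ x # ys)))"
    by simp
qed

text \<open>The action of a linear map \<open>h\<close> on the tensor algebra, a homomorphism for \<open>tprod\<close>.\<close>

definition tfun :: "('k::field \<Rightarrow> 'w::ab_group_add \<Rightarrow> 'w) \<Rightarrow> ('v \<Rightarrow> 'w) \<Rightarrow> ('k, 'v) tensor \<Rightarrow> ('k, 'w) tensor" where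
  "tfun s h = tlift s (\<lambda>xs. tens s (map h xs))"

lemma embC_tfun: "embC s = tfun s inC"
  by (simp add: embC_def tfun_def fun_eq_iff)

lemma linear_tfun: "Vector_Spaces.linear tscale tscale (tfun s h)"
  unfolding tfun_def by (rule linear_tlift)

lemmas linear_tfun_D = linear_D[OF linear_tfun]

context
  fixes sV :: "'k::field \<Rightarrow> 'v::ab_group_add \<Rightarrow> 'v" and sW :: "'k \<Rightarrow> 'w::ab_group_add \<Rightarrow> 'w" and h
  assumes h: "Vector_Spaces.linear sV sW h"
begin

lemma tfun_vector_spaces: "vector_space sV" "vector_space sW"
  using h by (simp_all add: Vector_Spaces.linear_iff)

lemma tfun_tens: "tfun sW h (tens sV xs) = tens sW (map h xs)"
  unfolding tfun_def using slotwise_linear_map[OF slotwise_linear_tens[OF tfun_vector_spaces(2)] h]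
  by (rule tlift_tens) (simp flip: tensor_algebra_def)

lemma tfun_in: "t \<in> tensor_algebra sV \<Longrightarrow> tfun sW h t \<in> tensor_algebra sW"
  by (erule tensor_algebra_mapI[OF _ linear_tfun subspace_tensor_algebra]) (simp add: tfun_tens)

lemma tfun_in_power: "t \<in> tensor_power sV n \<Longrightarrow> tfun sW h t \<in> tensor_power sW n"
  by (erule tensor_power_mapI[OF _ linear_tfun subspace_tensor_power]) (simp add: tfun_tens tens_in_power)

lemma tfun_tprod:
  assumes t: "t \<in> tensor_algebra sV" and u: "u \<in> tensor_algebra sV"
  shows "tfun sW h (tprod sV t u) = tprod sW (tfun sW h t) (tfun sW h u)"
  using t linear_comp[OF linear_tprod_left linear_tfun] linear_comp[OF linear_tfun linear_tprod_left]
proof (rule tensor_algebra_eqI)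
  fix xs
  have "tfun sW h (tlift sV (\<lambda>ys. tens sV (xs @ ys)) u) = tlift sW (\<lambda>ys. tens sW (map h xs @ ys)) (tfun sW h u)"
    using u linear_comp[OF linear_tlift linear_tfun] linear_comp[OF linear_tfun linear_tlift]
    by (rule tensor_algebra_eqI) (simp add: tfun_tens tlift_append_tens tfun_vector_spaces)
  then show "tfun sW h (tprod sV (tens sV xs) u) = tprod sW (tfun sW h (tens sV xs)) (tfun sW h u)"
    using u by (simp add: tprod_tens_left tfun_vector_spaces tfun_tens tfun_in)
qed

lemma tfun_tprods: "set ts \<subseteq> tensor_algebra sV \<Longrightarrow> tfun sW h (tprods sV ts) = tprods sW (map (tfun sW h) ts)"
  by (induction ts) (auto simp: tfun_tens tfun_tprod tfun_vector_spaces)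

lemma slot_map_tfun:
  assumes "slot_map sU sV f"
  shows "slot_map sU sW (tfun sW h \<circ> f)"
  using assms tfun_vector_spaces linear_comp[OF _ linear_tfun, of sU f] by (simp add: slot_map_def comp_def tfun_in)

lemma tfun_tmap:
  fixes sU :: "'k \<Rightarrow> 'u::ab_group_add \<Rightarrow> 'u"
  assumes fs: "\<forall>f\<in>set fs. slot_map sU sV f" and sU: "vector_space sU" and t: "t \<in> tensor_power sU (length fs)"
  shows "tfun sW h (tmap sV fs t) = tmap sW (map (\<lambda>f. tfun sW h \<circ> f) fs) t"
  using t linear_comp[OF linear_tmap linear_tfun] linear_tmap
proof (rule tensor_power_eqI)
  fix xs :: "'u list" assume xs: "length xs = length fs"
  have "set (map2 (\<lambda>f x. f x) fs xs) \<subseteq> tensor_algebra sV"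
    using fs by (auto dest!: set_zip_leftD simp: slot_map_def)
  then have "tfun sW h (tprods sV (map2 (\<lambda>f x. f x) fs xs))
      = tprods sW (map (tfun sW h) (map2 (\<lambda>f x. f x) fs xs))"
    by (rule tfun_tprods)
  moreover have "map (tfun sW h) (map2 (\<lambda>f x. f x) fs xs) = map2 (\<lambda>f x. f x) (map (\<lambda>f. tfun sW h \<circ> f) fs) xs"
    by (simp add: zip_map1 split_def)
  moreover have "\<forall>f\<in>set (map (\<lambda>f. tfun sW h \<circ> f) fs). slot_map sU sW f"
    using fs slot_map_tfun by auto
  ultimately show "tfun sW h (tmap sV fs (tens sU xs)) = tmap sW (map (\<lambda>f. tfun sW h \<circ> f) fs) (tens sU xs)"
    using fs xs by (simp add: tmap_tens[OF sU tfun_vector_spaces(1)] tmap_tens[OF sU tfun_vector_spaces(2)])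
qed

lemma tmap_tfun:
  assumes fs: "\<forall>f\<in>set fs. slot_map sW sU f" and sU: "vector_space sU" and t: "t \<in> tensor_power sV (length fs)"
  shows "tmap sU fs (tfun sW h t) = tmap sU (map (\<lambda>f. f \<circ> h) fs) t"
  using t linear_comp[OF linear_tfun linear_tmap] linear_tmap
proof (rule tensor_power_eqI)
  fix xs :: "'v list" assume xs: "length xs = length fs"
  have "map2 (\<lambda>f x. f x) fs (map h xs) = map2 (\<lambda>f x. f x) (map (\<lambda>f. f \<circ> h) fs) xs"
    by (simp add: zip_map1 zip_map2 split_def)
  moreover have "\<forall>f\<in>set (map (\<lambda>f. f \<circ> h) fs). slot_map sV sU f"
    using fs slot_map_comp[OF h] by auto
  ultimately show "tmap sU fs (tfun sW h (tens sV xs)) = tmap sU (map (\<lambda>f. f \<circ> h) fs) (tens sV xs)"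
    using fs xs by (simp add: tfun_tens tmap_tens[OF tfun_vector_spaces(2) sU] tmap_tens[OF tfun_vector_spaces(1) sU])
qed

end

lemma tfun_inverse:
  assumes h: "Vector_Spaces.linear sV sW h" and k: "Vector_Spaces.linear sW sV k"
    and kh: "\<And>x. k (h x) = x" and t: "t \<in> tensor_algebra sV"
  shows "tfun sV k (tfun sW h t) = t"
  using t linear_comp[OF linear_tfun linear_tfun] tensor.linear_ident
  by (rule tensor_algebra_eqI) (simp add: tfun_tens[OF h] tfun_tens[OF k] kh comp_def)

section \<open>Maps on products of two subspaces\<close>

lemma tensors_pair: "tensors s [A, B] = tensor.span {tens s [a, b] |a b. a \<in> A \<and> b \<in> B}"
proof -
  have "{tens s xs |xs. list_all2 (\<in>) xs [A, B]} = {tens s [a, b] |a b. a \<in> A \<and> b \<in> B}"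
    by (auto simp: list_all2_Cons2)
  then show ?thesis by (simp add: tensors_def)
qed

lemma tensors_pair_power: "t \<in> tensors s [A, B] \<Longrightarrow> t \<in> tensor_power s 2"
  using tensors_subset_power[of s "[A, B]"] by (auto simp: numeral_2_eq_2)

lemma tensors_pair_UNIV: "tensors s [UNIV, UNIV] = tensor_power s 2"
  by (simp add: tensor_power_def numeral_2_eq_2)

lemma tensors_pair_eqI:
  assumes "t \<in> tensors s [A, B]" "Vector_Spaces.linear tscale u f" "Vector_Spaces.linear tscale u g"
    "\<And>a b. a \<in> A \<Longrightarrow> b \<in> B \<Longrightarrow> f (tens s [a, b]) = g (tens s [a, b])"
  shows "f t = g t"
  using assms(2,3) _ assms(1)[unfolded tensors_pair] by (rule linear_eq_on_span) (use assms(4) in blast)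

text \<open>A map in one slot of a mixed tensor product is only seen through its values on the subspace
  sitting there.\<close>

lemma tmap_pair_cong:
  assumes "slot_map sV sW F" "slot_map sV sW G" "slot_map sV sW F'" "slot_map sV sW G'"
    and "t \<in> tensors sV [A, B]" "\<And>a. a \<in> A \<Longrightarrow> F a = F' a" "\<And>b. b \<in> B \<Longrightarrow> G b = G' b"
  shows "tmap sW [F, G] t = tmap sW [F', G'] t"
  using assms(5) linear_tmap linear_tmap
  by (rule tensors_pair_eqI) (simp add: tmap_pair assms)

lemma tmap_pair_plus:
  assumes F: "slot_map sV sW F" and F': "slot_map sV sW F'" and G: "slot_map sV sW G" and t: "t \<in> tensor_power sV 2"
  shows "tmap sW [\<lambda>x. F x + F' x, G] t = tmap sW [F, G] t + tmap sW [F', G] t"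
    and "tmap sW [G, \<lambda>x. F x + F' x] t = tmap sW [G, F] t + tmap sW [G, F'] t"
proof -
  note sm = slot_map_plus[OF F F']
  note vs = slot_mapD(7)[OF G] and alg = slot_mapD(2)[OF F] slot_mapD(2)[OF F'] slot_mapD(2)[OF G]
  show "tmap sW [\<lambda>x. F x + F' x, G] t = tmap sW [F, G] t + tmap sW [F', G] t"
    using t[folded tensors_pair_UNIV] linear_tmap linear_plus[OF linear_tmap linear_tmap]
    by (rule tensors_pair_eqI) (simp add: tmap_pair F F' G sm linear_D(1)[OF linear_tprod_left])
  show "tmap sW [G, \<lambda>x. F x + F' x] t = tmap sW [G, F] t + tmap sW [G, F'] t"
    using t[folded tensors_pair_UNIV] linear_tmap linear_plus[OF linear_tmap linear_tmap]
    by (rule tensors_pair_eqI) (simp add: tmap_pair F F' G sm tprod_right vs alg)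
qed

lemma tmap_pair_zero:
  assumes F: "slot_map sV sW F" and G: "slot_map sV sW G" and t: "t \<in> tensors sV [A, B]"
    and zero: "(\<forall>a\<in>A. F a = 0) \<or> (\<forall>b\<in>B. G b = 0)"
  shows "tmap sW [F, G] t = 0"
  using t linear_tmap linear_zero[OF vector_space_tscale vector_space_tscale]
proof (rule tensors_pair_eqI)
  fix a b assume "a \<in> A" "b \<in> B"
  then show "tmap sW [F, G] (tens sV [a, b]) = 0"
    using zero slot_mapD(2,7)[OF F]
    by (auto simp: tmap_pair F G linear_D(3)[OF linear_tprod_left] tprod_right(3)[OF _ _ tens_in])
qed

lemma tmap_in_power_pair:
  assumes F: "graded_map sV sW m F" and G: "graded_map sV sW n G" and t: "t \<in> tensor_power sV 2" and "k = m + n"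
  shows "tmap sW [F, G] t \<in> tensor_power sW k"
  using t linear_tmap subspace_tensor_power
proof (rule tensor_power_mapI)
  fix xs :: "'b list" assume "length xs = 2"
  then obtain a b where "xs = [a, b]" by (auto simp: numeral_2_eq_2 length_Suc_conv)
  then show "tmap sW [F, G] (tens sV xs) \<in> tensor_power sW k"
    using F G graded_map_slot_map[OF F] graded_map_slot_map[OF G] assms(4)
    by (auto simp: tmap_pair graded_map_def intro!: tprod_in_power)
qed

section \<open>A dendriform coalgebra as a bicomodule over itself\<close>

text \<open>The tensor product \<open>h\<^sub>1 \<otimes> \<dots> \<otimes> h\<^sub>k\<close> of linear maps.\<close>

definition tens_maps where
  "tens_maps s hs = tmap s (map (\<lambda>h. tid s \<circ> h) hs)"

lemma linear_tens_maps: "Vector_Spaces.linear tscale tscale (tens_maps s hs)"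
  unfolding tens_maps_def by (rule linear_tmap)

lemma slot_map_tid_comp: "Vector_Spaces.linear sV sW h \<Longrightarrow> slot_map sV sW (tid sW \<circ> h)"
  by (rule slot_map_comp, assumption, rule slot_map_tid) (simp add: Vector_Spaces.linear_iff)

lemma tens_maps_tens_pair:
  assumes "Vector_Spaces.linear sV sW h" "Vector_Spaces.linear sV sW k"
  shows "tens_maps sW [h, k] (tens sV [a, b]) = tens sW [h a, k b]"
  using assms slot_mapD(7)[OF slot_map_tid_comp[OF assms(1)]]
  by (simp add: tens_maps_def tmap_pair slot_map_tid_comp) (simp add: tid_def)

context
  fixes sV :: "'k::field \<Rightarrow> 'v::ab_group_add \<Rightarrow> 'v" and sW :: "'k \<Rightarrow> 'w::ab_group_add \<Rightarrow> 'w"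
    and h h' k k' :: "'v \<Rightarrow> 'w"
  assumes h: "Vector_Spaces.linear sV sW h" and h': "Vector_Spaces.linear sV sW h'"
    and k: "Vector_Spaces.linear sV sW k" and k': "Vector_Spaces.linear sV sW k'"
begin

lemma tens_maps_vector_spaces: "vector_space sV" "vector_space sW"
  using h by (simp_all add: Vector_Spaces.linear_iff)

text \<open>Each identity of a bicomodule is the image of an identity of the coalgebra under one of the
  inclusions \<open>h\<^sub>1 \<otimes> h\<^sub>2 \<otimes> h\<^sub>3\<close> of \<open>C \<otimes> C \<otimes> C\<close> into a mixed tensor product; this lemma and the next one move
  the inclusion to the outside.\<close>

lemma tmap_tens_maps_left:
  assumes F: "slot_map sW sW F" and f: "graded_map sV sV 2 f" and Ff: "\<And>x. F (h x) = tens_maps sW [k, k'] (f x)"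
    and t: "t \<in> tensor_power sV 2"
  shows "tmap sW [F, tid sW] (tens_maps sW [h, h'] t) = tens_maps sW [k, k', h'] (tmap sV [f, tid sV] t)"
  using t[folded tensors_pair_UNIV] linear_comp[OF linear_tens_maps linear_tmap] linear_comp[OF linear_tmap linear_tens_maps]
proof (rule tensors_pair_eqI)
  fix a b
  note sm = slot_map_tid[OF tens_maps_vector_spaces(1)] slot_map_tid[OF tens_maps_vector_spaces(2)] graded_map_slot_map[OF f]
  have "tens_maps sW [k, k', h'] (tprod sV (f a) (tens sV [b])) = tprod sW (tens_maps sW [k, k'] (f a)) (tens_maps sW [h'] (tens sV [b]))"
    using tmap_tprod[OF tens_maps_vector_spaces, of "[tid sW \<circ> k, tid sW \<circ> k']" "[tid sW \<circ> h']" "f a" "tens sV [b]"] f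
    by (simp add: tens_maps_def slot_map_tid_comp k k' h' tens_in_power graded_map_def numeral_2_eq_2)
  also have "tens_maps sW [h'] (tens sV [b]) = tid sW (h' b)"
    by (simp add: tens_maps_def tmap_single slot_map_tid_comp h')
  finally show "tmap sW [F, tid sW] (tens_maps sW [h, h'] (tens sV [a, b])) = tens_maps sW [k, k', h'] (tmap sV [f, tid sV] (tens sV [a, b]))"
    by (simp add: tens_maps_tens_pair h h' tmap_pair F sm Ff) (simp add: tid_def)
qed

lemma tmap_tens_maps_right:
  assumes F: "slot_map sW sW F" and f: "graded_map sV sV 2 f" and Ff: "\<And>x. F (h' x) = tens_maps sW [k, k'] (f x)"
    and t: "t \<in> tensor_power sV 2"
  shows "tmap sW [tid sW, F] (tens_maps sW [h, h'] t) = tens_maps sW [h, k, k'] (tmap sV [tid sV, f] t)"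
  using t[folded tensors_pair_UNIV] linear_comp[OF linear_tens_maps linear_tmap] linear_comp[OF linear_tmap linear_tens_maps]
proof (rule tensors_pair_eqI)
  fix a b
  note sm = slot_map_tid[OF tens_maps_vector_spaces(1)] slot_map_tid[OF tens_maps_vector_spaces(2)] graded_map_slot_map[OF f]
  have "tens_maps sW [h, k, k'] (tprod sV (tens sV [a]) (f b)) = tprod sW (tens_maps sW [h] (tens sV [a])) (tens_maps sW [k, k'] (f b))"
    using tmap_tprod[OF tens_maps_vector_spaces, of "[tid sW \<circ> h]" "[tid sW \<circ> k, tid sW \<circ> k']" "tens sV [a]" "f b"] f
    by (simp add: tens_maps_def slot_map_tid_comp k k' h tens_in_power graded_map_def numeral_2_eq_2)
  also have "tens_maps sW [h] (tens sV [a]) = tid sW (h a)"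
    by (simp add: tens_maps_def tmap_single slot_map_tid_comp h)
  finally show "tmap sW [tid sW, F] (tens_maps sW [h, h'] (tens sV [a, b])) = tens_maps sW [h, k, k'] (tmap sV [tid sV, f] (tens sV [a, b]))"
    by (simp add: tens_maps_tens_pair h h' tmap_pair F sm Ff) (simp add: tid_def)
qed

lemma tens_maps_in_tensors:
  assumes t: "t \<in> tensor_power sV 2"
  shows "tens_maps sW [h, h'] t \<in> tensors sW [range h, range h']"
  using linear_tens_maps _ _ t[folded tensors_pair_UNIV, unfolded tensors_pair]
proof (rule linear_maps_span)
  show "tensor.subspace (tensors sW [range h, range h'])" by (simp add: tensors_pair)
  fix z assume "z \<in> {tens sV [a, b] |a b. a \<in> UNIV \<and> b \<in> UNIV}"
  then obtain a b where "z = tens sV [a, b]" by blast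
  then show "tens_maps sW [h, h'] z \<in> tensors sW [range h, range h']"
    by (auto simp: tens_maps_tens_pair h h' tensors_pair intro!: tensor.span_base)
qed

end

lemma as_CM_tens_maps: "as_CM s = tens_maps (sum_scale s s) [inC, inM]" "as_MC s = tens_maps (sum_scale s s) [inM, inC]"
  by (simp_all add: as_CM_def as_MC_def tens_maps_def Let_def fun_eq_iff)

lemma embC_tens_maps:
  assumes "Vector_Spaces.linear sV s inC" "t \<in> tensor_power sV 2"
  shows "embC s t = tens_maps s [inC, inC] t"
  unfolding embC_tfun
  using assms(2)[folded tensors_pair_UNIV] linear_tfun linear_tens_maps
  by (rule tensors_pair_eqI) (simp add: tfun_tens[OF assms(1)] tens_maps_tens_pair[OF assms(1,1)])

lemma (in dendriform_coalgebra) graded_dl_dr: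
  "graded_map sC sC 2 dl" "graded_map sC sC 2 dr"
  using linear_dl linear_dr dl_in dr_in vector_space_axioms by (simp_all add: graded_map_def)

lemma fun_plus_apply: "(f + g) x = f x + g x"
  by (rule plus_fun_apply)

context dendriform_coalgebra begin

lemma graded_sum: "graded_map sC sC 2 (dl + dr)"
  using graded_map_plus[OF graded_dl_dr] by (simp add: plus_fun_def[of dl dr])

lemma dend_apply:
  "tmap sC [dl, tid sC] (dl x) = tmap sC [tid sC, dl + dr] (dl x)"
  "tmap sC [dr, tid sC] (dl x) = tmap sC [tid sC, dl] (dr x)"
  "tmap sC [dl + dr, tid sC] (dr x) = tmap sC [tid sC, dr] (dr x)"
  using dend1 dend2 dend3 by (simp_all add: fun_eq_iff[where 'b = "('a, 'b) tensor"])

text \<open>The three groups of identities come from the inclusions of \<open>C \<otimes> C \<otimes> C\<close> as \<open>C \<otimes> C \<otimes> M\<close>,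
  \<open>C \<otimes> M \<otimes> C\<close> and \<open>M \<otimes> C \<otimes> C\<close>.\<close>

lemma regular_bicomodule:
  "dendriform_bicomodule sC dl dr sC (as_CM sC \<circ> dl) (as_CM sC \<circ> dr) (as_MC sC \<circ> dl) (as_MC sC \<circ> dr)"
proof -
  let ?S = "sum_scale sC sC"
  note sC = vector_space_axioms
  note S = vector_space_sum_scale[OF sC sC]
  note maps = linear_sum_maps[OF sC sC]
  note CM = as_CM_tens_maps(1)[of sC] and MC = as_CM_tens_maps(2)[of sC]
  have tens_maps_graded: "graded_map sC ?S 2 (tens_maps ?S [h, h'] \<circ> f)"
    if "graded_map sC sC 2 f" "Vector_Spaces.linear sC ?S h" "Vector_Spaces.linear sC ?S h'" for h h' f
    using that S linear_comp[OF _ linear_tens_maps] tens_maps_in_tensors[of sC ?S h h'] tensors_pair_power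
    unfolding graded_map_def comp_def by blast
  have emb_graded: "graded_map sC ?S 2 (embC ?S \<circ> f)" if "graded_map sC sC 2 f" for f
    using that S linear_comp[OF _ linear_tfun] tfun_in_power[OF maps(3)]
    unfolding graded_map_def comp_def embC_tfun by blast
  have embC_tens_maps': "embC ?S (f x) = tens_maps ?S [inC, inC] (f x)" if "graded_map sC sC 2 f" for f x
    using that by (intro embC_tens_maps[OF maps(3)]) (simp add: graded_map_def)
  have plus: "(embC ?S \<circ> dl \<circ> fst) + (embC ?S \<circ> dr \<circ> fst) = embC ?S \<circ> (dl + dr) \<circ> fst"
    "(as_CM sC \<circ> dl \<circ> snd) + (as_CM sC \<circ> dr \<circ> snd) = as_CM sC \<circ> (dl + dr) \<circ> snd"
    "(as_MC sC \<circ> dl \<circ> snd) + (as_MC sC \<circ> dr \<circ> snd) = as_MC sC \<circ> (dl + dr) \<circ> snd"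
    by (rule ext, simp add: fun_plus_apply embC_tfun linear_tfun_D CM MC linear_D[OF linear_tens_maps])+
  have emb_left: "tmap ?S [embC ?S \<circ> f \<circ> fst, tid ?S] (as_CM sC t) = tens_maps ?S [inC, inC, inM] (tmap sC [f, tid sC] t)"
    and emb_right: "tmap ?S [tid ?S, embC ?S \<circ> f \<circ> fst] (as_MC sC t) = tens_maps ?S [inM, inC, inC] (tmap sC [tid sC, f] t)"
    and CM_left: "tmap ?S [as_CM sC \<circ> f \<circ> snd, tid ?S] (as_MC sC t) = tens_maps ?S [inC, inM, inC] (tmap sC [f, tid sC] t)"
    and CM_right: "tmap ?S [tid ?S, as_CM sC \<circ> f \<circ> snd] (as_CM sC t) = tens_maps ?S [inC, inC, inM] (tmap sC [tid sC, f] t)"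
    and MC_left: "tmap ?S [as_MC sC \<circ> f \<circ> snd, tid ?S] (as_MC sC t) = tens_maps ?S [inM, inC, inC] (tmap sC [f, tid sC] t)"
    and MC_right: "tmap ?S [tid ?S, as_MC sC \<circ> f \<circ> snd] (as_CM sC t) = tens_maps ?S [inC, inM, inC] (tmap sC [tid sC, f] t)"
    if f: "graded_map sC sC 2 f" and t: "t \<in> tensor_power sC 2" for f t
  proof -
    note sm = graded_map_slot_map[OF graded_map_comp[OF maps(1) emb_graded[OF f]]]
      graded_map_slot_map[OF graded_map_comp[OF maps(2) tens_maps_graded[OF f]]]
    show "tmap ?S [embC ?S \<circ> f \<circ> fst, tid ?S] (as_CM sC t) = tens_maps ?S [inC, inC, inM] (tmap sC [f, tid sC] t)"
      unfolding CM by (rule tmap_tens_maps_left[OF maps(3,4,3,3) _ f _ t])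
        (use maps in \<open>simp_all add: sm embC_tens_maps'[OF f] inC_def inM_def\<close>)
    show "tmap ?S [tid ?S, embC ?S \<circ> f \<circ> fst] (as_MC sC t) = tens_maps ?S [inM, inC, inC] (tmap sC [tid sC, f] t)"
      unfolding MC by (rule tmap_tens_maps_right[OF maps(4,3,3,3) _ f _ t])
        (use maps in \<open>simp_all add: sm embC_tens_maps'[OF f] inC_def inM_def\<close>)
    show "tmap ?S [as_CM sC \<circ> f \<circ> snd, tid ?S] (as_MC sC t) = tens_maps ?S [inC, inM, inC] (tmap sC [f, tid sC] t)"
      unfolding CM MC by (rule tmap_tens_maps_left[OF maps(4,3,3,4) _ f _ t])
        (use maps in \<open>simp_all add: sm inM_def\<close>)
    show "tmap ?S [tid ?S, as_CM sC \<circ> f \<circ> snd] (as_CM sC t) = tens_maps ?S [inC, inC, inM] (tmap sC [tid sC, f] t)"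
      unfolding CM by (rule tmap_tens_maps_right[OF maps(3,4,3,4) _ f _ t])
        (use maps in \<open>simp_all add: sm inM_def\<close>)
    show "tmap ?S [as_MC sC \<circ> f \<circ> snd, tid ?S] (as_MC sC t) = tens_maps ?S [inM, inC, inC] (tmap sC [f, tid sC] t)"
      unfolding MC by (rule tmap_tens_maps_left[OF maps(4,3,4,3) _ f _ t])
        (use maps in \<open>simp_all add: sm inM_def\<close>)
    show "tmap ?S [tid ?S, as_MC sC \<circ> f \<circ> snd] (as_CM sC t) = tens_maps ?S [inC, inM, inC] (tmap sC [tid sC, f] t)"
      unfolding CM MC by (rule tmap_tens_maps_right[OF maps(3,4,4,3) _ f _ t])
        (use maps in \<open>simp_all add: sm inM_def\<close>)
  qed
  note gr = graded_dl_dr graded_sum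
  note expand = emb_left emb_right CM_left CM_right MC_left MC_right
  have linear: "Vector_Spaces.linear sC tscale (as_CM sC \<circ> f)" "Vector_Spaces.linear sC tscale (as_MC sC \<circ> f)"
    and range: "(as_CM sC \<circ> f) x \<in> tensors ?S [range inC, range inM]"
      "(as_MC sC \<circ> f) x \<in> tensors ?S [range inM, range inC]"
    if "graded_map sC sC 2 f" for f x
    using tens_maps_graded[OF that maps(3,4)] tens_maps_graded[OF that maps(4,3)] that
      tens_maps_in_tensors[OF maps(3,4,3,3)] tens_maps_in_tensors[OF maps(4,3,3,3)]
    by (simp_all add: CM MC graded_map_def)
  show ?thesis
    by (intro dendriform_bicomodule.intro dendriform_bicomodule_axioms.intro;
        (rule dendriform_coalgebra_axioms sC linear[OF gr(1)] linear[OF gr(2)] range[OF gr(1)] range[OF gr(2)]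
        | (rule ext, simp only: comp_apply plus expand[OF gr(1)] expand[OF gr(2)] expand[OF gr(3)]
             dl_in dr_in dend_apply)))
qed

end

section \<open>The coboundary as the differential of a multiplication\<close>

lemma graded_map_comp_at:
  assumes "vector_space sV" "vector_space sW" "\<And>r. graded_map sV sW n (\<sigma> r)"
  shows "graded_map sV sW n (comp_at \<sigma> y)"
  unfolding comp_at_def[abs_def] by (intro graded_map_sum graded_map_scale assms)

lemma (in dendriform_coalgebra) graded_pair_family: "graded_map sC sC 2 (pair_family dl dr r)"
  using graded_dl_dr graded_map_zero[OF vector_space_axioms vector_space_axioms] by (simp add: pair_family_def)

text \<open>The components at \<open>[1]\<close>, \<open>[2]\<close>, \<open>[3]\<close> are the three dendriform identities.\<close>

theorem (in dendriform_coalgebra) is_multiplication_pair_family: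
  "is_multiplication sC (pair_family dl dr)"
proof -
  note s = vector_space_axioms
  let ?p = "pair_family dl dr"
  have p: "?p \<in> operad sC (Suc (Suc 0))"
    using graded_pair_family
    by (simp add: operad_def cochains_iff s numeral_2_eq_2) (simp add: pair_family_def)
  have total: "total (Suc 0) ?p = dl + dr"
    by (rule ext) (simp add: total_def pair_family_def fun_plus_apply)
  have comps: "?p (Suc 0) = dl" "?p (Suc (Suc 0)) = dr"
    by (simp_all add: pair_family_def)
  have slots: "at_slot sC (Suc (Suc 0)) (Suc 0) g = tmap sC [g, tid sC]"
    "at_slot sC (Suc (Suc 0)) (Suc (Suc 0)) g = tmap sC [tid sC, g]" for g
    by (simp_all add: at_slot_def)
  have "pcomp sC (Suc (Suc 0)) (Suc (Suc 0)) ?p (Suc 0) ?p = pcomp sC (Suc (Suc 0)) (Suc (Suc 0)) ?p (Suc (Suc 0)) ?p"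
  proof (rule cochain_eqI)
    fix l x assume "l \<le> Suc (Suc 0)"
    then consider "l = 0" | "l = Suc 0" | "l = Suc (Suc 0)" by linarith
    then show "pcomp sC (Suc (Suc 0)) (Suc (Suc 0)) ?p (Suc 0) ?p (Suc l) x
        = pcomp sC (Suc (Suc 0)) (Suc (Suc 0)) ?p (Suc (Suc 0)) ?p (Suc l) x"
      by cases (simp_all add: pcomp_Suc[OF s] comp_at_R1 R0_Suc slots total comps dend_apply)
  next
    fix r assume "r \<notin> {1..Suc (Suc (Suc 0))}"
    then show "pcomp sC (Suc (Suc 0)) (Suc (Suc 0)) ?p (Suc 0) ?p r
        = pcomp sC (Suc (Suc 0)) (Suc (Suc 0)) ?p (Suc (Suc 0)) ?p r"
      by (simp add: pcomp_def)
  qed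
  with p show ?thesis by (simp add: is_multiplication_def numeral_2_eq_2)
qed

lemma coboundary_zero:
  assumes "vector_space sC" "vector_space sM" and L: "\<And>r x. L r x \<in> tensor_power (sum_scale sC sM) 2"
    and R: "\<And>r x. R r x \<in> tensor_power (sum_scale sC sM) 2"
  shows "coboundary sC D L R n (0 :: ('k::field, 'm::ab_group_add, 'c::ab_group_add) cochain) = 0"
proof -
  note maps = linear_sum_maps[OF assms(1,2)]
  have comp_at: "comp_at (0 :: ('k, 'm, 'c) cochain) y x = 0" for x y
    by (simp add: comp_at_def zero_fun_apply)
  then have sm: "slot_map (sum_scale sC sM) sC (comp_at (0 :: ('k, 'm, 'c) cochain) y \<circ> snd)" for y
    using linear_zero[OF vector_space_sum_scale[OF assms(1,2)] vector_space_tscale] assms(1)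
    by (simp add: slot_map_def comp_def)
  note sm_id = slot_map_tid_comp[OF maps(1)]
  have "tmap sC [tid sC \<circ> fst, comp_at (0 :: ('k, 'm, 'c) cochain) y \<circ> snd] (L r x) = 0"
    "tmap sC [comp_at (0 :: ('k, 'm, 'c) cochain) y \<circ> snd, tid sC \<circ> fst] (R r x) = 0" for y r x
    using tmap_pair_zero[OF sm_id sm L[folded tensors_pair_UNIV]]
      tmap_pair_zero[OF sm sm_id R[folded tensors_pair_UNIV]] comp_at by simp_all
  then show ?thesis
    by (intro ext) (simp add: coboundary_def linear_at_slot_D zero_fun_apply)
qed

lemma coboundary_closed:
  assumes C: "vector_space sC" and M: "vector_space sM"
    and D: "\<And>r. graded_map sC sC 2 (D r)"
    and L: "\<And>r. graded_map sM (sum_scale sC sM) 2 (L r)" and R: "\<And>r. graded_map sM (sum_scale sC sM) 2 (R r)"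
    and \<sigma>: "\<sigma> \<in> cochains sM sC n"
  shows "coboundary sC D L R n \<sigma> \<in> cochains sM sC (n + 1)"
proof -
  note maps = linear_sum_maps[OF C M]
  have \<sigma>': "graded_map sM sC n (\<sigma> r)" for r
    using \<sigma> by (simp add: cochains_iff C M)
  have tid: "graded_map sC sC 1 (tid sC)"
    using slot_map_tid[OF C] by (simp add: graded_map_def slot_map_def tid_def tens_in_power)
  have pair: "graded_map sM sC (n + 1) (\<lambda>x. tmap sC [F, G] (f x))"
    if "graded_map (sum_scale sC sM) sC a F" "graded_map (sum_scale sC sM) sC b G" "a + b = n + 1"
      "graded_map sM (sum_scale sC sM) 2 f" for F G f a b
    using that linear_comp[OF _ linear_tmap, of sM f] C tmap_in_power_pair[OF that(1,2)]
    unfolding graded_map_def by metis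
  note comp = graded_map_comp[OF maps(2) graded_map_comp_at[OF M C \<sigma>']] and id = graded_map_comp[OF maps(1) tid]
  have "graded_map sM sC (n + 1) (\<lambda>x. (at_slot sC n i (comp_at D y) \<circ> \<sigma> r) x)" if "i \<in> {1..n}" for i y r
    using that graded_map_at_slot[OF \<sigma>' graded_map_comp_at[OF C C D]] by (simp add: comp_def)
  then have "graded_map sM sC (n + 1) (\<lambda>x. tmap sC [tid sC \<circ> fst, comp_at \<sigma> (R1 2 2 n r) \<circ> snd] (L (R0 2 2 n r) x)
     + (\<Sum>i=1..n. tscale ((-1) ^ i) ((at_slot sC n i (comp_at D (R1 n i 2 r)) \<circ> \<sigma> (R0 n i 2 r)) x))
     + tscale ((-1) ^ (n + 1)) (tmap sC [comp_at \<sigma> (R1 2 1 n r) \<circ> snd, tid sC \<circ> fst] (R (R0 2 1 n r) x)))" for r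
    by (intro graded_map_plus graded_map_scale graded_map_sum C M pair[OF id comp _ L] pair[OF comp id _ R]) simp_all
  then show ?thesis
    by (simp add: cochains_iff C M coboundary_def graded_map_zero)
qed

text \<open>Identifying \<open>C \<otimes> C\<close> with \<open>C \<otimes> M\<close> and \<open>M \<otimes> C\<close> and then reading off the components is the
  identity, so the outer terms of the coboundary are partial compositions too.\<close>

theorem (in dendriform_coalgebra) coboundary_regular:
  assumes n: "n \<ge> 1" and \<sigma>: "\<sigma> \<in> cochains sC sC n"
  shows "coboundary sC (pair_family dl dr) (pair_family (as_CM sC \<circ> dl) (as_CM sC \<circ> dr))
      (pair_family (as_MC sC \<circ> dl) (as_MC sC \<circ> dr)) n \<sigma> = operadic_coboundary sC (pair_family dl dr) n \<sigma>"
proof -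
  let ?S = "sum_scale sC sC" and ?D = "pair_family dl dr"
  note s = vector_space_axioms
  note maps = linear_sum_maps[OF s s]
  have CM: "pair_family (as_CM sC \<circ> dl) (as_CM sC \<circ> dr) r x = as_CM sC (?D r x)"
    and MC: "pair_family (as_MC sC \<circ> dl) (as_MC sC \<circ> dr) r x = as_MC sC (?D r x)" for r x
    by (simp_all add: pair_family_def as_CM_tens_maps linear_D[OF linear_tens_maps] zero_fun_apply)
  have slots: "tmap sC [tid sC \<circ> fst, \<tau> \<circ> snd] (as_CM sC t) = at_slot sC 2 2 \<tau> t"
    "tmap sC [\<tau> \<circ> snd, tid sC \<circ> fst] (as_MC sC t) = at_slot sC 2 1 \<tau> t"
    if \<tau>: "slot_map sC sC \<tau>" and t: "t \<in> tensor_power sC 2" for \<tau> t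
  proof -
    note sm = slot_map_tid_comp[OF maps(1)] slot_map_comp[OF maps(2) \<tau>] slot_map_tid[OF s]
    have at: "at_slot sC 2 2 \<tau> = tmap sC [tid sC, \<tau>]" "at_slot sC 2 1 \<tau> = tmap sC [\<tau>, tid sC]"
      by (simp_all add: at_slot_def)
    show "tmap sC [tid sC \<circ> fst, \<tau> \<circ> snd] (as_CM sC t) = at_slot sC 2 2 \<tau> t" unfolding at as_CM_tens_maps
      using t[folded tensors_pair_UNIV] linear_comp[OF linear_tens_maps linear_tmap] linear_tmap
      by (rule tensors_pair_eqI) (simp add: tens_maps_tens_pair maps tmap_pair sm \<tau>, simp add: inC_def inM_def)
    show "tmap sC [\<tau> \<circ> snd, tid sC \<circ> fst] (as_MC sC t) = at_slot sC 2 1 \<tau> t" unfolding at as_CM_tens_maps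
      using t[folded tensors_pair_UNIV] linear_comp[OF linear_tens_maps linear_tmap] linear_tmap
      by (rule tensors_pair_eqI) (simp add: tens_maps_tens_pair maps tmap_pair sm \<tau>, simp add: inC_def inM_def)
  qed
  have "slot_map sC sC (comp_at \<sigma> y)" for y
    using \<sigma> by (intro graded_map_slot_map[of _ _ n] graded_map_comp_at s) (simp add: cochains_iff s)
  moreover have "?D r x \<in> tensor_power sC 2" for r x
    using graded_pair_family by (simp add: graded_map_def)
  ultimately show ?thesis
    by (intro ext) (simp add: coboundary_def operadic_coboundary_apply CM MC slots zero_fun_apply)
qed

section \<open>The coalgebra on the direct sum of a coalgebra and a bicomodule\<close>

text \<open>The total structure map of \<open>C \<oplus> M\<close> from one of \<open>C\<close> and the corresponding left and right
  coactions.\<close>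

definition semidirect where
  "semidirect s x xl xr = (\<lambda>p. embC s (x (fst p)) + xl (snd p) + xr (snd p))"

lemma tmap_embC:
  assumes i: "Vector_Spaces.linear sC S inC" and F: "slot_map S S F" and G: "slot_map S S G"
    and f: "slot_map sC sC f" and g: "slot_map sC sC g"
    and Ff: "\<And>c. F (inC c) = embC S (f c)" and Gg: "\<And>c. G (inC c) = embC S (g c)"
    and t: "t \<in> tensor_power sC 2"
  shows "tmap S [F, G] (embC S t) = embC S (tmap sC [f, g] t)"
proof -
  have "tmap S [F, G] (embC S t) = tmap S [F \<circ> inC, G \<circ> inC] t"
    unfolding embC_tfun using tmap_tfun[OF i, of "[F, G]" S t] F G t
    by (simp add: numeral_2_eq_2 slot_mapD(6))
  moreover have "F \<circ> inC = tfun S inC \<circ> f" "G \<circ> inC = tfun S inC \<circ> g"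
    by (rule ext, simp add: Ff Gg embC_tfun)+
  moreover have "tmap S [tfun S inC \<circ> f, tfun S inC \<circ> g] t = tfun S inC (tmap sC [f, g] t)"
    using tfun_tmap[OF i, of "[f, g]" sC t] f g t by (simp add: numeral_2_eq_2 slot_mapD(6))
  ultimately show ?thesis by (simp add: embC_tfun)
qed

definition comodule_map where
  "comodule_map sM S A B f \<longleftrightarrow> Vector_Spaces.linear sM tscale f \<and> (\<forall>x. f x \<in> tensors S [A, B])"

lemma embC_in_tensors:
  assumes "Vector_Spaces.linear sC S inC" "t \<in> tensor_power sC 2"
  shows "embC S t \<in> tensors S [range inC, range inC]"
  using tens_maps_in_tensors[OF assms(1,1,1,1) assms(2)] by (simp add: embC_tens_maps[OF assms])

lemma graded_embC:
  assumes "Vector_Spaces.linear sC S inC" "graded_map sV sC n f"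
  shows "graded_map sV S n (embC S \<circ> f)"
  using assms tfun_in_power[OF assms(1)] linear_comp[OF _ linear_tfun, of sV f]
  unfolding graded_map_def comp_def embC_tfun Vector_Spaces.linear_iff[of sC S] by blast

lemma graded_comodule_map:
  assumes "vector_space S" "comodule_map sM S A B f"
  shows "graded_map sM S 2 f"
  using assms tensors_pair_power unfolding graded_map_def comodule_map_def by blast

locale semidirect_setting =
  fixes sC :: "'k::field \<Rightarrow> 'c::ab_group_add \<Rightarrow> 'c" and sM :: "'k \<Rightarrow> 'm::ab_group_add \<Rightarrow> 'm"
    and S :: "'k \<Rightarrow> 'c \<times> 'm \<Rightarrow> 'c \<times> 'm"
  assumes C: "vector_space sC" and M: "vector_space sM" and S_eq: "S = sum_scale sC sM"
begin

lemmas S = vector_space_sum_scale[OF C M, folded S_eq]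
lemmas maps = linear_sum_maps[OF C M, folded S_eq]

abbreviation "CM \<equiv> comodule_map sM S (range inC) (range inM)"
abbreviation "MC \<equiv> comodule_map sM S (range inM) (range inC)"

lemma slot_maps:
  assumes "graded_map sC sC 2 x" "CM xl" "MC xr"
  shows "slot_map S S (embC S \<circ> x \<circ> fst)" "slot_map S S (xl \<circ> snd)" "slot_map S S (xr \<circ> snd)"
  using graded_map_comp[OF maps(1) graded_embC[OF maps(3) assms(1)]]
    graded_map_comp[OF maps(2) graded_comodule_map[OF S assms(2)]]
    graded_map_comp[OF maps(2) graded_comodule_map[OF S assms(3)]]
  by (simp_all add: graded_map_slot_map)

lemma graded_semidirect:
  assumes "graded_map sC sC 2 x" "CM xl" "MC xr"
  shows "graded_map S S 2 (semidirect S x xl xr)"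
  using graded_map_plus[OF graded_map_plus[OF graded_map_comp[OF maps(1) graded_embC[OF maps(3) assms(1)]]
    graded_map_comp[OF maps(2) graded_comodule_map[OF S assms(2)]]]
    graded_map_comp[OF maps(2) graded_comodule_map[OF S assms(3)]]]
  by (simp add: semidirect_def[abs_def] comp_def)

lemma semidirect_in:
  assumes "graded_map sC sC 2 x" "CM xl" "MC xr"
  shows "semidirect S x xl xr (inC c) = embC S (x c)" "semidirect S x xl xr (inM m) = xl m + xr m"
proof -
  have "x 0 = 0" "xl 0 = 0" "xr 0 = 0"
    using assms linear_D(3) unfolding graded_map_def comodule_map_def by blast+
  then show "semidirect S x xl xr (inC c) = embC S (x c)" "semidirect S x xl xr (inM m) = xl m + xr m"
    by (simp_all add: semidirect_def inC_def inM_def embC_tfun linear_tfun_D)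
qed

text \<open>On \<open>C \<otimes> C\<close>, \<open>C \<otimes> M\<close> and \<open>M \<otimes> C\<close> only those summands survive that accept the element in the
  slot where the map acts.\<close>

lemma semidirect_expand:
  assumes x: "graded_map sC sC 2 x" "CM xl" "MC xr" and y: "graded_map sC sC 2 y" "CM yl" "MC yr"
  shows "tmap S [semidirect S x xl xr, tid S] (semidirect S y yl yr p)
      = embC S (tmap sC [x, tid sC] (y (fst p))) + (tmap S [embC S \<circ> x \<circ> fst, tid S] (yl (snd p))
        + tmap S [xl \<circ> snd, tid S] (yr (snd p)) + tmap S [xr \<circ> snd, tid S] (yr (snd p)))" (is ?left)
    and "tmap S [tid S, semidirect S x xl xr] (semidirect S y yl yr p)
      = embC S (tmap sC [tid sC, x] (y (fst p))) + (tmap S [tid S, xl \<circ> snd] (yl (snd p))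
        + tmap S [tid S, xr \<circ> snd] (yl (snd p)) + tmap S [tid S, embC S \<circ> x \<circ> fst] (yr (snd p)))" (is ?right)
proof -
  let ?X = "semidirect S x xl xr"
  obtain c m where p: "p = (c, m)" by (cases p)
  note X = graded_map_slot_map[OF graded_semidirect[OF x]]
  note sm = slot_maps[OF x] and sum = slot_map_plus[OF slot_maps(2,3)[OF x]]
  note id = slot_map_tid[OF S] and idC = slot_map_tid[OF C] and fx = graded_map_slot_map[OF x(1)]
  have tid_inC: "tid S (inC c) = embC S (tid sC c)" for c
    by (simp add: tid_def embC_tfun tfun_tens[OF maps(3)])
  have y2: "y c \<in> tensor_power sC 2" using y(1) by (simp add: graded_map_def)
  have yl: "yl m \<in> tensors S [range inC, range inM]" and yr: "yr m \<in> tensors S [range inM, range inC]"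
    using y(2,3) by (simp_all add: comodule_map_def)
  have on_C: "?X a = (embC S \<circ> x \<circ> fst) a" if "a \<in> range inC" for a
    using that by (auto simp: semidirect_in[OF x]) (simp add: inC_def)
  have on_M: "?X a = (xl \<circ> snd) a + (xr \<circ> snd) a" if "a \<in> range inM" for a
    using that by (auto simp: semidirect_in[OF x]) (simp add: inM_def)
  have emb: "tmap S [?X, tid S] (embC S (y c)) = embC S (tmap sC [x, tid sC] (y c))"
    "tmap S [tid S, ?X] (embC S (y c)) = embC S (tmap sC [tid sC, x] (y c))"
    by (rule tmap_embC[OF maps(3) X id fx idC _ _ y2], simp_all add: semidirect_in[OF x] tid_inC)
       (rule tmap_embC[OF maps(3) id X idC fx _ _ y2], simp_all add: semidirect_in[OF x] tid_inC)
  have left: "tmap S [?X, tid S] (yl m) = tmap S [embC S \<circ> x \<circ> fst, tid S] (yl m)"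
    "tmap S [?X, tid S] (yr m) = tmap S [\<lambda>a. (xl \<circ> snd) a + (xr \<circ> snd) a, tid S] (yr m)"
    by (rule tmap_pair_cong[OF X id sm(1) id yl on_C refl], assumption)
       (rule tmap_pair_cong[OF X id sum id yr on_M refl], assumption)
  have right: "tmap S [tid S, ?X] (yl m) = tmap S [tid S, \<lambda>a. (xl \<circ> snd) a + (xr \<circ> snd) a] (yl m)"
    "tmap S [tid S, ?X] (yr m) = tmap S [tid S, embC S \<circ> x \<circ> fst] (yr m)"
    by (rule tmap_pair_cong[OF id X id sum yl refl on_M], assumption)
       (rule tmap_pair_cong[OF id X id sm(1) yr refl on_C], assumption)
  have split: "semidirect S y yl yr p = embC S (y c) + yl m + yr m"
    by (simp add: semidirect_def p)
  show ?left
    unfolding split linear_tmap_D(1) emb left tmap_pair_plus(1)[OF sm(2,3) id tensors_pair_power[OF yr]]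
    by (simp add: p add.assoc)
  show ?right
    unfolding split linear_tmap_D(1) emb right tmap_pair_plus(2)[OF sm(2,3) id tensors_pair_power[OF yl]]
    by (simp add: p add.assoc)
qed

text \<open>A cochain on \<open>M\<close> with values in \<open>C\<close>, extended by zero to \<open>C \<oplus> M\<close>.\<close>

definition lift :: "('k, 'm, 'c) cochain \<Rightarrow> ('k, 'c \<times> 'm, 'c \<times> 'm) cochain" where
  "lift \<sigma> = (\<lambda>r. embC S \<circ> \<sigma> r \<circ> snd)"

lemma lift_in_operad:
  assumes "\<sigma> \<in> cochains sM sC n"
  shows "lift \<sigma> \<in> operad S n"
proof -
  have "graded_map sM sC n (\<sigma> r)" for r using assms by (simp add: cochains_iff C M)
  moreover have "embC S \<circ> (0 :: 'm \<Rightarrow> ('k, 'c) tensor) \<circ> (snd :: 'c \<times> 'm \<Rightarrow> 'm) = 0"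
    by (rule ext) (simp add: embC_tfun linear_tfun_D zero_fun_apply)
  ultimately show ?thesis
    using assms graded_map_comp[OF maps(2) graded_embC[OF maps(3)]]
    by (simp add: operad_def cochains_iff C M S lift_def)
qed

text \<open>The projection to \<open>C\<close> induces a left inverse of \<open>embC\<close>.\<close>

lemma lift_eq_0:
  assumes "\<sigma> \<in> cochains sM sC n" "lift \<sigma> = 0"
  shows "\<sigma> = 0"
proof (intro ext[of \<sigma>] ext[of "\<sigma> _"])
  fix r x
  have "\<sigma> r x \<in> tensor_algebra sC"
    using assms(1) slot_mapD(2)[OF graded_map_slot_map, of sM sC n "\<sigma> r" x] by (simp add: cochains_iff C M)
  moreover have "embC S (\<sigma> r x) = 0"
    using fun_cong[OF fun_cong[OF assms(2), of r], of "(0, x)"] by (simp add: lift_def zero_fun_apply)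
  ultimately show "\<sigma> r x = 0 r x"
    using tfun_inverse[OF maps(3,1), of "\<sigma> r x"]
    by (simp add: embC_tfun inC_def linear_tfun_D zero_fun_apply)
qed

text \<open>The extension by zero kills \<open>C\<close>, so in the first term only the left coaction survives and in the last
  term only the right one; the middle terms stay inside the tensor powers of \<open>C\<close>.\<close>

theorem operadic_coboundary_lift:
  assumes \<sigma>: "\<sigma> \<in> cochains sM sC n"
    and D: "\<And>r. graded_map sC sC 2 (D r)" and L: "\<And>r. CM (L r)" and R: "\<And>r. MC (R r)"
  shows "operadic_coboundary S (\<lambda>r. semidirect S (D r) (L r) (R r)) n (lift \<sigma>)
    = lift (coboundary sC D L R n \<sigma>)"
proof (intro ext[of "operadic_coboundary _ _ _ _"] ext[of "operadic_coboundary _ _ _ _ _"])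
  fix r and p :: "'c \<times> 'm"
  let ?E = "\<lambda>r. semidirect S (D r) (L r) (R r)"
  obtain c m where p: "p = (c, m)" by (cases p)
  have \<sigma>': "graded_map sM sC n (\<sigma> r)" for r using \<sigma> by (simp add: cochains_iff C M)
  have tid_inC: "tid S (inC c) = embC S (tid sC c)" for c
    by (simp add: tid_def embC_tfun tfun_tens[OF maps(3)])
  note id = slot_map_tid[OF S] and idC = slot_map_tid[OF C]
  have comp_at_lift: "comp_at (lift \<sigma>) y = embC S \<circ> comp_at \<sigma> y \<circ> snd" for y
    by (rule ext) (simp add: comp_at_def lift_def embC_tfun linear_tfun_D linear_map_sum[OF linear_tfun])
  have outer: "tmap S [tid S, embC S \<circ> \<tau> \<circ> snd] (?E k p) = embC S (tmap sC [tid sC \<circ> fst, \<tau> \<circ> snd] (L k m))"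
    "tmap S [embC S \<circ> \<tau> \<circ> snd, tid S] (?E k p) = embC S (tmap sC [\<tau> \<circ> snd, tid sC \<circ> fst] (R k m))"
    if "graded_map sM sC n \<tau>" for \<tau> k
  proof -
    let ?F = "embC S \<circ> \<tau> \<circ> snd"
    have F: "slot_map S S ?F"
      by (rule graded_map_slot_map[OF graded_map_comp[OF maps(2) graded_embC[OF maps(3) that]]])
    have \<tau>: "slot_map S sC (\<tau> \<circ> snd)"
      by (rule slot_map_comp[OF maps(2) graded_map_slot_map[OF that]])
    note id1 = slot_map_tid_comp[OF maps(1)]
    have eid: "slot_map S S (embC S \<circ> (tid sC \<circ> fst))"
      unfolding embC_tfun by (rule slot_map_tfun[OF maps(3) id1])
    have "\<tau> 0 = 0" using that linear_D(3) unfolding graded_map_def by blast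
    then have F0: "\<forall>a\<in>range inC. ?F a = 0"
      by (auto simp: inC_def embC_tfun linear_tfun_D)
    have eid_C: "tid S a = (embC S \<circ> (tid sC \<circ> fst)) a" if "a \<in> range inC" for a
      using that tid_inC by (auto simp: inC_def)
    have Dc: "embC S (D k c) \<in> tensors S [range inC, range inC]"
      using D by (intro embC_in_tensors[OF maps(3)]) (simp add: graded_map_def)
    have Lm: "L k m \<in> tensors S [range inC, range inM]" and Rm: "R k m \<in> tensors S [range inM, range inC]"
      using L R by (simp_all add: comodule_map_def)
    have split: "?E k p = embC S (D k c) + L k m + R k m"
      by (simp add: semidirect_def p)
    have comp: "embC S (tmap sC [tid sC \<circ> fst, \<tau> \<circ> snd] (L k m))
        = tmap S [embC S \<circ> (tid sC \<circ> fst), embC S \<circ> (\<tau> \<circ> snd)] (L k m)"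
      "embC S (tmap sC [\<tau> \<circ> snd, tid sC \<circ> fst] (R k m))
        = tmap S [embC S \<circ> (\<tau> \<circ> snd), embC S \<circ> (tid sC \<circ> fst)] (R k m)"
      unfolding embC_tfun
      using tfun_tmap[OF maps(3), of "[tid sC \<circ> fst, \<tau> \<circ> snd]" S "L k m"]
        tfun_tmap[OF maps(3), of "[\<tau> \<circ> snd, tid sC \<circ> fst]" S "R k m"]
        tensors_pair_power[OF Lm] tensors_pair_power[OF Rm]
      by (simp_all add: \<tau> id1 S numeral_2_eq_2)
    have "tmap S [tid S, ?F] (embC S (D k c)) = 0" "tmap S [tid S, ?F] (R k m) = 0"
      "tmap S [?F, tid S] (embC S (D k c)) = 0" "tmap S [?F, tid S] (L k m) = 0"
      by (rule tmap_pair_zero[OF id F Dc disjI2[OF F0]] tmap_pair_zero[OF id F Rm disjI2[OF F0]]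
          tmap_pair_zero[OF F id Dc disjI1[OF F0]] tmap_pair_zero[OF F id Lm disjI1[OF F0]])+
    moreover have "tmap S [tid S, ?F] (L k m) = tmap S [embC S \<circ> (tid sC \<circ> fst), ?F] (L k m)"
      by (rule tmap_pair_cong[OF id F eid F Lm eid_C refl])
    moreover have "tmap S [?F, tid S] (R k m) = tmap S [?F, embC S \<circ> (tid sC \<circ> fst)] (R k m)"
      by (rule tmap_pair_cong[OF F id F eid Rm refl eid_C])
    ultimately show "tmap S [tid S, ?F] (?E k p) = embC S (tmap sC [tid sC \<circ> fst, \<tau> \<circ> snd] (L k m))"
      "tmap S [?F, tid S] (?E k p) = embC S (tmap sC [\<tau> \<circ> snd, tid sC \<circ> fst] (R k m))"
      unfolding split comp by (simp_all add: linear_tmap_D comp_assoc)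
  qed
  have inner: "at_slot S n i (comp_at ?E y) (embC S u) = embC S (at_slot sC n i (comp_at D y) u)"
    if "i \<in> {1..n}" and u: "u \<in> tensor_power sC n" for i y u
  proof -
    let ?fs = "replicate (i - 1) (tid S) @ comp_at ?E y # replicate (n - i) (tid S)"
      and ?gs = "replicate (i - 1) (tid sC) @ comp_at D y # replicate (n - i) (tid sC)"
    have E: "slot_map S S (comp_at ?E y)"
      by (rule graded_map_slot_map[OF graded_map_comp_at[OF S S graded_semidirect[OF D L R]]])
    have D': "slot_map sC sC (comp_at D y)"
      by (rule graded_map_slot_map[OF graded_map_comp_at[OF C C D]])
    have len: "length ?fs = n" "length ?gs = n" using that by auto
    have "comp_at ?E y \<circ> inC = embC S \<circ> comp_at D y"
      by (rule ext) (simp add: comp_at_def semidirect_in[OF D L R] embC_tfun linear_tfun_D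
          linear_map_sum[OF linear_tfun])
    moreover have "tid S \<circ> inC = embC S \<circ> tid sC"
      by (rule ext) (simp add: tid_inC)
    ultimately have "map (\<lambda>f. f \<circ> inC) ?fs = map (\<lambda>f. tfun S inC \<circ> f) ?gs"
      by (simp add: embC_tfun)
    moreover have "tmap S ?fs (tfun S inC u) = tmap S (map (\<lambda>f. f \<circ> inC) ?fs) u"
      by (rule tmap_tfun[OF maps(3) _ S]) (use u len(1) E id in auto)
    moreover have "tfun S inC (tmap sC ?gs u) = tmap S (map (\<lambda>f. tfun S inC \<circ> f) ?gs) u"
      by (rule tfun_tmap[OF maps(3) _ C]) (use u len(2) D' idC in auto)
    ultimately show ?thesis
      by (simp only: at_slot_def embC_tfun)
  qed
  have slots: "at_slot S 2 2 F = tmap S [tid S, F]" "at_slot S 2 1 F = tmap S [F, tid S]" for F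
    by (simp_all add: at_slot_def)
  have first: "at_slot S 2 2 (comp_at (lift \<sigma>) y) (?E k p)
      = embC S (tmap sC [tid sC \<circ> fst, comp_at \<sigma> y \<circ> snd] (L k m))"
    and last: "at_slot S 2 1 (comp_at (lift \<sigma>) y) (?E k p)
      = embC S (tmap sC [comp_at \<sigma> y \<circ> snd, tid sC \<circ> fst] (R k m))" for y k
    by (simp_all only: slots comp_at_lift outer[OF graded_map_comp_at[OF M C \<sigma>']])
  have middle: "at_slot S n i (comp_at ?E y) (lift \<sigma> k p) = embC S (at_slot sC n i (comp_at D y) (\<sigma> k m))"
    if "i \<in> {1..n}" for i y k
    using inner[OF that] \<sigma>' by (simp add: lift_def p graded_map_def)
  show "operadic_coboundary S ?E n (lift \<sigma>) r p = lift (coboundary sC D L R n \<sigma>) r p"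
  proof (cases "r \<in> {1..n+1}")
    case True
    have "(\<Sum>i=1..n. tscale ((-1) ^ i) (at_slot S n i (comp_at ?E (R1 n i 2 r)) (lift \<sigma> (R0 n i 2 r) p)))
        = embC S (\<Sum>i=1..n. tscale ((-1) ^ i) (at_slot sC n i (comp_at D (R1 n i 2 r)) (\<sigma> (R0 n i 2 r) m)))"
      unfolding embC_tfun linear_map_sum[OF linear_tfun] linear_tfun_D
      by (intro sum.cong refl) (simp only: middle embC_tfun)
    moreover have "lift \<tau> k p = embC S (\<tau> k m)" for \<tau> k
      by (simp add: lift_def p)
    ultimately show ?thesis
      using True by (simp add: operadic_coboundary_apply first last
          coboundary_def embC_tfun linear_tfun_D del: One_nat_def)
  next
    case False
    then show ?thesis
      by (simp only: operadic_coboundary_apply lift_def coboundary_def if_True comp_apply zero_fun_apply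
          embC_tfun linear_tfun_D not_False_eq_True)
  qed
qed

end

context dendriform_bicomodule begin

interpretation semidirect_setting sC sM s
  by unfold_locales (simp_all add: s_def)

lemma comodule_maps: "CM ll" "CM lr" "MC rl" "MC rr"
  using linear_ll linear_lr linear_rl linear_rr ll_in lr_in rl_in rr_in by (simp_all add: comodule_map_def)

lemma comodule_map_plus:
  assumes "comodule_map sM s A B f" "comodule_map sM s A B g"
  shows "comodule_map sM s A B (f + g)"
proof -
  have "tensor.subspace (tensors s [A, B])" by (simp only: tensors_pair tensor.subspace_span)
  moreover have "Vector_Spaces.linear sM tscale (f + g)"
    using assms linear_plus[of sM tscale f g] by (simp add: comodule_map_def plus_fun_def[of f g])
  ultimately show ?thesis
    using assms by (simp add: comodule_map_def fun_plus_apply tensor.subspace_add)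
qed

lemma comodule_map_zero: "comodule_map sM s A B 0"
proof -
  have "tensor.subspace (tensors s [A, B])" by (simp only: tensors_pair tensor.subspace_span)
  moreover have "Vector_Spaces.linear sM tscale (0 :: 'm \<Rightarrow> ('k, 'c \<times> 'm) tensor)"
    using linear_zero[OF M vector_space_tscale] by (subst zero_fun_def) simp
  ultimately show ?thesis by (simp add: comodule_map_def zero_fun_apply tensor.subspace_0)
qed

lemma families:
  "graded_map sC sC 2 (pair_family dl dr r)" "CM (pair_family ll lr r)" "MC (pair_family rl rr r)"
  using graded_pair_family comodule_maps comodule_map_zero by (simp_all add: pair_family_def)

lemmas graded_families = graded_comodule_map[OF S families(2)] graded_comodule_map[OF S families(3)]

lemma coboundary_0:
  "coboundary sC (pair_family dl dr) (pair_family ll lr) (pair_family rl rr) n 0 = 0"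
  using graded_families by (intro coboundary_zero[OF C M]) (simp_all add: graded_map_def s_def)

abbreviation "eL \<equiv> semidirect s dl ll rl"
abbreviation "eR \<equiv> semidirect s dr lr rr"

lemma semidirect_plus: "eL + eR = semidirect s (dl + dr) (ll + lr) (rl + rr)"
  by (rule ext) (simp add: fun_plus_apply semidirect_def embC_tfun linear_tfun_D add_ac)

lemma sums: "(ll + lr) \<circ> snd = lL + lR" "(rl + rr) \<circ> snd = rL + rR" "embC s \<circ> (dl + dr) \<circ> fst = dL + dR"
  by (rule ext, simp add: fun_plus_apply lL_def lR_def rL_def rR_def dL_def dR_def embC_tfun linear_tfun_D)+

text \<open>Separating the summands with values in \<open>C \<otimes> C \<otimes> C\<close>, \<open>C \<otimes> C \<otimes> M\<close>, \<open>C \<otimes> M \<otimes> C\<close> and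
  \<open>M \<otimes> C \<otimes> C\<close>, each of the three identities of the sum is one identity of \<open>C\<close> and three of \<open>M\<close>.\<close>

theorem semidirect_coalgebra: "dendriform_coalgebra s eL eR"
proof -
  note gL = graded_dl_dr(1) comodule_maps(1,3) and gR = graded_dl_dr(2) comodule_maps(2,4)
  note gS = graded_sum comodule_map_plus[OF comodule_maps(1,2)] comodule_map_plus[OF comodule_maps(3,4)]
  note E = graded_semidirect[OF gL] graded_semidirect[OF gR]
  note folds = lL_def[symmetric] lR_def[symmetric] rL_def[symmetric] rR_def[symmetric]
    dL_def[symmetric] dR_def[symmetric] idt_def[symmetric]
  note bi = ll1[THEN fun_cong, unfolded comp_apply] ll2[THEN fun_cong, unfolded comp_apply]
    ll3[THEN fun_cong, unfolded comp_apply] lr1[THEN fun_cong, unfolded comp_apply]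
    lr2[THEN fun_cong, unfolded comp_apply] lr3[THEN fun_cong, unfolded comp_apply]
    rr1[THEN fun_cong, unfolded comp_apply] rr2[THEN fun_cong, unfolded comp_apply]
    rr3[THEN fun_cong, unfolded comp_apply]
  show ?thesis
  proof (intro dendriform_coalgebra.intro dendriform_coalgebra_axioms.intro)
    show "vector_space s" by (rule S)
    show "Vector_Spaces.linear s tscale eL" "Vector_Spaces.linear s tscale eR"
      "eL x \<in> tensor_power s 2" "eR x \<in> tensor_power s 2" for x
      using E by (simp_all add: graded_map_def del: split_paired_All)
    show "tmap s [eL, tid s] \<circ> eL = tmap s [tid s, eL + eR] \<circ> eL"
    proof (rule ext)
      fix p
      show "(tmap s [eL, tid s] \<circ> eL) p = (tmap s [tid s, eL + eR] \<circ> eL) p"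
        unfolding comp_apply semidirect_plus 
        unfolding semidirect_expand(1)[OF gL gL] semidirect_expand(2)[OF gS gL]
        unfolding sums folds
        unfolding bi dend_apply ..
    qed
    show "tmap s [eR, tid s] \<circ> eL = tmap s [tid s, eL] \<circ> eR"
    proof (rule ext)
      fix p
      show "(tmap s [eR, tid s] \<circ> eL) p = (tmap s [tid s, eL] \<circ> eR) p"
        unfolding comp_apply 
        unfolding semidirect_expand(1)[OF gR gL] semidirect_expand(2)[OF gL gR]
        unfolding sums folds
        unfolding bi dend_apply ..
    qed
    show "tmap s [eL + eR, tid s] \<circ> eR = tmap s [tid s, eR] \<circ> eR"
    proof (rule ext)
      fix p
      show "(tmap s [eL + eR, tid s] \<circ> eR) p = (tmap s [tid s, eR] \<circ> eR) p"
        unfolding comp_apply semidirect_plus 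
        unfolding semidirect_expand(1)[OF gS gR] semidirect_expand(2)[OF gR gR]
        unfolding sums folds
        unfolding bi dend_apply ..
    qed
  qed
qed

text \<open>The square of the coboundary is carried by the injective map \<open>lift\<close> to the square of the
  differential on the operad of \<open>C \<oplus> M\<close>, which vanishes by \<open>d_d\<close>.\<close>

theorem coboundary_squared:
  assumes \<sigma>: "\<sigma> \<in> cochains sM sC n"
  shows "coboundary sC (pair_family dl dr) (pair_family ll lr) (pair_family rl rr) n \<sigma> \<in> cochains sM sC (n + 1)"
    and "coboundary sC (pair_family dl dr) (pair_family ll lr) (pair_family rl rr) (n + 1)
      (coboundary sC (pair_family dl dr) (pair_family ll lr) (pair_family rl rr) n \<sigma>) = 0"
proof -
  let ?D = "pair_family dl dr" and ?L = "pair_family ll lr" and ?R = "pair_family rl rr"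
  let ?\<delta> = "coboundary sC ?D ?L ?R"
  have closed: "?\<delta> n \<sigma> \<in> cochains sM sC (n + 1)" if "\<sigma> \<in> cochains sM sC n" for n \<sigma>
    by (rule coboundary_closed[OF C M families(1) graded_families[unfolded s_def] that])
  show "?\<delta> n \<sigma> \<in> cochains sM sC (n + 1)" by (rule closed[OF \<sigma>])
  let ?E = "\<lambda>r. semidirect s (?D r) (?L r) (?R r)"
  have "?E = pair_family eL eR"
    by (intro ext) (simp add: pair_family_def semidirect_def zero_fun_apply embC_tfun linear_tfun_D)
  then have E: "is_multiplication s ?E"
    using dendriform_coalgebra.is_multiplication_pair_family[OF semidirect_coalgebra] by simp
  note lift = operadic_coboundary_lift[OF _ families]
  show "?\<delta> (n + 1) (?\<delta> n \<sigma>) = 0"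
  proof (cases n)
    case 0
    then have "\<sigma> = 0" using \<sigma> by (auto simp: cochains_def fun_eq_iff zero_fun_apply)
    then show ?thesis by (simp add: coboundary_0)
  next
    case (Suc a)
    have f: "lift \<sigma> \<in> operad s (Suc a)" using lift_in_operad[OF \<sigma>] Suc by simp
    have "lift (?\<delta> (n + 1) (?\<delta> n \<sigma>))
        = operadic_coboundary s ?E (n + 1) (operadic_coboundary s ?E n (lift \<sigma>))"
      by (simp only: lift[OF \<sigma>] lift[OF closed[OF \<sigma>]])
    also have "\<dots> = 0"
      using mult_diff_mult_diff[OF S E f] mult_diff_scale[OF S E mult_diff_closed[OF S E f]]
      by (simp add: operadic_coboundary_eq Suc)
    finally show ?thesis using lift_eq_0[OF closed[OF closed[OF \<sigma>]]] by simp
  qed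
qed

end

theorem mainTheorem2:
  fixes sC :: "'k::field_char_0 \<Rightarrow> 'c::ab_group_add \<Rightarrow> 'c"
    and dl dr :: "'c \<Rightarrow> ('k, 'c) tensor"
  assumes "dendriform_coalgebra sC dl dr"
  shows
    "let D = pair_family dl dr;
         ll = as_CM sC \<circ> dl; lr = as_CM sC \<circ> dr;
         rl = as_MC sC \<circ> dl; rr = as_MC sC \<circ> dr;
         X = cochains sC sC;
         \<delta> = coboundary sC D (pair_family ll lr) (pair_family rl rr);
         B = coboundaries X \<delta>
     in dendriform_bicomodule sC dl dr sC ll lr rl rr \<and>
        is_multiplication sC D \<and>
        (\<forall>n\<ge>1. X n = operad sC n \<and>
           (\<forall>\<sigma>\<in>X n. \<delta> n \<sigma> = cscale ((-1) ^ (n - 1)) (mult_diff sC D n \<sigma>))) \<and>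
        gerstenhaber_algebra (cohomology X \<delta>) B
          (\<lambda>n. induced2 (B n) (+))
          (\<lambda>n a. induced1 (B n) (cscale a))
          (\<lambda>m n. induced2 (B (m + n)) (mult_prod sC D m n))
          (\<lambda>m n. induced2 (B (m + n - 1)) (bracket sC m n)) \<and>
        (\<forall>(sM :: 'k \<Rightarrow> 'm::ab_group_add \<Rightarrow> 'm) ll lr rl rr.
           dendriform_bicomodule sC dl dr sM ll lr rl rr \<longrightarrow>
           (let \<delta> = coboundary sC D (pair_family ll lr) (pair_family rl rr)
            in \<forall>n. \<forall>\<sigma>\<in>cochains sM sC n.
                 \<delta> n \<sigma> \<in> cochains sM sC (n + 1) \<and> \<delta> (n + 1) (\<delta> n \<sigma>) = 0))"
proof -
  interpret dendriform_coalgebra sC dl dr by fact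
  note reg = regular_bicomodule and mult = is_multiplication_pair_family
  let ?\<delta> = "coboundary sC (pair_family dl dr) (pair_family (as_CM sC \<circ> dl) (as_CM sC \<circ> dr))
    (pair_family (as_MC sC \<circ> dl) (as_MC sC \<circ> dr))"
  have \<delta>: "?\<delta> n \<sigma> = cscale ((-1) ^ (n - 1)) (mult_diff sC (pair_family dl dr) n \<sigma>)"
    if "n \<ge> 1" "\<sigma> \<in> operad sC n" for n \<sigma>
    using that coboundary_regular by (simp add: operadic_coboundary_eq operad_def)
  have "?\<delta> 0 0 = 0" by (rule dendriform_bicomodule.coboundary_0[OF reg])
  then have "gerstenhaber_algebra (cohomology (cochains sC sC) ?\<delta>) (coboundaries (cochains sC sC) ?\<delta>)
    (\<lambda>n. induced2 (coboundaries (cochains sC sC) ?\<delta> n) (+))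
    (\<lambda>n a. induced1 (coboundaries (cochains sC sC) ?\<delta> n) (cscale a))
    (\<lambda>m n. induced2 (coboundaries (cochains sC sC) ?\<delta> (m + n)) (mult_prod sC (pair_family dl dr) m n))
    (\<lambda>m n. induced2 (coboundaries (cochains sC sC) ?\<delta> (m + n - 1)) (bracket sC m n))"
    by (intro gerstenhaber_operad[OF vector_space_axioms mult] \<delta>) (simp_all add: operad_def)
  with reg mult \<delta> dendriform_bicomodule.coboundary_squared show ?thesis
    unfolding Let_def by (auto simp: operad_def)
qed

end
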